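(* Let $K$ be a field, let $m\ge n\ge1$ be integers, and let $J_G\subset S$ be the binomial edge ideal of the complete bipartite graph $G=K_{m,n}$. Put $p=m$ if $n=1$, and $p=2m+n-2$ if $m\ge n>1$. Then the Betti diagram of $S/J_G$ has the form $$\begin{array}{c|ccccc} & 0 & 1 & 2 & \cdots & p\\ \hline 0 & 1 & 0 & 0 & \cdots & 0\\ 1 & 0 & mn & 0 & \cdots & 0\\ 2 & 0 & 0 & \beta_{2,2} & \cdots & \beta_{p,2}\end{array}$$ That is, $\beta_{0,0}(S/J_G)=1$, $\beta_{1,1}(S/J_G)=mn$, and every other graded Betti number $\beta_{i,j}(S/J_G)$ is zero except possibly those with $j=2$ and $2\le i\le p$.
   Context: $S=K[x_1,\dots,x_{m+n},y_1,\dots,y_{m+n}]$ with the standard grading. $G=K_{m,n}$ is the complete bipartite graph on $\{1,\dots,m+n\}$ with parts $\{1,\dots,n\}$ and $\{n+1,\dots,n+m\}$; $J_G$ is the ideal generated by all $x_iy_j-x_jy_i$ with $i<j$ and $\{i,j\}$ an edge of $G$. The graded Betti numbers of a finitely generated graded $S$-module $M$ are $\beta_{i,j}(M)=\dim_K\operatorname{Tor}_i^S(K,M)_{i+j}$; in the Betti diagram, columns are indexed by $i$ and rows by $j$. *)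

theory Defs
  imports Complex_Main "HOL-Library.Poly_Mapping" "HOL-Library.Function_Algebras"
begin

section \<open>The polynomial ring\<close>

datatype var = VX nat | VY nat

text \<open>Exponent vectors are finitely supported maps \<open>var \<Rightarrow>\<^sub>0 nat\<close>; a polynomial is a finitely
  supported map from exponent vectors to coefficients, with the convolution product of
  \<open>Poly_Mapping\<close>.  The type has infinitely many variables; \<open>polys N\<close> is the subring
  $S = K[x_1,\dots,x_N,y_1,\dots,y_N]$.\<close>

type_synonym 'k mpoly = "(var \<Rightarrow>\<^sub>0 nat) \<Rightarrow>\<^sub>0 'k"

definition const_poly :: "'k::field \<Rightarrow> 'k mpoly" where
  "const_poly c = Poly_Mapping.single 0 c"

definition var_poly :: "var \<Rightarrow> 'k::field mpoly" where
  "var_poly v = Poly_Mapping.single (Poly_Mapping.single v 1) 1"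

definition polys :: "nat \<Rightarrow> 'k::field mpoly set" where
  "polys N = {f. \<forall>t \<in> Poly_Mapping.keys f. Poly_Mapping.keys t \<subseteq> VX ` {1..N} \<union> VY ` {1..N}}"

definition mon_deg :: "(var \<Rightarrow>\<^sub>0 nat) \<Rightarrow> nat" where
  "mon_deg t = (\<Sum>v\<in>Poly_Mapping.keys t. Poly_Mapping.lookup t v)"

text \<open>The homogeneous component \<open>S\<^sub>d\<close> (which contains \<open>0\<close>, and is \<open>{0}\<close> for negative \<open>d\<close>).\<close>

definition hom_polys :: "nat \<Rightarrow> int \<Rightarrow> 'k::field mpoly set" where
  "hom_polys N d = {f \<in> polys N. \<forall>t \<in> Poly_Mapping.keys f. int (mon_deg t) = d}"

definition ideal_gen :: "nat \<Rightarrow> 'k::field mpoly set \<Rightarrow> 'k mpoly set" where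
  "ideal_gen N A = {\<Sum>g\<in>B. c g * g | B c. finite B \<and> B \<subseteq> A \<and> (\<forall>g\<in>B. c g \<in> polys N)}"


section \<open>Binomial edge ideals\<close>

text \<open>A graph on \<open>{1..N}\<close> is given by its set \<open>E\<close> of edges, each a two-element set.\<close>

definition binomial_edge_ideal :: "nat \<Rightarrow> nat set set \<Rightarrow> 'k::field mpoly set" where
  "binomial_edge_ideal N E =
     ideal_gen N {var_poly (VX i) * var_poly (VY j) - var_poly (VX j) * var_poly (VY i) | i j.
                    i \<in> {1..N} \<and> j \<in> {1..N} \<and> i < j \<and> {i, j} \<in> E}"

definition complete_bipartite_edges :: "nat \<Rightarrow> nat \<Rightarrow> nat set set" where
  "complete_bipartite_edges m n = {{i, j} | i j. i \<in> {1..n} \<and> j \<in> {n+1..n+m}}"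


section \<open>Graded free resolutions of the residue field\<close>

text \<open>The data of an augmented sequence $\cdots \to F_1 \to F_0 \to K \to 0$ of finitely generated
  graded free modules $F_i = \bigoplus_{b < r_i} S(-\delta_i(b))$: here $r_i$ is \<open>rk F i\<close>, and
  $\delta_i(b)$, the degree of the \<open>b\<close>-th basis element of $F_i$, is \<open>gdeg F i b\<close>.
  The matrix of $F_{i+1} \to F_i$ has the entries \<open>entry F i a b\<close> (row \<open>a\<close>, column \<open>b\<close>), and
  \<open>aug F b\<close> is the image in $K$ of the \<open>b\<close>-th basis element of $F_0$.
  An element of $F_i$ is its coordinate function, extended by \<open>0\<close> beyond $r_i$.\<close>

record (overloaded) 'k free_complex =
  rk :: "nat \<Rightarrow> nat"
  gdeg :: "nat \<Rightarrow> nat \<Rightarrow> int"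
  entry :: "nat \<Rightarrow> nat \<Rightarrow> nat \<Rightarrow> 'k mpoly"
  aug :: "nat \<Rightarrow> 'k"

definition free_module :: "nat \<Rightarrow> 'k::field free_complex \<Rightarrow> nat \<Rightarrow> (nat \<Rightarrow> 'k mpoly) set" where
  "free_module N F i = {v. (\<forall>b < rk F i. v b \<in> polys N) \<and> (\<forall>b \<ge> rk F i. v b = 0)}"

definition free_module_part ::
    "nat \<Rightarrow> 'k::field free_complex \<Rightarrow> nat \<Rightarrow> int \<Rightarrow> (nat \<Rightarrow> 'k mpoly) set" where
  "free_module_part N F i d =
     {v \<in> free_module N F i. \<forall>b < rk F i. v b \<in> hom_polys N (d - gdeg F i b)}"

definition bdry ::
    "'k::field free_complex \<Rightarrow> nat \<Rightarrow> (nat \<Rightarrow> 'k mpoly) \<Rightarrow> (nat \<Rightarrow> 'k mpoly)" where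
  "bdry F i v = (\<lambda>a. if a < rk F i then \<Sum>b < rk F (Suc i). entry F i a b * v b else 0)"

text \<open>A polynomial acts on $K = S/(x_1,\dots,x_N,y_1,\dots,y_N)$ through its constant
  coefficient.\<close>

definition augmentation :: "'k::field free_complex \<Rightarrow> (nat \<Rightarrow> 'k mpoly) \<Rightarrow> 'k" where
  "augmentation F v = (\<Sum>b < rk F 0. Poly_Mapping.lookup (v b) 0 * aug F b)"

text \<open>The first two conditions say that the maps are homogeneous of degree \<open>0\<close>, with \<open>K\<close>
  concentrated in degree \<open>0\<close>; the others say that the sequence is exact.\<close>

definition graded_free_resolution :: "nat \<Rightarrow> 'k::field free_complex \<Rightarrow> bool" where
  "graded_free_resolution N F \<longleftrightarrow>
     (\<forall>i. \<forall>a < rk F i. \<forall>b < rk F (Suc i).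
        entry F i a b \<in> hom_polys N (gdeg F (Suc i) b - gdeg F i a)) \<and>
     (\<forall>b < rk F 0. aug F b \<noteq> 0 \<longrightarrow> gdeg F 0 b = 0) \<and>
     augmentation F ` free_module N F 0 = UNIV \<and>
     bdry F 0 ` free_module N F 1 = {v \<in> free_module N F 0. augmentation F v = 0} \<and>
     (\<forall>i. bdry F (Suc i) ` free_module N F (Suc (Suc i)) =
            {v \<in> free_module N F (Suc i). bdry F i v = 0})"


section \<open>Tor and graded Betti numbers\<close>

definition vscale :: "'k::field \<Rightarrow> (nat \<Rightarrow> 'k mpoly) \<Rightarrow> (nat \<Rightarrow> 'k mpoly)" where
  "vscale c v = (\<lambda>b. const_poly c * v b)"

interpretation coord: vector_space "vscale :: 'k::field \<Rightarrow> _"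
  by unfold_locales
    (auto simp: vscale_def const_poly_def fun_eq_iff distrib_left distrib_right single_add
      mult_single simp flip: mult.assoc)

text \<open>For a homogeneous ideal \<open>I\<close> of \<open>S\<close>, $F_i \otimes_S S/I = F_i/IF_i$, where $IF_i$ consists of
  the vectors with all coordinates in \<open>I\<close>.  The following are the preimages in the degree \<open>d\<close> part
  of $F_i$ of the cycles and of the boundaries of $F \otimes_S S/I$ in homological degree \<open>i\<close>.\<close>

definition tor_cycles ::
    "nat \<Rightarrow> 'k::field free_complex \<Rightarrow> 'k mpoly set \<Rightarrow> nat \<Rightarrow> int \<Rightarrow> (nat \<Rightarrow> 'k mpoly) set" where
  "tor_cycles N F I i d =
     {v \<in> free_module_part N F i d.
        case i of 0 \<Rightarrow> True | Suc k \<Rightarrow> \<forall>a < rk F k. bdry F k v a \<in> I}"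

definition tor_boundaries ::
    "nat \<Rightarrow> 'k::field free_complex \<Rightarrow> 'k mpoly set \<Rightarrow> nat \<Rightarrow> int \<Rightarrow> (nat \<Rightarrow> 'k mpoly) set" where
  "tor_boundaries N F I i d =
     {bdry F i u + w | u w. u \<in> free_module_part N F (Suc i) d \<and>
        w \<in> free_module_part N F i d \<and> (\<forall>b < rk F i. w b \<in> I)}"

text \<open>$\beta_{i,j}(S/I) = \dim_K \operatorname{Tor}^S_i(K, S/I)_{i+j}$, where
  $\operatorname{Tor}^S_i(K, S/I) = H_i(F \otimes_S S/I)$ for a graded free resolution \<open>F\<close> of \<open>K\<close>;
  Tor does not depend on the choice of \<open>F\<close>.  The boundaries are a subspace of the cycles and both
  are finite-dimensional, so the dimension of the quotient is the difference of the dimensions.\<close>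

definition graded_betti :: "nat \<Rightarrow> 'k::field mpoly set \<Rightarrow> nat \<Rightarrow> int \<Rightarrow> nat" where
  "graded_betti N I i j =
     (let F = (SOME F. graded_free_resolution N F) in
        coord.dim (tor_cycles N F I i (int i + j)) - coord.dim (tor_boundaries N F I i (int i + j)))"

end

(*
  Let V(I, i, d) say that Tor_i(K, S/I) vanishes in degree d, computed with an arbitrary graded free
  resolution F of K. Half-exactness of Tor along the sequences relating I, I : x, I + (x), and I, I',
  I + I', and their intersection, propagates V between homogeneous ideals; since multiplication by a
  variable on F is null-homotopic, a nonzerodivisor x moreover gives V(I + (x), i + 1, d + 1) ==> V(I, i, d).
  Write T(U) for the ideal of the two-minors x_i y_j - x_j y_i of all pairs together with the variables
  of the vertices in U, and let A, B be the parts of the graph. Modulo T(U) the variable x_k (k not in U)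
  is regular, (T(U) + (x_k)) : y_k is generated by variables, and T(U) + (x_k, y_k) = T(U + k); so
  induction on U gives V for T(U). The edge ideal is the intersection of T(empty), (x_a, y_a : a in A) and
  (x_b, y_b : b in B), and the sums of ideals occurring in this intersection are T(A) and T(B). This
  bounds the projective dimension and confines Tor to the rows 0, 1, 2. The rows 0 and 1 in
  homological degree at least 2 vanish because, after comparison with the Koszul complex, they
  reduce to the absence of linear syzygies on the quadrics x_a y_b - x_b y_a. Homological degrees
  0 and 1 are computed directly: Tor_1 is J/mJ, which is spanned by the mn generators.
*)
theory Submission
  imports Defs
begin

section \<open>Polynomials\<close>

text \<open>Every ideal in the induction is spanned by monomials and differences of monomials, and
  such an ideal is encoded by a partition of the monomials into classes. A colon by a variable then
  becomes precomposition of the label, and adjoining a variable kills the classes that contain a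
  multiple of it.

  The constants come from counting. The bound for T(U) is 2|U| + (N - |U| - 1) = N + |U| - 1: the
  variables of U, plus the codimension of the minors of the remaining 2 x (N - |U|) matrix. T(B)
  enters the intersection through a connecting map, which lowers the homological degree by one; this
  gives N + |B| - 2 = 2m + n - 2 and is also the source of row 2. For n = 1 the component of B
  contains T(empty) and drops out together with T(B), and the bound m remains.

  The Betti numbers refer to an unspecified resolution, possibly not minimal. Vanishing is therefore
  an inclusion of cycles in boundaries, and a degree-zero lift of 1 in K stands in for the basis
  vector of a minimal F_0 = S.\<close>

abbreviation lookup :: "('a \<Rightarrow>\<^sub>0 'b::zero) \<Rightarrow> 'a \<Rightarrow> 'b" where "lookup \<equiv> Poly_Mapping.lookup"
abbreviation keys :: "('a \<Rightarrow>\<^sub>0 'b::zero) \<Rightarrow> 'a set" where "keys \<equiv> Poly_Mapping.keys"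
abbreviation single :: "'a \<Rightarrow> 'b \<Rightarrow> 'a \<Rightarrow>\<^sub>0 'b::zero" where "single \<equiv> Poly_Mapping.single"

section \<open>Monomials and polynomials in the 2N variables\<close>

definition vars :: "nat \<Rightarrow> var set" where
  "vars N = VX ` {1..N} \<union> VY ` {1..N}"

definition mons :: "nat \<Rightarrow> (var \<Rightarrow>\<^sub>0 nat) set" where
  "mons N = {t. keys t \<subseteq> vars N}"

lemma finite_vars [simp]: "finite (vars N)"
  by (simp add: vars_def)

lemma keys_add_nat: "keys (s + t) = keys s \<union> keys (t :: 'a \<Rightarrow>\<^sub>0 nat)"
  by (auto simp: in_keys_iff lookup_add)

lemma mons_add_iff [simp]: "s + t \<in> mons N \<longleftrightarrow> s \<in> mons N \<and> t \<in> mons N"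
  by (auto simp: mons_def keys_add_nat)

lemma mons_zero [simp]: "0 \<in> mons N"
  by (simp add: mons_def)

lemma mons_single [simp]: "single v (Suc 0) \<in> mons N \<longleftrightarrow> v \<in> vars N"
  by (simp add: mons_def)

lemma polys_iff: "f \<in> polys N \<longleftrightarrow> keys f \<subseteq> mons N"
  by (auto simp: polys_def mons_def vars_def)

lemma polys_zero [simp]: "0 \<in> polys N"
  by (simp add: polys_iff)

lemma polys_single [simp]: "t \<in> mons N \<Longrightarrow> single t c \<in> polys N"
  by (simp add: polys_iff)

lemma polys_one [simp]: "1 \<in> polys N"
  using polys_single[of 0 N 1] by (simp del: polys_single)

lemma polys_const [simp]: "const_poly c \<in> polys N"
  by (simp add: const_poly_def)

lemma polys_var [simp]: "v \<in> vars N \<Longrightarrow> var_poly v \<in> polys N"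
  by (simp add: var_poly_def)

lemma polys_add [simp]: "f \<in> polys N \<Longrightarrow> g \<in> polys N \<Longrightarrow> f + g \<in> polys N"
  using keys_add[of f g] by (auto simp: polys_iff)

lemma polys_uminus [simp]: "f \<in> polys N \<Longrightarrow> - f \<in> polys N"
  by (auto simp: polys_iff)

lemma polys_diff [simp]: "f \<in> polys N \<Longrightarrow> g \<in> polys N \<Longrightarrow> f - g \<in> polys N"
  using keys_diff[of f g] by (auto simp: polys_iff)

lemma polys_mult [simp]: "f \<in> polys N \<Longrightarrow> g \<in> polys N \<Longrightarrow> f * g \<in> polys N"
  using keys_mult[of f g] by (fastforce simp: polys_iff)

lemma polys_sum [simp]: "(\<And>b. b \<in> A \<Longrightarrow> f b \<in> polys N) \<Longrightarrow> sum f A \<in> polys N"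
  by (induction A rule: infinite_finite_induct) auto

lemma poly_eq_sum_monomials: "f = (\<Sum>t\<in>keys f. single t (lookup f t))"
proof (rule poly_mapping_eqI)
  fix k show "lookup f k = lookup (\<Sum>t\<in>keys f. single t (lookup f t)) k"
    by (cases "k \<in> keys f")
      (auto simp: lookup_sum lookup_single when_def not_in_keys_iff_lookup_eq_zero)
qed

lemma mon_deg_eq_sum: "finite A \<Longrightarrow> keys t \<subseteq> A \<Longrightarrow> mon_deg t = (\<Sum>v\<in>A. lookup t v)"
  unfolding mon_deg_def by (rule sum.mono_neutral_left) (auto simp: in_keys_iff)

lemma mon_deg_add [simp]: "mon_deg (s + t) = mon_deg s + mon_deg t"
  by (simp add: mon_deg_eq_sum[of "keys s \<union> keys t"] keys_add_nat lookup_add sum.distrib)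

lemma mon_deg_single [simp]: "mon_deg (single v e) = e"
  by (simp add: mon_deg_def)

lemma mon_deg_zero [simp]: "mon_deg 0 = 0"
  by (simp add: mon_deg_def)

lemma mon_deg_eq_0_iff [simp]: "mon_deg t = 0 \<longleftrightarrow> t = 0"
  by (auto simp: mon_deg_def in_keys_iff) (metis keys_eq_empty lookup_eq_zero_in_keys_contradict ex_in_conv)

text \<open>These functionals cut out the ideals below: a span of monomials and of differences of
  monomials is a common kernel of such sums, so membership can be tested without exhibiting
  coefficients of generators.\<close>

definition coeff_sum :: "(var \<Rightarrow>\<^sub>0 nat) set \<Rightarrow> 'k::field mpoly \<Rightarrow> 'k" where
  "coeff_sum C f = (\<Sum>t\<in>keys f. lookup f t when t \<in> C)"

lemma coeff_sum_superset:
  "finite A \<Longrightarrow> keys f \<subseteq> A \<Longrightarrow> coeff_sum C f = (\<Sum>t\<in>A. lookup f t when t \<in> C)"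
  unfolding coeff_sum_def by (rule sum.mono_neutral_left) (auto simp: in_keys_iff)

lemma coeff_sum_zero [simp]: "coeff_sum C 0 = 0"
  by (simp add: coeff_sum_def)

lemma coeff_sum_single [simp]: "coeff_sum C (single t c) = (c when t \<in> C)"
  by (simp add: coeff_sum_def)

lemma coeff_sum_add [simp]: "coeff_sum C (f + g) = coeff_sum C f + coeff_sum C g"
  using keys_add[of f g]
  by (simp add: coeff_sum_superset[of "keys f \<union> keys g"] lookup_add when_add_distrib sum.distrib)

lemma coeff_sum_uminus [simp]: "coeff_sum C (- f) = - coeff_sum C f"
  by (simp add: coeff_sum_def when_uminus_distrib sum_negf)

lemma coeff_sum_diff [simp]: "coeff_sum C (f - g) = coeff_sum C f - coeff_sum C g"
  using coeff_sum_add[of C f "- g"] by simp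

lemma coeff_sum_sum: "coeff_sum C (sum f A) = (\<Sum>b\<in>A. coeff_sum C (f b))"
  by (induction A rule: infinite_finite_induct) auto

lemma coeff_sum_singleton: "coeff_sum {t} f = lookup f t"
  by (simp add: coeff_sum_def when_def in_keys_iff)

lemma coeff_sum_cong: "(\<And>t. t \<in> keys f \<Longrightarrow> t \<in> C \<longleftrightarrow> t \<in> D) \<Longrightarrow> coeff_sum C f = coeff_sum D f"
  by (auto simp: coeff_sum_def when_def intro!: sum.cong)

lemma coeff_sum_eq_0: "(\<And>t. t \<in> keys f \<Longrightarrow> t \<notin> C) \<Longrightarrow> coeff_sum C f = 0"
  by (auto simp: coeff_sum_def)

text \<open>Multiplying by a monomial translates the support, so the class is pulled back along the
  translation. Closure under products and the formula for colon ideals both rest on this.\<close>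

lemma coeff_sum_monomial_mult:
  "coeff_sum C (single s c * f) = c * coeff_sum {t. s + t \<in> C} f"
proof -
  have "single s c * f = (\<Sum>t\<in>keys f. single (s + t) (c * lookup f t))"
    by (subst poly_eq_sum_monomials[of f]) (simp add: sum_distrib_left mult_single)
  then show ?thesis
    by (simp add: coeff_sum_sum sum_distrib_left mult_when coeff_sum_def[of _ f])
qed

lemma lookup_monomial_mult [simp]:
  "lookup (single s c * f) (s + t) = c * lookup (f :: 'k::field mpoly) t"
proof -
  have "{u. s + u \<in> {s + t}} = {t}"
    by (auto dest: add_left_imp_eq)
  then show ?thesis
    using coeff_sum_monomial_mult[of "{s + t}" s c f] by (simp only: coeff_sum_singleton)
qed

lemma lookup_monomial_mult_eq_0:
  fixes f :: "'k::field mpoly"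
  assumes "\<And>t. u \<noteq> s + t"
  shows "lookup (single s c * f) u = 0"
proof -
  have "{t. s + t \<in> {u}} = {}"
    using assms by auto
  then show ?thesis
    using coeff_sum_monomial_mult[of "{u}" s c f] by (simp add: coeff_sum_singleton coeff_sum_eq_0)
qed

lemma keys_monomial_mult: "keys (single s c * f) \<subseteq> (+) s ` keys (f :: 'k::field mpoly)"
proof
  fix u assume u: "u \<in> keys (single s c * f)"
  then obtain t where "u = s + t"
    using lookup_monomial_mult_eq_0[of u s c f] by (auto simp: in_keys_iff)
  with u show "u \<in> (+) s ` keys f"
    by (auto simp: in_keys_iff)
qed

text \<open>Exponents are natural numbers, so 0 = s + t forces s = t = 0. Multiplicativity of the
  constant coefficient is what makes the augmentation linear over S.\<close>

lemma lookup_mult_zero: "lookup (f * g) (0 :: var \<Rightarrow>\<^sub>0 nat) = lookup f 0 * (lookup g 0 :: 'k::field)"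
proof -
  have *: "s = 0" if "0 = s + t" for s t :: "var \<Rightarrow>\<^sub>0 nat"
    using arg_cong[OF that, of keys] by (simp add: keys_add_nat)
  have **: "lookup (single s c * g) 0 = lookup (single s c) 0 * lookup g 0" for s c
  proof (cases "s = 0")
    case True
    then show ?thesis using lookup_monomial_mult[of 0 c g 0] by simp
  next
    case False
    then show ?thesis
      using lookup_monomial_mult_eq_0[of 0 s c g] * by (auto simp: lookup_single_not_eq)
  qed
  show ?thesis
    by (subst poly_eq_sum_monomials[of f], subst (3) poly_eq_sum_monomials[of f])
      (simp only: sum_distrib_right lookup_sum **)
qed

section \<open>Restriction to sets of monomials, and homogeneous components\<close>

definition restrict_mons :: "((var \<Rightarrow>\<^sub>0 nat) \<Rightarrow> bool) \<Rightarrow> 'k::field mpoly \<Rightarrow> 'k mpoly" where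
  "restrict_mons P f = Poly_Mapping.mapp (\<lambda>t c. c when P t) f"

lemma lookup_restrict_mons: "lookup (restrict_mons P f) t = (lookup f t when P t)"
  by (auto simp: restrict_mons_def lookup_mapp when_def in_keys_iff)

lemma keys_restrict_mons: "keys (restrict_mons P f) = {t \<in> keys f. P t}"
  by (auto simp: in_keys_iff lookup_restrict_mons)

lemma restrict_mons_add: "restrict_mons P (f + g) = restrict_mons P f + restrict_mons P g"
  by (rule poly_mapping_eqI) (simp add: lookup_restrict_mons lookup_add when_add_distrib)

lemma restrict_mons_zero [simp]: "restrict_mons P 0 = 0"
  by (rule poly_mapping_eqI) (simp add: lookup_restrict_mons)

lemma restrict_mons_sum: "restrict_mons P (sum f A) = (\<Sum>b\<in>A. restrict_mons P (f b))"
  by (induction A rule: infinite_finite_induct) (auto simp: restrict_mons_add)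

lemma restrict_mons_single: "restrict_mons P (single t c) = (if P t then single t c else 0)"
  by (rule poly_mapping_eqI) (auto simp: lookup_restrict_mons lookup_single when_def)

lemma restrict_mons_split: "restrict_mons P f + restrict_mons (\<lambda>t. \<not> P t) f = f"
  by (rule poly_mapping_eqI) (auto simp: lookup_restrict_mons lookup_add when_def)

lemma restrict_mons_polys [simp]: "f \<in> polys N \<Longrightarrow> restrict_mons P f \<in> polys N"
  by (auto simp: polys_iff keys_restrict_mons)

lemma coeff_sum_restrict_mons: "coeff_sum C (restrict_mons P f) = coeff_sum {t \<in> C. P t} f"
proof -
  have "coeff_sum C (restrict_mons P f) = (\<Sum>t\<in>keys f. lookup (restrict_mons P f) t when t \<in> C)"
    by (rule coeff_sum_superset) (auto simp: keys_restrict_mons)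
  then show ?thesis
    by (auto simp: coeff_sum_def lookup_restrict_mons when_def intro!: sum.cong)
qed

definition hom_comp :: "int \<Rightarrow> 'k::field mpoly \<Rightarrow> 'k mpoly" where
  "hom_comp d = restrict_mons (\<lambda>t. int (mon_deg t) = d)"

lemma lookup_hom_comp: "lookup (hom_comp d f) t = (lookup f t when int (mon_deg t) = d)"
  by (simp add: hom_comp_def lookup_restrict_mons)

lemma hom_comp_zero [simp]: "hom_comp d 0 = 0"
  by (simp add: hom_comp_def)

lemma hom_comp_sum: "hom_comp d (sum f A) = (\<Sum>b\<in>A. hom_comp d (f b))"
  by (simp add: hom_comp_def restrict_mons_sum)

lemma hom_comp_add: "hom_comp d (f + g) = hom_comp d f + hom_comp d g"
  by (simp add: hom_comp_def restrict_mons_add)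

lemma hom_polysD: "f \<in> hom_polys N d \<Longrightarrow> f \<in> polys N"
  by (simp add: hom_polys_def)

lemma hom_comp_in [simp]: "f \<in> polys N \<Longrightarrow> hom_comp d f \<in> hom_polys N d"
  by (simp add: hom_polys_def hom_comp_def) (simp add: keys_restrict_mons)

lemma hom_comp_id: "f \<in> hom_polys N d \<Longrightarrow> hom_comp d f = f"
  by (rule poly_mapping_eqI) (auto simp: lookup_hom_comp hom_polys_def when_def in_keys_iff)

lemma hom_polys_lookup: "f \<in> hom_polys N d \<Longrightarrow> int (mon_deg t) \<noteq> d \<Longrightarrow> lookup f t = 0"
  by (auto simp: hom_polys_def in_keys_iff)

lemma hom_comp_mult:
  assumes "a \<in> hom_polys N e"
  shows "hom_comp d (a * f) = a * hom_comp (d - e) f"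
proof -
  have *: "hom_comp d (single s c * single t c') = single s c * hom_comp (d - e) (single t c')"
    if "s \<in> keys a" for s t and c c' :: 'a
    using that assms
    by (auto simp: hom_polys_def mult_single hom_comp_def restrict_mons_single)
  have **: "hom_comp d (single s c * f) = single s c * hom_comp (d - e) f" if "s \<in> keys a" for s c
    by (subst (1 2) poly_eq_sum_monomials[of f])
      (simp only: sum_distrib_left hom_comp_sum *[OF that])
  show ?thesis
    by (subst (1 2) poly_eq_sum_monomials[of a])
      (simp add: sum_distrib_right hom_comp_sum ** cong: sum.cong)
qed

lemma hom_polys_zero [simp]: "0 \<in> hom_polys N d"
  by (simp add: hom_polys_def)

lemma hom_polys_add [simp]: "f \<in> hom_polys N d \<Longrightarrow> g \<in> hom_polys N d \<Longrightarrow> f + g \<in> hom_polys N d"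
  using keys_add[of f g] by (auto simp: hom_polys_def)

lemma hom_polys_uminus [simp]: "f \<in> hom_polys N d \<Longrightarrow> - f \<in> hom_polys N d"
  by (auto simp: hom_polys_def)

lemma hom_polys_diff [simp]: "f \<in> hom_polys N d \<Longrightarrow> g \<in> hom_polys N d \<Longrightarrow> f - g \<in> hom_polys N d"
  using keys_diff[of f g] by (auto simp: hom_polys_def)

lemma hom_polys_sum [simp]: "(\<And>b. b \<in> A \<Longrightarrow> f b \<in> hom_polys N d) \<Longrightarrow> sum f A \<in> hom_polys N d"
  by (induction A rule: infinite_finite_induct) auto

lemma hom_polys_mult:
  assumes "f \<in> hom_polys N d" "g \<in> hom_polys N e"
  shows "f * g \<in> hom_polys N (d + e)"
proof -
  have "hom_comp (d + e) (f * g) = f * g"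
    using assms by (simp add: hom_comp_mult hom_comp_id)
  moreover have "f * g \<in> polys N"
    using assms by (simp add: hom_polysD)
  ultimately show ?thesis
    by (metis hom_comp_in)
qed

lemma hom_polys_single: "t \<in> mons N \<Longrightarrow> d = int (mon_deg t) \<Longrightarrow> single t c \<in> hom_polys N d"
  by (simp add: hom_polys_def)

lemma hom_polys_one [simp]: "1 \<in> hom_polys N 0"
  by (auto simp: hom_polys_def)

lemma hom_polys_const [simp]: "const_poly c \<in> hom_polys N 0"
  by (auto simp: hom_polys_def const_poly_def)

lemma hom_polys_var [simp]: "v \<in> vars N \<Longrightarrow> var_poly v \<in> hom_polys N 1"
  by (simp add: var_poly_def hom_polys_single)

section \<open>Vectors of polynomials\<close>

definition smult :: "'k::field mpoly \<Rightarrow> (nat \<Rightarrow> 'k mpoly) \<Rightarrow> (nat \<Rightarrow> 'k mpoly)" where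
  "smult p v = (\<lambda>b. p * v b)"

definition vunit :: "nat \<Rightarrow> nat \<Rightarrow> 'k::field mpoly" where
  "vunit b = (\<lambda>a. if a = b then 1 else 0)"

text \<open>\<open>M b\<close> is the image of the \<open>b\<close>-th basis vector, so
  \<open>lin r M\<close> is the linear extension of a map given on a basis. Chain maps and
  homotopies are stored in this form.\<close>

definition lin :: "nat \<Rightarrow> (nat \<Rightarrow> nat \<Rightarrow> 'k::field mpoly) \<Rightarrow> (nat \<Rightarrow> 'k mpoly) \<Rightarrow> (nat \<Rightarrow> 'k mpoly)" where
  "lin r M v = (\<lambda>a. \<Sum>b<r. v b * M b a)"

lemma smult_apply [simp]: "smult p v b = p * v b"
  by (simp add: smult_def)

lemma lin_zero [simp]: "lin r M 0 = 0"
  by (simp add: lin_def fun_eq_iff)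

lemma lin_add: "lin r M (v + w) = lin r M v + lin r M w"
  by (simp add: lin_def fun_eq_iff distrib_right sum.distrib)

lemma lin_diff_matrix: "lin r (\<lambda>b. M b - M' b) v = lin r M v - lin r M' v"
  by (simp add: lin_def fun_eq_iff right_diff_distrib sum_subtractf)

lemma lin_lin: "lin r' L (lin r M v) = lin r (\<lambda>b. lin r' L (M b)) v"
proof
  fix a
  have "lin r' L (lin r M v) a = (\<Sum>c<r'. \<Sum>b<r. v b * M b c * L c a)"
    by (simp add: lin_def sum_distrib_right)
  also have "\<dots> = (\<Sum>b<r. \<Sum>c<r'. v b * M b c * L c a)"
    by (rule sum.swap)
  also have "\<dots> = lin r (\<lambda>b. lin r' L (M b)) v a"
    by (simp add: lin_def sum_distrib_left mult.assoc)
  finally show "lin r' L (lin r M v) a = lin r (\<lambda>b. lin r' L (M b)) v a" .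
qed

lemma lin_vunit [simp]: "b < r \<Longrightarrow> lin r M (vunit b) = M b"
  by (simp add: lin_def fun_eq_iff vunit_def if_distrib[of "\<lambda>x. x * _"] cong: if_cong)

lemma lin_cong: "(\<And>b. b < r \<Longrightarrow> M b = M' b) \<Longrightarrow> lin r M v = lin r M' v"
  by (simp add: lin_def)

lemma lin_smult_vunit: "(\<And>b. r \<le> b \<Longrightarrow> v b = 0) \<Longrightarrow> lin r (\<lambda>b. smult p (vunit b)) v = smult p v"
  by (force simp: lin_def fun_eq_iff vunit_def if_distrib[of "\<lambda>x. _ * x"] mult.commute cong: if_cong)

lemma lin_id: "(\<And>b. r \<le> b \<Longrightarrow> v b = 0) \<Longrightarrow> lin r vunit v = v"
  using lin_smult_vunit[of r v 1] by (simp add: smult_def)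

lemma bdry_lin: "bdry G i (lin r M v) = lin r (\<lambda>b. bdry G i (M b)) v"
proof
  fix a
  have "(\<Sum>c<rk G (Suc i). entry G i a c * (\<Sum>b<r. v b * M b c))
      = (\<Sum>c<rk G (Suc i). \<Sum>b<r. v b * (entry G i a c * M b c))"
    by (simp add: sum_distrib_left mult.left_commute)
  also have "\<dots> = (\<Sum>b<r. \<Sum>c<rk G (Suc i). v b * (entry G i a c * M b c))"
    by (rule sum.swap)
  finally show "bdry G i (lin r M v) a = lin r (\<lambda>b. bdry G i (M b)) v a"
    by (simp add: bdry_def lin_def sum_distrib_left)
qed

lemma free_moduleI: "v \<in> free_module_part N F i d \<Longrightarrow> v \<in> free_module N F i"
  by (simp add: free_module_part_def)

lemma free_module_outside: "v \<in> free_module N F i \<Longrightarrow> rk F i \<le> b \<Longrightarrow> v b = 0"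
  by (simp add: free_module_def)

lemma bdry_eq_lin:
  assumes "v \<in> free_module N F (Suc i)"
  shows "bdry F i v = lin (rk F (Suc i)) (\<lambda>b. bdry F i (vunit b)) v"
  using bdry_lin[of F i "rk F (Suc i)" vunit v] assms by (simp add: lin_id free_module_outside)

lemma bdry_zero [simp]: "bdry F i 0 = 0"
  by (simp add: bdry_def fun_eq_iff)

lemma bdry_add: "bdry F i (v + w) = bdry F i v + bdry F i w"
  by (simp add: bdry_def fun_eq_iff distrib_left sum.distrib)

lemma bdry_uminus: "bdry F i (- v) = - bdry F i v"
  by (simp add: bdry_def fun_eq_iff sum_negf)

lemma bdry_diff: "bdry F i (v - w) = bdry F i v - bdry F i w"
  using bdry_add[of F i v "- w"] by (simp add: bdry_uminus)

lemma bdry_smult: "bdry F i (smult p v) = smult p (bdry F i v)"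
  by (simp add: bdry_def fun_eq_iff sum_distrib_left mult.left_commute)

lemma part_iff: "v \<in> free_module_part N F i d \<longleftrightarrow>
    (\<forall>b < rk F i. v b \<in> hom_polys N (d - gdeg F i b)) \<and> (\<forall>b \<ge> rk F i. v b = 0)"
  by (auto simp: free_module_part_def free_module_def hom_polysD)

lemma part_zero [simp]: "0 \<in> free_module_part N F i d"
  by (simp add: part_iff)

lemma part_add [simp]:
  "v \<in> free_module_part N F i d \<Longrightarrow> w \<in> free_module_part N F i d \<Longrightarrow> v + w \<in> free_module_part N F i d"
  by (simp add: part_iff)

lemma part_diff [simp]:
  "v \<in> free_module_part N F i d \<Longrightarrow> w \<in> free_module_part N F i d \<Longrightarrow> v - w \<in> free_module_part N F i d"
  by (simp add: part_iff)

lemma part_smult: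
  assumes "p \<in> hom_polys N e" "v \<in> free_module_part N F i d"
  shows "smult p v \<in> free_module_part N F i (d + e)"
  using assms hom_polys_mult[OF assms(1)] by (fastforce simp: part_iff algebra_simps)

lemma part_vunit: "b < rk F i \<Longrightarrow> vunit b \<in> free_module_part N F i (gdeg F i b)"
  by (auto simp: part_iff vunit_def)

lemma lin_part:
  assumes "\<And>b. b < rk F i \<Longrightarrow> M b \<in> free_module_part N G j (gdeg F i b + e)"
    and "v \<in> free_module_part N F i d"
  shows "lin (rk F i) M v \<in> free_module_part N G j (d + e)"
proof -
  have "v b * M b a \<in> hom_polys N (d + e - gdeg G j a)" if "b < rk F i" "a < rk G j" for a b
    using hom_polys_mult[of "v b" N "d - gdeg F i b" "M b a" "gdeg F i b + e - gdeg G j a"]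
      assms that by (simp add: part_iff algebra_simps)
  moreover have "M b a = 0" if "b < rk F i" "a \<ge> rk G j" for a b
    using assms that by (simp add: part_iff)
  ultimately show ?thesis
    by (auto simp: part_iff lin_def intro!: hom_polys_sum)
qed

lemma part_polys: "v \<in> free_module_part N F i d \<Longrightarrow> v b \<in> polys N"
  using free_moduleI[of v N F i d] by (cases "b < rk F i") (auto simp: free_module_def)

definition hom_part :: "'k::field free_complex \<Rightarrow> nat \<Rightarrow> int \<Rightarrow> (nat \<Rightarrow> 'k mpoly) \<Rightarrow> (nat \<Rightarrow> 'k mpoly)" where
  "hom_part F i d v = (\<lambda>b. hom_comp (d - gdeg F i b) (v b))"

lemma hom_part_in: "v \<in> free_module N F i \<Longrightarrow> hom_part F i d v \<in> free_module_part N F i d"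
  by (auto simp: part_iff free_module_def hom_part_def)

lemma hom_part_id: "v \<in> free_module_part N F i d \<Longrightarrow> hom_part F i d v = v"
proof
  fix b
  assume "v \<in> free_module_part N F i d"
  then show "hom_part F i d v b = v b"
    by (cases "b < rk F i") (auto simp: part_iff hom_part_def hom_comp_id)
qed

section \<open>Homogeneous ideals\<close>

definition hideal :: "nat \<Rightarrow> 'k::field mpoly set \<Rightarrow> bool" where
  "hideal N I \<longleftrightarrow> I \<subseteq> polys N \<and> 0 \<in> I \<and> (\<forall>f\<in>I. \<forall>g\<in>I. f + g \<in> I) \<and>
     (\<forall>f\<in>I. \<forall>p\<in>polys N. p * f \<in> I) \<and> (\<forall>f\<in>I. \<forall>d. hom_comp d f \<in> I)"

lemma hideal_polys: "hideal N I \<Longrightarrow> f \<in> I \<Longrightarrow> f \<in> polys N"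
  by (auto simp: hideal_def)

lemma hideal_zero: "hideal N I \<Longrightarrow> 0 \<in> I"
  by (auto simp: hideal_def)

lemma hideal_add: "hideal N I \<Longrightarrow> f \<in> I \<Longrightarrow> g \<in> I \<Longrightarrow> f + g \<in> I"
  by (auto simp: hideal_def)

lemma hideal_mult: "hideal N I \<Longrightarrow> f \<in> I \<Longrightarrow> p \<in> polys N \<Longrightarrow> p * f \<in> I"
  by (auto simp: hideal_def)

lemma hideal_hom_comp: "hideal N I \<Longrightarrow> f \<in> I \<Longrightarrow> hom_comp d f \<in> I"
  by (auto simp: hideal_def)

lemma hideal_uminus: "hideal N I \<Longrightarrow> f \<in> I \<Longrightarrow> - f \<in> I"
  using hideal_mult[of N I f "- 1"] by simp

lemma hideal_diff: "hideal N I \<Longrightarrow> f \<in> I \<Longrightarrow> g \<in> I \<Longrightarrow> f - g \<in> I"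
  using hideal_add[of N I f "- g"] by (simp add: hideal_uminus)

lemma hideal_sum: "hideal N I \<Longrightarrow> (\<And>b. b \<in> A \<Longrightarrow> f b \<in> I) \<Longrightarrow> sum f A \<in> I"
  by (induction A rule: infinite_finite_induct) (auto simp: hideal_zero hideal_add)

definition ideal_colon :: "nat \<Rightarrow> 'k::field mpoly set \<Rightarrow> 'k mpoly \<Rightarrow> 'k mpoly set" where
  "ideal_colon N I x = {g \<in> polys N. x * g \<in> I}"

definition ideal_adjoin :: "nat \<Rightarrow> 'k::field mpoly set \<Rightarrow> 'k mpoly \<Rightarrow> 'k mpoly set" where
  "ideal_adjoin N I x = {f + x * g | f g. f \<in> I \<and> g \<in> polys N}"

definition ideal_sum :: "'k::field mpoly set \<Rightarrow> 'k mpoly set \<Rightarrow> 'k mpoly set" where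
  "ideal_sum I I' = {f + g | f g. f \<in> I \<and> g \<in> I'}"

definition in_ideal :: "'k::field mpoly set \<Rightarrow> 'k free_complex \<Rightarrow> nat \<Rightarrow> (nat \<Rightarrow> 'k mpoly) \<Rightarrow> bool" where
  "in_ideal I F i v \<longleftrightarrow> (\<forall>b<rk F i. v b \<in> I)"

lemma in_ideal_zero [simp]: "hideal N I \<Longrightarrow> in_ideal I F i 0"
  by (simp add: in_ideal_def hideal_zero)

lemma in_ideal_add: "hideal N I \<Longrightarrow> in_ideal I F i v \<Longrightarrow> in_ideal I F i w \<Longrightarrow> in_ideal I F i (v + w)"
  by (simp add: in_ideal_def hideal_add)

lemma in_ideal_diff: "hideal N I \<Longrightarrow> in_ideal I F i v \<Longrightarrow> in_ideal I F i w \<Longrightarrow> in_ideal I F i (v - w)"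
  by (simp add: in_ideal_def hideal_diff)

lemma in_ideal_lin:
  assumes "hideal N I" "in_ideal I F i v" "\<And>b a. b < rk F i \<Longrightarrow> M b a \<in> polys N"
  shows "lin (rk F i) M v a \<in> I"
  unfolding lin_def using assms hideal_mult[OF assms(1), of "v _" "M _ a"]
  by (intro hideal_sum[OF assms(1)]) (simp add: in_ideal_def mult.commute)

text \<open>A representation f + x g chosen coordinate by coordinate need not be homogeneous;
  passing to the homogeneous components of the right degrees repairs this. The second vector has
  degree d - 1 because x has degree one.\<close>

lemma in_ideal_adjoin_split:
  assumes I: "hideal N I" and x: "x \<in> hom_polys N 1"
    and v: "v \<in> free_module_part N F i d" "in_ideal (ideal_adjoin N I x) F i v"
  obtains v1 v2 where "v1 \<in> free_module_part N F i d" "in_ideal I F i v1"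
    "v2 \<in> free_module_part N F i (d - 1)" "v = v1 + smult x v2"
proof -
  have "\<exists>f g. f \<in> I \<and> f \<in> hom_polys N (d - gdeg F i b) \<and> g \<in> hom_polys N (d - 1 - gdeg F i b)
      \<and> v b = f + x * g" if b: "b < rk F i" for b
  proof -
    let ?e = "d - gdeg F i b"
    obtain f g where fg: "f \<in> I" "g \<in> polys N" "v b = f + x * g"
      using v(2) b by (auto simp: in_ideal_def ideal_adjoin_def)
    have "v b = hom_comp ?e (v b)"
      using v(1) b by (intro hom_comp_id[of _ N, symmetric]) (simp add: part_iff)
    also have "\<dots> = hom_comp ?e f + x * hom_comp (?e - 1) g"
      by (simp add: fg hom_comp_add hom_comp_mult[OF x])
    finally show ?thesis
      using fg I by (intro exI[of _ "hom_comp ?e f"] exI[of _ "hom_comp (?e - 1) g"])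
        (auto simp: hideal_hom_comp hideal_polys[OF I] algebra_simps)
  qed
  then obtain f g where fg: "\<And>b. b < rk F i \<Longrightarrow> f b \<in> I \<and> f b \<in> hom_polys N (d - gdeg F i b)
      \<and> g b \<in> hom_polys N (d - 1 - gdeg F i b) \<and> v b = f b + x * g b"
    by metis
  show ?thesis
  proof (rule that[of "\<lambda>b. if b < rk F i then f b else 0" "\<lambda>b. if b < rk F i then g b else 0"])
    show "v = (\<lambda>b. if b < rk F i then f b else 0) + smult x (\<lambda>b. if b < rk F i then g b else 0)"
      using v(1) fg by (auto simp: part_iff fun_eq_iff)
  qed (use fg in \<open>auto simp: part_iff in_ideal_def\<close>)
qed

lemma in_ideal_sum_split:
  assumes I: "hideal N I" and I': "hideal N I'"
    and v: "v \<in> free_module_part N F i d" "in_ideal (ideal_sum I I') F i v"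
  obtains v1 v2 where "v1 \<in> free_module_part N F i d" "in_ideal I F i v1"
    "v2 \<in> free_module_part N F i d" "in_ideal I' F i v2" "v = v1 + v2"
proof -
  have "\<exists>f g. f \<in> I \<and> f \<in> hom_polys N (d - gdeg F i b) \<and> g \<in> I' \<and> g \<in> hom_polys N (d - gdeg F i b)
      \<and> v b = f + g" if b: "b < rk F i" for b
  proof -
    let ?e = "d - gdeg F i b"
    obtain f g where fg: "f \<in> I" "g \<in> I'" "v b = f + g"
      using v(2) b by (auto simp: in_ideal_def ideal_sum_def)
    have "v b = hom_comp ?e (v b)"
      using v(1) b by (intro hom_comp_id[of _ N, symmetric]) (simp add: part_iff)
    also have "\<dots> = hom_comp ?e f + hom_comp ?e g"
      by (simp add: fg hom_comp_add)
    finally show ?thesis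
      using fg I I' by (intro exI[of _ "hom_comp ?e f"] exI[of _ "hom_comp ?e g"])
        (auto simp: hideal_hom_comp hideal_polys[OF I] hideal_polys[OF I'])
  qed
  then obtain f g where fg: "\<And>b. b < rk F i \<Longrightarrow> f b \<in> I \<and> f b \<in> hom_polys N (d - gdeg F i b)
      \<and> g b \<in> I' \<and> g b \<in> hom_polys N (d - gdeg F i b) \<and> v b = f b + g b"
    by metis
  show ?thesis
  proof (rule that[of "\<lambda>b. if b < rk F i then f b else 0" "\<lambda>b. if b < rk F i then g b else 0"])
    show "v = (\<lambda>b. if b < rk F i then f b else 0) + (\<lambda>b. if b < rk F i then g b else 0)"
      using v(1) fg by (auto simp: part_iff fun_eq_iff)
  qed (use fg in \<open>auto simp: part_iff in_ideal_def\<close>)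
qed

section \<open>Resolutions\<close>

text \<open>Extending the boundary by zero in homological degree 0 lets the diagram chases treat all
  degrees alike. At i = 0 the truncated index \<open>i - 1\<close> is again 0, which is harmless
  because the value is the zero vector.\<close>

definition diff :: "'k::field free_complex \<Rightarrow> nat \<Rightarrow> (nat \<Rightarrow> 'k mpoly) \<Rightarrow> (nat \<Rightarrow> 'k mpoly)" where
  "diff F i v = (case i of 0 \<Rightarrow> 0 | Suc k \<Rightarrow> bdry F k v)"

lemma diff_0 [simp]: "diff F 0 v = 0"
  by (simp add: diff_def)

lemma diff_Suc [simp]: "diff F (Suc i) v = bdry F i v"
  by (simp add: diff_def)

lemma diff_add: "diff F i (v + w) = diff F i v + diff F i w"
  by (cases i) (simp_all add: bdry_add)

lemma diff_diff: "diff F i (v - w) = diff F i v - diff F i w"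
  by (cases i) (simp_all add: bdry_diff)

lemma diff_smult: "diff F i (smult p v) = smult p (diff F i v)"
  by (cases i) (simp_all add: bdry_smult, simp add: fun_eq_iff)

lemma tor_cycles_eq:
  assumes "hideal N I"
  shows "tor_cycles N F I i d = {v \<in> free_module_part N F i d. in_ideal I F (i - 1) (diff F i v)}"
  using assms by (cases i) (auto simp: tor_cycles_def in_ideal_def hideal_zero)

lemma tor_boundaries_eq: "tor_boundaries N F I i d = {bdry F i u + w | u w.
    u \<in> free_module_part N F (Suc i) d \<and> w \<in> free_module_part N F i d \<and> in_ideal I F i w}"
  by (simp add: tor_boundaries_def in_ideal_def)

text \<open>An inclusion rather than a statement about dimensions: this is the form that diagram
  chases consume and produce.\<close>

definition tor_vanishes :: "nat \<Rightarrow> 'k::field free_complex \<Rightarrow> 'k mpoly set \<Rightarrow> nat \<Rightarrow> int \<Rightarrow> bool" where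
  "tor_vanishes N F I i d \<longleftrightarrow> tor_cycles N F I i d \<subseteq> tor_boundaries N F I i d"

lemma tor_vanishesI:
  assumes "hideal N I"
    and "\<And>z. z \<in> free_module_part N F i d \<Longrightarrow> in_ideal I F (i - 1) (diff F i z) \<Longrightarrow>
      \<exists>u w. u \<in> free_module_part N F (Suc i) d \<and> w \<in> free_module_part N F i d \<and> in_ideal I F i w
        \<and> z = bdry F i u + w"
  shows "tor_vanishes N F I i d"
  using assms(2) unfolding tor_vanishes_def tor_cycles_eq[OF assms(1)] tor_boundaries_eq by blast

lemma tor_vanishesE:
  assumes "tor_vanishes N F I i d" "hideal N I"
    and "z \<in> free_module_part N F i d" "in_ideal I F (i - 1) (diff F i z)"
  obtains u w where "u \<in> free_module_part N F (Suc i) d" "w \<in> free_module_part N F i d"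
    "in_ideal I F i w" "z = bdry F i u + w"
  using assms(1,3,4) unfolding tor_vanishes_def tor_cycles_eq[OF assms(2)] tor_boundaries_eq by blast

locale resolution =
  fixes N :: nat and F :: "'k::field free_complex"
  assumes resolution: "graded_free_resolution N F"
begin

abbreviation part :: "nat \<Rightarrow> int \<Rightarrow> (nat \<Rightarrow> 'k mpoly) set" where
  "part \<equiv> free_module_part N F"

lemma entry_hom: "a < rk F i \<Longrightarrow> b < rk F (Suc i) \<Longrightarrow>
    entry F i a b \<in> hom_polys N (gdeg F (Suc i) b - gdeg F i a)"
  using resolution by (simp add: graded_free_resolution_def)

lemma bdry_part: "v \<in> part (Suc i) d \<Longrightarrow> bdry F i v \<in> part i d"
proof -
  assume v: "v \<in> part (Suc i) d"
  have "entry F i a b * v b \<in> hom_polys N (d - gdeg F i a)" if "a < rk F i" "b < rk F (Suc i)" for a b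
    using hom_polys_mult[OF entry_hom[OF that], of "v b" "d - gdeg F (Suc i) b"] v that
    by (simp add: part_iff)
  then show ?thesis
    by (auto simp: part_iff bdry_def intro!: hom_polys_sum)
qed

lemma diff_part: "v \<in> part i d \<Longrightarrow> diff F i v \<in> part (i - 1) d"
  by (cases i) (auto simp: bdry_part)

lemma bdry_in_ideal:
  assumes "hideal N I" "in_ideal I F (Suc i) v"
  shows "in_ideal I F i (bdry F i v)"
  using assms entry_hom[THEN hom_polysD]
  by (auto simp: in_ideal_def bdry_def intro!: hideal_sum hideal_mult)

lemma diff_in_ideal:
  assumes "hideal N I" "in_ideal I F i v"
  shows "in_ideal I F (i - 1) (diff F i v)"
  using assms by (cases i) (auto simp: bdry_in_ideal)

lemma diff_bdry: "u \<in> free_module N F (Suc i) \<Longrightarrow> diff F i (bdry F i u) = 0"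
proof (cases i)
  case (Suc k)
  assume "u \<in> free_module N F (Suc i)"
  then have "bdry F i u \<in> {v \<in> free_module N F (Suc k). bdry F k v = 0}"
    using resolution Suc unfolding graded_free_resolution_def by blast
  then show ?thesis
    by (simp add: Suc)
qed simp

lemma augmentation_bdry: "u \<in> free_module N F (Suc 0) \<Longrightarrow> augmentation F (bdry F 0 u) = 0"
proof -
  assume "u \<in> free_module N F (Suc 0)"
  then have "bdry F 0 u \<in> {v \<in> free_module N F 0. augmentation F v = 0}"
    using resolution unfolding graded_free_resolution_def One_nat_def by blast
  then show ?thesis
    by simp
qed

text \<open>Exactness of a resolution is stated for the whole modules. Since homogeneous components
  commute with the boundary, a preimage of a homogeneous vector can be replaced by its component of
  the same degree.\<close>

lemma hom_part_bdry: "bdry F i (hom_part F (Suc i) d u) = hom_part F i d (bdry F i u)"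
proof
  fix a
  have "entry F i a b * hom_comp (d - gdeg F (Suc i) b) (u b)
      = hom_comp (d - gdeg F i a) (entry F i a b * u b)" if "a < rk F i" "b < rk F (Suc i)" for b
    using hom_comp_mult[OF entry_hom[OF that], of "d - gdeg F i a" "u b"] by simp
  then show "bdry F i (hom_part F (Suc i) d u) a = hom_part F i d (bdry F i u) a"
    by (simp add: bdry_def hom_part_def hom_comp_sum)
qed

lemma exact_Suc:
  assumes v: "v \<in> part (Suc i) d" and "bdry F i v = 0"
  obtains u where "u \<in> part (Suc (Suc i)) d" "bdry F (Suc i) u = v"
proof -
  have "v \<in> bdry F (Suc i) ` free_module N F (Suc (Suc i))"
    using resolution assms unfolding graded_free_resolution_def by (simp add: free_moduleI)
  then obtain u where u: "u \<in> free_module N F (Suc (Suc i))" "bdry F (Suc i) u = v"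
    by blast
  then have "bdry F (Suc i) (hom_part F (Suc (Suc i)) d u) = v"
    using v by (simp add: hom_part_bdry hom_part_id)
  then show ?thesis
    using that hom_part_in[OF u(1)] by blast
qed

lemma exact_0:
  assumes v: "v \<in> part 0 d" and "augmentation F v = 0"
  obtains u where "u \<in> part (Suc 0) d" "bdry F 0 u = v"
proof -
  have "v \<in> bdry F 0 ` free_module N F 1"
    using resolution assms unfolding graded_free_resolution_def by (simp add: free_moduleI)
  then obtain u where u: "u \<in> free_module N F (Suc 0)" "bdry F 0 u = v"
    by auto
  then have "bdry F 0 (hom_part F (Suc 0) d u) = v"
    using v by (simp add: hom_part_bdry hom_part_id)
  then show ?thesis
    using that hom_part_in[OF u(1)] by blast
qed

lemma gdeg_0: "b < rk F 0 \<Longrightarrow> aug F b \<noteq> 0 \<Longrightarrow> gdeg F 0 b = 0"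
  using resolution by (simp add: graded_free_resolution_def)

text \<open>K sits in degree 0: wherever \<open>aug F b\<close> is nonzero the generator has degree
  0, so the coordinate is homogeneous of degree \<open>d\<close> and has no constant term.\<close>

lemma augmentation_eq_0:
  assumes "v \<in> part 0 d" "d \<noteq> 0"
  shows "augmentation F v = 0"
  unfolding augmentation_def
proof (intro sum.neutral ballI)
  fix b assume "b \<in> {..<rk F 0}"
  then have "b < rk F 0" by simp
  then have "lookup (v b) 0 = 0" if "aug F b \<noteq> 0"
    using assms gdeg_0[OF _ that] by (intro hom_polys_lookup[of _ N d]) (auto simp: part_iff)
  then show "lookup (v b) 0 * aug F b = 0"
    by auto
qed

lemma augmentation_add: "augmentation F (v + w) = augmentation F v + augmentation F w"
  by (simp add: augmentation_def lookup_add distrib_right sum.distrib)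

lemma augmentation_smult: "augmentation F (smult p v) = lookup p 0 * augmentation F v"
  by (simp add: augmentation_def lookup_mult_zero sum_distrib_left mult.assoc)

lemma augmentation_diff: "augmentation F (v - w) = augmentation F v - augmentation F w"
  by (simp add: augmentation_def lookup_minus left_diff_distrib sum_subtractf)

lemma augmentation_hom_part_0: "augmentation F (hom_part F 0 0 v) = augmentation F v"
proof -
  have "lookup (hom_comp (- gdeg F 0 b) (v b)) 0 * aug F b = lookup (v b) 0 * aug F b" if "b < rk F 0" for b
    using gdeg_0[OF that] by (cases "aug F b = 0") (simp_all add: lookup_hom_comp)
  then show ?thesis
    by (auto simp: augmentation_def hom_part_def intro!: sum.cong)
qed

text \<open>F_0 may have rank greater than one. This homogeneous lift of 1 in K takes over the role
  that the basis vector of S has in a minimal resolution.\<close>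

lemma generator_0:
  obtains g where "g \<in> part 0 0" "augmentation F g = 1"
proof -
  have "1 \<in> augmentation F ` free_module N F 0"
    using resolution by (simp add: graded_free_resolution_def)
  then obtain v where v: "v \<in> free_module N F 0" "augmentation F v = 1"
    by force
  then show ?thesis
    using that[OF hom_part_in[OF v(1), of 0]] by (simp add: augmentation_hom_part_0)
qed

end

section \<open>Comparison of resolutions\<close>

lemma chain_map_vector:
  assumes "\<And>b. b < rk F (Suc i) \<Longrightarrow>
      bdry G i (\<phi> (Suc i) b) = lin (rk F i) (\<phi> i) (bdry F i (vunit b))"
    and "v \<in> free_module N F (Suc i)"
  shows "bdry G i (lin (rk F (Suc i)) (\<phi> (Suc i)) v) = lin (rk F i) (\<phi> i) (bdry F i v)"
  unfolding bdry_lin bdry_eq_lin[OF assms(2)] lin_lin using assms(1) by (rule lin_cong)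

text \<open>A chain map of internal degree \<open>e\<close> that induces zero on K. The modules of
  \<open>F\<close> are free and \<open>G\<close> is exact, so the homotopy is lifted one homological
  degree at a time on basis vectors.\<close>

lemma null_homotopy:
  assumes "resolution N F" "resolution N G"
    and \<theta>: "\<And>i b. b < rk F i \<Longrightarrow> \<theta> i b \<in> free_module_part N G i (gdeg F i b + e)"
    and chain: "\<And>i b. b < rk F (Suc i) \<Longrightarrow>
      bdry G i (\<theta> (Suc i) b) = lin (rk F i) (\<theta> i) (bdry F i (vunit b))"
    and aug: "\<And>b. b < rk F 0 \<Longrightarrow> augmentation G (\<theta> 0 b) = 0"
  obtains s where "\<And>i b. b < rk F i \<Longrightarrow> s i b \<in> free_module_part N G (Suc i) (gdeg F i b + e)"
    and "\<And>i v. v \<in> free_module N F i \<Longrightarrow>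
      bdry G i (lin (rk F i) (s i) v) + lin (rk F (i - 1)) (s (i - 1)) (diff F i v) = lin (rk F i) (\<theta> i) v"
proof -
  interpret F: resolution N F by fact
  interpret G: resolution N G by fact
  \<comment> \<open>\<open>A\<close> says that the homotopy already matches \<theta> on boundaries
    of \<open>F\<close>; this makes \<theta> - s d a cycle at the next stage, so that it can be
    lifted. \<open>B\<close> is the homotopy equation between consecutive stages.\<close>
  define A where "A i s \<longleftrightarrow> (\<forall>b<rk F i. s b \<in> G.part (Suc i) (gdeg F i b + e)) \<and>
      (\<forall>b<rk F (Suc i). bdry G i (lin (rk F i) s (bdry F i (vunit b))) = lin (rk F i) (\<theta> i) (bdry F i (vunit b))) \<and>
      (i = 0 \<longrightarrow> (\<forall>b<rk F 0. bdry G 0 (s b) = \<theta> 0 b))" for i s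
  define B where "B i s s' \<longleftrightarrow> (\<forall>b<rk F (Suc i). bdry G (Suc i) (s' b) =
      \<theta> (Suc i) b - lin (rk F i) s (bdry F i (vunit b)))" for i s s'
  have "\<exists>u. u \<in> G.part (Suc 0) (gdeg F 0 b + e) \<and> bdry G 0 u = \<theta> 0 b" if "b < rk F 0" for b
    using G.exact_0[OF \<theta>[OF that] aug[OF that]] by metis
  then obtain s0 where s0: "\<And>b. b < rk F 0 \<Longrightarrow> s0 b \<in> G.part (Suc 0) (gdeg F 0 b + e) \<and> bdry G 0 (s0 b) = \<theta> 0 b"
    by metis
  then have "A 0 s0"
    by (auto simp: A_def bdry_lin intro!: lin_cong)
  then have base: "\<exists>s. A 0 s"
    by blast
  have step: "\<exists>s'. A (Suc i) s' \<and> B i s s'" if A: "A i s" for i s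
  proof -
    have "\<exists>u. u \<in> G.part (Suc (Suc i)) (gdeg F (Suc i) b + e) \<and>
        bdry G (Suc i) u = \<theta> (Suc i) b - lin (rk F i) s (bdry F i (vunit b))" if b: "b < rk F (Suc i)" for b
    proof -
      let ?c = "\<theta> (Suc i) b - lin (rk F i) s (bdry F i (vunit b))"
      have "bdry F i (vunit b) \<in> F.part i (gdeg F (Suc i) b)"
        using b by (intro F.bdry_part part_vunit)
      then have "lin (rk F i) s (bdry F i (vunit b)) \<in> G.part (Suc i) (gdeg F (Suc i) b + e)"
        using A by (intro lin_part) (auto simp: A_def)
      then have "?c \<in> G.part (Suc i) (gdeg F (Suc i) b + e)"
        using \<theta> b by simp
      moreover have "bdry G i ?c = 0"
        using A b chain[OF b] by (simp add: bdry_diff A_def)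
      ultimately show ?thesis
        using G.exact_Suc by metis
    qed
    then obtain s' where s': "\<And>b. b < rk F (Suc i) \<Longrightarrow> s' b \<in> G.part (Suc (Suc i)) (gdeg F (Suc i) b + e) \<and>
        bdry G (Suc i) (s' b) = \<theta> (Suc i) b - lin (rk F i) s (bdry F i (vunit b))"
      by metis
    have "bdry G (Suc i) (lin (rk F (Suc i)) s' y) = lin (rk F (Suc i)) (\<theta> (Suc i)) y"
      if b: "b < rk F (Suc (Suc i))" and y: "y = bdry F (Suc i) (vunit b)" for b y
    proof -
      have vb: "vunit b \<in> F.part (Suc (Suc i)) (gdeg F (Suc (Suc i)) b)"
        using b by (rule part_vunit)
      have "y \<in> free_module N F (Suc i)"
        using F.bdry_part[OF vb] free_moduleI y by blast
      moreover have "bdry F i y = 0"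
        using F.diff_bdry[OF free_moduleI[OF vb]] y by simp
      \<comment> \<open>\<open>y\<close> is a boundary, so its own boundary vanishes and the term s
        d contributes nothing on it.\<close>
      ultimately have 0: "lin (rk F (Suc i)) (\<lambda>b. bdry F i (vunit b)) y = 0"
        by (simp add: bdry_eq_lin)
      have "bdry G (Suc i) (lin (rk F (Suc i)) s' y)
          = lin (rk F (Suc i)) (\<lambda>b. \<theta> (Suc i) b - lin (rk F i) s (bdry F i (vunit b))) y"
        using s' by (auto simp: bdry_lin intro!: lin_cong)
      also have "\<dots> = lin (rk F (Suc i)) (\<theta> (Suc i)) y"
        by (simp add: lin_diff_matrix 0 flip: lin_lin)
      finally show ?thesis .
    qed
    then have "A (Suc i) s' \<and> B i s s'"
      using s' by (auto simp: A_def B_def)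
    then show ?thesis by blast
  qed
  obtain s where s: "\<And>i. A i (s i)" "\<And>i. B i (s i) (s (Suc i))"
    using dependent_nat_choice[of A B, OF base step] by blast
  show ?thesis
  proof (rule that[of s])
    show "s i b \<in> G.part (Suc i) (gdeg F i b + e)" if "b < rk F i" for i b
      using s(1)[of i] that by (simp add: A_def)
    show "bdry G i (lin (rk F i) (s i) v) + lin (rk F (i - 1)) (s (i - 1)) (diff F i v) = lin (rk F i) (\<theta> i) v"
      if v: "v \<in> free_module N F i" for i v
    proof (cases i)
      case 0
      then show ?thesis
        using s(1)[of 0] by (auto simp: A_def bdry_lin intro!: lin_cong)
    next
      case (Suc k)
      have "bdry G i (lin (rk F i) (s i) v) = lin (rk F i) (\<lambda>b. \<theta> i b - lin (rk F k) (s k) (bdry F k (vunit b))) v"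
        using s(2)[of k] by (auto simp: Suc B_def bdry_lin intro!: lin_cong)
      also have "\<dots> = lin (rk F i) (\<theta> i) v - lin (rk F k) (s k) (bdry F k v)"
        using bdry_eq_lin[of v N F k] v by (simp add: lin_diff_matrix lin_lin Suc)
      finally show ?thesis
        by (simp add: Suc)
    qed
  qed
qed

text \<open>The identity of K is lifted to a chain map of degree 0, again by freeness of
  \<open>F\<close> and exactness of \<open>G\<close>.\<close>

lemma comparison_map:
  assumes "resolution N F" "resolution N G"
  obtains \<phi> where "\<And>i b. b < rk F i \<Longrightarrow> \<phi> i b \<in> free_module_part N G i (gdeg F i b)"
    and "\<And>i b. b < rk F (Suc i) \<Longrightarrow>
      bdry G i (\<phi> (Suc i) b) = lin (rk F i) (\<phi> i) (bdry F i (vunit b))"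
    and "\<And>v. augmentation G (lin (rk F 0) (\<phi> 0) v) = augmentation F v"
proof -
  interpret F: resolution N F by fact
  interpret G: resolution N G by fact
  obtain g where g: "g \<in> G.part 0 0" "augmentation G g = 1"
    by (rule G.generator_0)
  \<comment> \<open>Sending the \<open>b\<close>-th basis vector to \<open>aug F b\<close> times a
    lift of 1 makes the map cover the identity of K.\<close>
  define \<phi>0 where "\<phi>0 b = smult (const_poly (aug F b)) g" for b
  have lookup0: "lookup (\<Sum>b<r. f b :: 'a mpoly) 0 = (\<Sum>b<r. lookup (f b) 0)" for f and r :: nat
    by (rule lookup_sum)
  have \<phi>0: "augmentation G (lin (rk F 0) \<phi>0 v) = augmentation F v" for v
  proof -
    have "lin (rk F 0) \<phi>0 v = smult (\<Sum>b<rk F 0. v b * const_poly (aug F b)) g"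
      by (simp add: lin_def \<phi>0_def fun_eq_iff sum_distrib_right mult.assoc)
    then show ?thesis
      by (simp add: G.augmentation_smult g lookup0 lookup_mult_zero const_poly_def augmentation_def[of F])
  qed
  have \<phi>0_part: "\<phi>0 b \<in> G.part 0 (gdeg F 0 b)" if "b < rk F 0" for b
  proof (cases "aug F b = 0")
    case True
    then have "\<phi>0 b = 0"
      by (simp add: \<phi>0_def fun_eq_iff const_poly_def)
    then show ?thesis by simp
  next
    case False
    then show ?thesis
      using part_smult[OF hom_polys_const g(1), of "aug F b"] F.gdeg_0[OF that] by (simp add: \<phi>0_def)
  qed
  \<comment> \<open>The middle clause gives the cycle needed for the next lift. For i = 0 it is
    vacuous, and the last clause takes its place: it fixes the map, whose compatibility with the
    augmentations is what exactness at F_0 asks for.\<close>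
  define A where "A i \<phi> \<longleftrightarrow> (\<forall>b<rk F i. \<phi> b \<in> G.part i (gdeg F i b)) \<and>
      (\<forall>b<rk F (Suc i). diff G i (lin (rk F i) \<phi> (bdry F i (vunit b))) = 0) \<and>
      (i = 0 \<longrightarrow> \<phi> = \<phi>0)" for i \<phi>
  define B where "B i \<phi> \<phi>' \<longleftrightarrow> (\<forall>b<rk F (Suc i). bdry G i (\<phi>' b) = lin (rk F i) \<phi> (bdry F i (vunit b)))" for i \<phi> \<phi>'
  have base: "\<exists>\<phi>. A 0 \<phi>"
    using \<phi>0_part by (auto simp: A_def)
  have step: "\<exists>\<phi>'. A (Suc i) \<phi>' \<and> B i \<phi> \<phi>'" if A: "A i \<phi>" for i \<phi>
  proof -
    have "\<exists>u. u \<in> G.part (Suc i) (gdeg F (Suc i) b) \<and>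
        bdry G i u = lin (rk F i) \<phi> (bdry F i (vunit b))" if b: "b < rk F (Suc i)" for b
    proof -
      let ?c = "lin (rk F i) \<phi> (bdry F i (vunit b))"
      have vb: "vunit b \<in> F.part (Suc i) (gdeg F (Suc i) b)"
        using b by (rule part_vunit)
      have "?c \<in> G.part i (gdeg F (Suc i) b + 0)"
        using A by (intro lin_part F.bdry_part[OF vb]) (auto simp: A_def)
      then have c: "?c \<in> G.part i (gdeg F (Suc i) b)"
        by simp
      show ?thesis
      proof (cases i)
        case 0
        then have "augmentation G ?c = 0"
          using A \<phi>0 F.augmentation_bdry[of "vunit b"] free_moduleI[OF vb] by (simp add: A_def)
        then show ?thesis
          using c G.exact_0 0 by metis
      next
        case (Suc k)
        then have "bdry G k ?c = 0"
          using A b by (simp add: A_def)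
        then show ?thesis
          using c G.exact_Suc Suc by metis
      qed
    qed
    then obtain \<phi>' where \<phi>': "\<And>b. b < rk F (Suc i) \<Longrightarrow> \<phi>' b \<in> G.part (Suc i) (gdeg F (Suc i) b) \<and>
        bdry G i (\<phi>' b) = lin (rk F i) \<phi> (bdry F i (vunit b))"
      by metis
    have "bdry G i (lin (rk F (Suc i)) \<phi>' (bdry F (Suc i) (vunit b))) = 0"
      if b: "b < rk F (Suc (Suc i))" for b
    proof -
      have vb: "vunit b \<in> F.part (Suc (Suc i)) (gdeg F (Suc (Suc i)) b)"
        using b by (rule part_vunit)
      have "bdry G i (lin (rk F (Suc i)) \<phi>' (bdry F (Suc i) (vunit b)))
          = lin (rk F (Suc i)) (\<lambda>b. lin (rk F i) \<phi> (bdry F i (vunit b))) (bdry F (Suc i) (vunit b))"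
        using \<phi>' by (auto simp: bdry_lin intro!: lin_cong)
      also have "\<dots> = lin (rk F i) \<phi> (bdry F i (bdry F (Suc i) (vunit b)))"
        using bdry_eq_lin[OF free_moduleI[OF F.bdry_part[OF vb]]] by (simp add: lin_lin)
      also have "\<dots> = 0"
        using F.diff_bdry[OF free_moduleI[OF vb]] by simp
      finally show ?thesis .
    qed
    then have "A (Suc i) \<phi>' \<and> B i \<phi> \<phi>'"
      using \<phi>' by (auto simp: A_def B_def)
    then show ?thesis by blast
  qed
  obtain \<phi> where \<phi>: "\<And>i. A i (\<phi> i)" "\<And>i. B i (\<phi> i) (\<phi> (Suc i))"
    using dependent_nat_choice[of A B, OF base step] by blast
  show ?thesis
  proof (rule that[of \<phi>])
    show "\<phi> i b \<in> G.part i (gdeg F i b)" if "b < rk F i" for i b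
      using \<phi>(1)[of i] that by (simp add: A_def)
    show "bdry G i (\<phi> (Suc i) b) = lin (rk F i) (\<phi> i) (bdry F i (vunit b))" if "b < rk F (Suc i)" for i b
      using \<phi>(2)[of i] that by (simp add: B_def)
    show "augmentation G (lin (rk F 0) (\<phi> 0) v) = augmentation F v" for v
      using \<phi>(1)[of 0] \<phi>0 by (simp add: A_def)
  qed
qed

text \<open>Independence of Tor from the resolution. It is needed because the linear strand is
  computed with the Koszul complex, while the Betti numbers use an arbitrary choice.\<close>

lemma tor_vanishes_transfer:
  assumes "resolution N F" "resolution N G" and I: "hideal N I" and "tor_vanishes N G I i d"
  shows "tor_vanishes N F I i d"
proof (rule tor_vanishesI[OF I])
  interpret F: resolution N F by fact
  interpret G: resolution N G by fact
  obtain \<phi> where \<phi>: "\<And>i b. b < rk F i \<Longrightarrow> \<phi> i b \<in> G.part i (gdeg F i b)"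
    "\<And>i b. b < rk F (Suc i) \<Longrightarrow> bdry G i (\<phi> (Suc i) b) = lin (rk F i) (\<phi> i) (bdry F i (vunit b))"
    "\<And>v. augmentation G (lin (rk F 0) (\<phi> 0) v) = augmentation F v"
    using comparison_map[OF assms(1,2)] by blast
  obtain \<psi> where \<psi>: "\<And>i b. b < rk G i \<Longrightarrow> \<psi> i b \<in> F.part i (gdeg G i b)"
    "\<And>i b. b < rk G (Suc i) \<Longrightarrow> bdry F i (\<psi> (Suc i) b) = lin (rk G i) (\<psi> i) (bdry G i (vunit b))"
    "\<And>v. augmentation F (lin (rk G 0) (\<psi> 0) v) = augmentation G v"
    using comparison_map[OF assms(2,1)] by blast
  have \<phi>_part: "lin (rk F i) (\<phi> i) v \<in> G.part i d" if "v \<in> F.part i d" for i v d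
    using lin_part[of F i "\<phi> i" N G i 0, OF _ that] \<phi>(1) by simp
  have \<psi>_part: "lin (rk G i) (\<psi> i) v \<in> F.part i d" if "v \<in> G.part i d" for i v d
    using lin_part[of G i "\<psi> i" N F i 0, OF _ that] \<psi>(1) by simp
  \<comment> \<open>The composite of the two comparison maps and the identity have the same
    augmentation, so their difference is null-homotopic.\<close>
  define \<theta> where "\<theta> i b = lin (rk G i) (\<psi> i) (\<phi> i b) - vunit b" for i b
  have \<theta>_lin: "lin (rk F i) (\<theta> i) v = lin (rk G i) (\<psi> i) (lin (rk F i) (\<phi> i) v) - v"
    if "v \<in> free_module N F i" for i v
    using that by (simp add: \<theta>_def[abs_def] lin_diff_matrix lin_lin lin_id free_module_outside)
  have \<theta>_part: "\<theta> i b \<in> F.part i (gdeg F i b + 0)" if "b < rk F i" for i b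
    using that \<phi>(1) by (simp add: \<theta>_def \<psi>_part part_vunit)
  have \<theta>_chain: "bdry F i (\<theta> (Suc i) b) = lin (rk F i) (\<theta> i) (bdry F i (vunit b))" if b: "b < rk F (Suc i)" for i b
  proof -
    have vb: "bdry F i (vunit b) \<in> free_module N F i"
      using F.bdry_part[OF part_vunit[OF b]] free_moduleI by blast
    have "\<phi> (Suc i) b \<in> free_module N G (Suc i)"
      using \<phi>(1)[OF b] by (rule free_moduleI)
    then show ?thesis
      using chain_map_vector[OF \<psi>(2), of i "\<phi> (Suc i) b" N] \<phi>(2)[OF b]
      by (simp add: \<theta>_lin[OF vb]) (simp add: \<theta>_def bdry_diff)
  qed
  have \<theta>_aug: "augmentation F (\<theta> 0 b) = 0" if "b < rk F 0" for b
    using \<phi>(3)[of "vunit b"] \<psi>(3) that by (simp add: \<theta>_def F.augmentation_diff)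
  obtain s where s: "\<And>i b. b < rk F i \<Longrightarrow> s i b \<in> F.part (Suc i) (gdeg F i b + 0)"
    "\<And>i v. v \<in> free_module N F i \<Longrightarrow>
      bdry F i (lin (rk F i) (s i) v) + lin (rk F (i - 1)) (s (i - 1)) (diff F i v) = lin (rk F i) (\<theta> i) v"
    using null_homotopy[where \<theta> = \<theta> and e = 0, OF assms(1,1) \<theta>_part \<theta>_chain \<theta>_aug] by blast
  have s_part: "lin (rk F i) (s i) v \<in> F.part (Suc i) d" if "v \<in> F.part i d" for i v d
    using lin_part[of F i "s i" N F "Suc i" 0, OF _ that] s(1) by simp
  fix z assume z: "z \<in> F.part i d" "in_ideal I F (i - 1) (diff F i z)"
  have "diff G i (lin (rk F i) (\<phi> i) z) = lin (rk F (i - 1)) (\<phi> (i - 1)) (diff F i z)"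
    using chain_map_vector[where \<phi> = \<phi>, OF \<phi>(2) , of "i - 1" z N] free_moduleI[OF z(1)] by (cases i) auto
  then have "in_ideal I G (i - 1) (diff G i (lin (rk F i) (\<phi> i) z))"
    using in_ideal_lin[OF I z(2), of "\<phi> (i - 1)"] part_polys[OF \<phi>(1)] by (simp add: in_ideal_def)
  then obtain u w where uw: "u \<in> G.part (Suc i) d" "w \<in> G.part i d" "in_ideal I G i w"
      "lin (rk F i) (\<phi> i) z = bdry G i u + w"
    using tor_vanishesE[OF assms(4) I \<phi>_part[OF z(1)]] by blast
  \<comment> \<open>With \<phi> z = d u + w and \<psi> \<phi> z - z = d s z + s d z one gets z = d
    (\<psi> u - s z) + (\<psi> w - s d z). The term s d z has coordinates in \<open>I\<close>
    because those of d z are in \<open>I\<close>.\<close>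
  let ?u = "lin (rk G (Suc i)) (\<psi> (Suc i)) u - lin (rk F i) (s i) z"
  let ?h = "lin (rk F (i - 1)) (s (i - 1)) (diff F i z)"
  let ?w = "lin (rk G i) (\<psi> i) w - ?h"
  have "bdry F i (lin (rk F i) (s i) z) + ?h = lin (rk G i) (\<psi> i) (bdry G i u) + lin (rk G i) (\<psi> i) w - z"
    using s(2)[OF free_moduleI[OF z(1)]] by (simp add: \<theta>_lin[OF free_moduleI[OF z(1)]] uw(4) lin_add)
  moreover have "lin (rk G i) (\<psi> i) (bdry G i u) = bdry F i (lin (rk G (Suc i)) (\<psi> (Suc i)) u)"
    using chain_map_vector[OF \<psi>(2) free_moduleI[OF uw(1)]] by simp
  ultimately have "z = bdry F i ?u + ?w"
    by (simp add: bdry_diff algebra_simps)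
  moreover have "?u \<in> F.part (Suc i) d"
    by (simp add: s_part z \<psi>_part uw)
  moreover have "?h \<in> F.part i d"
    using s_part[OF F.diff_part[OF z(1)]] by (cases i) simp_all
  then have "?w \<in> F.part i d"
    by (simp add: \<psi>_part uw)
  moreover have "in_ideal I F i ?w"
  proof (rule in_ideal_diff[OF I])
    show "in_ideal I F i (lin (rk G i) (\<psi> i) w)"
      using in_ideal_lin[OF I uw(3), of "\<psi> i"] part_polys[OF \<psi>(1)] by (simp add: in_ideal_def)
    show "in_ideal I F i ?h"
      using in_ideal_lin[OF I z(2), of "s (i - 1)"] part_polys[OF s(1)] by (simp add: in_ideal_def)
  qed
  ultimately show "\<exists>u w. u \<in> F.part (Suc i) d \<and> w \<in> F.part i d \<and> in_ideal I F i w \<and> z = bdry F i u + w"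
    by blast
qed

section \<open>Vanishing of Tor along exact sequences\<close>

context resolution
begin

text \<open>A form of degree one has no constant term and so acts as zero on K; multiplication by it
  is therefore covered by \<open>null_homotopy\<close> with e = 1.\<close>

lemma mult_homotopy:
  assumes x: "x \<in> hom_polys N 1"
  obtains s where "\<And>i b. b < rk F i \<Longrightarrow> s i b \<in> part (Suc i) (gdeg F i b + 1)"
    and "\<And>i v. v \<in> free_module N F i \<Longrightarrow>
      bdry F i (lin (rk F i) (s i) v) + lin (rk F (i - 1)) (s (i - 1)) (diff F i v) = smult x v"
proof -
  define \<theta> where "\<theta> i b = smult x (vunit b)" for i b :: nat
  have \<theta>_lin: "lin (rk F i) (\<theta> i) v = smult x v" if "v \<in> free_module N F i" for i v
    using that by (simp add: \<theta>_def[abs_def] lin_smult_vunit free_module_outside)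
  have 1: "\<theta> i b \<in> part i (gdeg F i b + 1)" if "b < rk F i" for i b
    unfolding \<theta>_def using part_smult[OF x part_vunit[of b F i]] that by simp
  have 2: "bdry F i (\<theta> (Suc i) b) = lin (rk F i) (\<theta> i) (bdry F i (vunit b))" if "b < rk F (Suc i)" for i b
    using \<theta>_lin[OF free_moduleI[OF bdry_part[OF part_vunit[OF that]]]] by (simp add: \<theta>_def bdry_smult)
  have 3: "augmentation F (\<theta> 0 b) = 0" for b
    using hom_polys_lookup[OF x, of 0] by (simp add: \<theta>_def augmentation_smult)
  obtain s where s: "\<And>i b. b < rk F i \<Longrightarrow> s i b \<in> part (Suc i) (gdeg F i b + 1)"
    "\<And>i v. v \<in> free_module N F i \<Longrightarrow>
      bdry F i (lin (rk F i) (s i) v) + lin (rk F (i - 1)) (s (i - 1)) (diff F i v) = lin (rk F i) (\<theta> i) v"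
    using null_homotopy[where \<theta> = \<theta> and e = 1, OF resolution_axioms resolution_axioms 1 2 3] by blast
  show ?thesis
    using that[of s] s \<theta>_lin by simp
qed

lemma in_ideal_colon:
  "v \<in> part i d \<Longrightarrow> in_ideal I F i (smult x v) \<Longrightarrow> in_ideal (ideal_colon N I x) F i v"
  by (simp add: in_ideal_def ideal_colon_def part_polys)

lemma in_ideal_colonD: "in_ideal (ideal_colon N I x) F i v \<Longrightarrow> in_ideal I F i (smult x v)"
  by (simp add: in_ideal_def ideal_colon_def)

lemma in_ideal_adjoin: "hideal N I \<Longrightarrow> in_ideal I F i v \<Longrightarrow> in_ideal (ideal_adjoin N I x) F i v"
  unfolding in_ideal_def ideal_adjoin_def by (force intro: exI[of _ 0])

lemma in_ideal_adjoin_smult: "hideal N I \<Longrightarrow> v \<in> part i d \<Longrightarrow> in_ideal (ideal_adjoin N I x) F i (smult x v)"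
  using hideal_zero[of N I] unfolding in_ideal_def ideal_adjoin_def by (force simp: part_polys)

text \<open>Half-exactness in the middle of 0 -> S/(I : x)(-1) -> S/I -> S/(I + (x)) -> 0, where the
  first map is multiplication by x and accounts for the degree d - 1.\<close>

lemma tor_vanishes_middle:
  assumes I: "hideal N I" "hideal N (ideal_colon N I x)" "hideal N (ideal_adjoin N I x)"
    and x: "x \<in> hom_polys N 1"
    and "tor_vanishes N F (ideal_colon N I x) i (d - 1)" "tor_vanishes N F (ideal_adjoin N I x) i d"
  shows "tor_vanishes N F I i d"
proof (rule tor_vanishesI[OF I(1)])
  fix z assume z: "z \<in> part i d" "in_ideal I F (i - 1) (diff F i z)"
  obtain u w where uw: "u \<in> part (Suc i) d" "w \<in> part i d" "in_ideal (ideal_adjoin N I x) F i w"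
      "z = bdry F i u + w"
    using tor_vanishesE[OF assms(6) I(3) z(1) in_ideal_adjoin[OF I(1) z(2)]] by blast
  obtain w1 w2 where w: "w1 \<in> part i d" "in_ideal I F i w1" "w2 \<in> part i (d - 1)" "w = w1 + smult x w2"
    using in_ideal_adjoin_split[OF I(1) x uw(2,3)] by blast
  have "smult x (diff F i w2) = diff F i z - diff F i w1"
    using diff_bdry[OF free_moduleI[OF uw(1)]] by (simp add: uw(4) w(4) diff_add diff_smult)
  then have "in_ideal I F (i - 1) (smult x (diff F i w2))"
    using in_ideal_diff[OF I(1) z(2) diff_in_ideal[OF I(1) w(2)]] by simp
  then have "in_ideal (ideal_colon N I x) F (i - 1) (diff F i w2)"
    by (rule in_ideal_colon[OF diff_part[OF w(3)]])
  then obtain u' w' where uw': "u' \<in> part (Suc i) (d - 1)" "w' \<in> part i (d - 1)"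
      "in_ideal (ideal_colon N I x) F i w'" "w2 = bdry F i u' + w'"
    using tor_vanishesE[OF assms(5) I(2) w(3)] by blast
  have "z = bdry F i (u + smult x u') + (w1 + smult x w')"
    by (simp add: uw(4) w(4) uw'(4) bdry_add bdry_smult) (simp add: fun_eq_iff algebra_simps)
  moreover have "u + smult x u' \<in> part (Suc i) d" "w1 + smult x w' \<in> part i d"
    using part_smult[OF x uw'(1)] part_smult[OF x uw'(2)] uw w by simp_all
  moreover have "in_ideal I F i (w1 + smult x w')"
    using in_ideal_add[OF I(1) w(2) in_ideal_colonD[OF uw'(3)]] .
  ultimately show "\<exists>u w. u \<in> part (Suc i) d \<and> w \<in> part i d \<and> in_ideal I F i w \<and> z = bdry F i u + w"
    by blast
qed

text \<open>The same sequence one place further: Tor_i of S/(I + (x)) lies between Tor_i of S/I and,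
  through the connecting map, Tor_{i-1} of S/(I : x) in degree d - 1. For i = 0 there is no
  connecting map.\<close>

lemma tor_vanishes_right:
  assumes I: "hideal N I" "hideal N (ideal_colon N I x)" "hideal N (ideal_adjoin N I x)"
    and x: "x \<in> hom_polys N 1"
    and "tor_vanishes N F I i d" and i: "i = 0 \<or> tor_vanishes N F (ideal_colon N I x) (i - 1) (d - 1)"
  shows "tor_vanishes N F (ideal_adjoin N I x) i d"
proof (rule tor_vanishesI[OF I(3)])
  fix z assume z: "z \<in> part i d" "in_ideal (ideal_adjoin N I x) F (i - 1) (diff F i z)"
  \<comment> \<open>The connecting map sends the class of \<open>z\<close> to zero, which means that
    a multiple of \<open>x\<close> can be subtracted to turn \<open>z\<close> into a cycle modulo
    \<open>I\<close> itself.\<close>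
  have "\<exists>u. u \<in> part i (d - 1) \<and> in_ideal I F (i - 1) (diff F i (z - smult x u))"
  proof (cases i)
    case 0
    then show ?thesis
      using I(1) by (auto intro: exI[of _ 0])
  next
    case (Suc k)
    obtain w1 w2 where w: "w1 \<in> part k d" "in_ideal I F k w1" "w2 \<in> part k (d - 1)"
        "diff F i z = w1 + smult x w2"
      using in_ideal_adjoin_split[OF I(1) x diff_part[OF z(1)] z(2)] Suc by auto
    have "diff F k (diff F i z) = 0"
      using diff_bdry[OF free_moduleI[of z N F "Suc k" d]] z(1) Suc by simp
    then have "smult x (diff F k w2) = 0 - diff F k w1"
      by (simp add: w(4) diff_add diff_smult) (metis add.commute eq_neg_iff_add_eq_0)
    then have "in_ideal I F (k - 1) (smult x (diff F k w2))"
      using in_ideal_diff[OF I(1) in_ideal_zero[OF I(1)] diff_in_ideal[OF I(1) w(2)]] by simp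
    then have "in_ideal (ideal_colon N I x) F (k - 1) (diff F k w2)"
      by (rule in_ideal_colon[OF diff_part[OF w(3)]])
    then obtain u' w' where uw': "u' \<in> part (Suc k) (d - 1)" "w' \<in> part k (d - 1)"
        "in_ideal (ideal_colon N I x) F k w'" "w2 = bdry F k u' + w'"
      using tor_vanishesE[of N F _ k "d - 1", OF _ I(2) w(3)] i Suc by auto
    have "diff F i (z - smult x u') = w1 + smult x w'"
      unfolding diff_diff w(4) unfolding Suc diff_Suc bdry_smult uw'(4)
      by (simp add: fun_eq_iff algebra_simps)
    then show ?thesis
      using uw' in_ideal_add[OF I(1) w(2) in_ideal_colonD[OF uw'(3)]] Suc by auto
  qed
  then obtain u where u: "u \<in> part i (d - 1)" "in_ideal I F (i - 1) (diff F i (z - smult x u))"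
    by blast
  have xu: "smult x u \<in> part i d"
    using part_smult[OF x u(1)] by simp
  obtain u' w where uw: "u' \<in> part (Suc i) d" "w \<in> part i d" "in_ideal I F i w"
      "z - smult x u = bdry F i u' + w"
    using tor_vanishesE[OF assms(5) I(1) _ u(2)] z(1) xu by auto
  have "z = bdry F i u' + (w + smult x u)"
    using uw(4) by (simp add: algebra_simps)
  moreover have "in_ideal (ideal_adjoin N I x) F i (w + smult x u)"
    using in_ideal_add[OF I(3) in_ideal_adjoin[OF I(1) uw(3)] in_ideal_adjoin_smult[OF I(1) u(1)]] .
  ultimately show "\<exists>u w. u \<in> part (Suc i) d \<and> w \<in> part i d \<and>
      in_ideal (ideal_adjoin N I x) F i w \<and> z = bdry F i u + w"
    using uw xu by (metis part_add)
qed

text \<open>For regular x the connecting map from Tor_{i+1} of S/(I + (x)) in degree d + 1 to Tor_i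
  of S/I in degree d is onto, because the next map is multiplication by x, which is zero on
  Tor.\<close>

lemma tor_vanishes_regular:
  assumes I: "hideal N I" "hideal N (ideal_adjoin N I x)" and colon: "ideal_colon N I x = I"
    and x: "x \<in> hom_polys N 1"
    and "tor_vanishes N F (ideal_adjoin N I x) (Suc i) (d + 1)"
  shows "tor_vanishes N F I i d"
proof (rule tor_vanishesI[OF I(1)])
  fix z assume z: "z \<in> part i d" "in_ideal I F (i - 1) (diff F i z)"
  obtain s where s: "\<And>i b. b < rk F i \<Longrightarrow> s i b \<in> part (Suc i) (gdeg F i b + 1)"
    "\<And>i v. v \<in> free_module N F i \<Longrightarrow>
      bdry F i (lin (rk F i) (s i) v) + lin (rk F (i - 1)) (s (i - 1)) (diff F i v) = smult x v"
    using mult_homotopy[OF x] by blast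
  \<comment> \<open>The homotopy supplies a preimage of \<open>z\<close> under the connecting map: d
    s z equals x z up to the term s d z, which has coordinates in \<open>I\<close>.\<close>
  let ?w = "lin (rk F i) (s i) z"
  let ?h = "lin (rk F (i - 1)) (s (i - 1)) (diff F i z)"
  have w: "?w \<in> part (Suc i) (d + 1)"
    using s(1) z(1) by (intro lin_part)
  have h: "in_ideal I F i ?h"
    using in_ideal_lin[OF I(1) z(2), of "s (i - 1)"] part_polys[OF s(1)] by (simp add: in_ideal_def)
  have dw: "bdry F i ?w = smult x z - ?h"
    using s(2)[OF free_moduleI[OF z(1)]] by (simp add: algebra_simps)
  have "in_ideal (ideal_adjoin N I x) F i (bdry F i ?w)"
    unfolding dw using in_ideal_diff[OF I(2) in_ideal_adjoin_smult[OF I(1) z(1)] in_ideal_adjoin[OF I(1) h]] .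
  then obtain u v where uv: "u \<in> part (Suc (Suc i)) (d + 1)" "v \<in> part (Suc i) (d + 1)"
      "in_ideal (ideal_adjoin N I x) F (Suc i) v" "?w = bdry F (Suc i) u + v"
    using tor_vanishesE[OF assms(5) I(2) w] by auto
  obtain v1 v2 where v: "v1 \<in> part (Suc i) (d + 1)" "in_ideal I F (Suc i) v1"
      "v2 \<in> part (Suc i) (d + 1 - 1)" "v = v1 + smult x v2"
    using in_ideal_adjoin_split[OF I(1) x uv(2,3)] by blast
  have "bdry F i (bdry F (Suc i) u) = 0"
    using diff_bdry[OF free_moduleI[OF uv(1)]] by simp
  then have "bdry F i ?w = bdry F i v1 + smult x (bdry F i v2)"
    by (simp add: uv(4) v(4) bdry_add bdry_smult)
  then have "smult x (z - bdry F i v2) = bdry F i v1 + ?h"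
    using dw by (auto simp: fun_eq_iff algebra_simps)
  then have "in_ideal I F i (smult x (z - bdry F i v2))"
    using in_ideal_add[OF I(1) bdry_in_ideal[OF I(1) v(2)] h] by simp
  moreover have v2: "bdry F i v2 \<in> part i d"
    using bdry_part[OF v(3)] by simp
  ultimately have "in_ideal I F i (z - bdry F i v2)"
    using in_ideal_colon[of "z - bdry F i v2" i d I x] z(1) colon by simp
  moreover have "z = bdry F i v2 + (z - bdry F i v2)"
    by simp
  ultimately show "\<exists>u w. u \<in> part (Suc i) d \<and> w \<in> part i d \<and> in_ideal I F i w \<and> z = bdry F i u + w"
    using v(3) v2 z(1) by (metis add_diff_cancel_right' part_diff)
qed

text \<open>Half-exactness for 0 -> S/(I \<inter> I') -> S/I \<oplus> S/I' -> S/(I + I') -> 0. The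
  sum of the ideals enters one homological degree higher but in the same internal degree, so its
  rows move down by one in the diagram.\<close>

lemma tor_vanishes_Int:
  assumes I: "hideal N I" "hideal N I'" "hideal N (ideal_sum I I')" "hideal N (I \<inter> I')"
    and "tor_vanishes N F (ideal_sum I I') (Suc i) d" "tor_vanishes N F I i d" "tor_vanishes N F I' i d"
  shows "tor_vanishes N F (I \<inter> I') i d"
proof (rule tor_vanishesI[OF I(4)])
  have Int: "in_ideal (I \<inter> I') F i v \<longleftrightarrow> in_ideal I F i v \<and> in_ideal I' F i v" for i v
    by (auto simp: in_ideal_def)
  have sum1: "in_ideal (ideal_sum I I') F i v" if "in_ideal I F i v" for i v
    using that hideal_zero[OF I(2)] unfolding in_ideal_def ideal_sum_def by force
  have sum2: "in_ideal (ideal_sum I I') F i v" if "in_ideal I' F i v" for i v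
    using that hideal_zero[OF I(1)] unfolding in_ideal_def ideal_sum_def by force
  fix z assume z: "z \<in> part i d" "in_ideal (I \<inter> I') F (i - 1) (diff F i z)"
  then have dz: "in_ideal I F (i - 1) (diff F i z)" "in_ideal I' F (i - 1) (diff F i z)"
    by (simp_all add: Int)
  obtain u w where uw: "u \<in> part (Suc i) d" "w \<in> part i d" "in_ideal I F i w" "z = bdry F i u + w"
    using tor_vanishesE[OF assms(6) I(1) z(1) dz(1)] by blast
  obtain u' w' where uw': "u' \<in> part (Suc i) d" "w' \<in> part i d" "in_ideal I' F i w'" "z = bdry F i u' + w'"
    using tor_vanishesE[OF assms(7) I(2) z(1) dz(2)] by blast
  have "bdry F i (u - u') = w' - w"
    using uw(4) uw'(4) by (simp add: bdry_diff algebra_simps)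
  then have "in_ideal (ideal_sum I I') F (Suc i - 1) (diff F (Suc i) (u - u'))"
    using in_ideal_diff[OF I(3) sum2[OF uw'(3)] sum1[OF uw(3)]] by simp
  then obtain y q where yq: "y \<in> part (Suc (Suc i)) d" "q \<in> part (Suc i) d"
      "in_ideal (ideal_sum I I') F (Suc i) q" "u - u' = bdry F (Suc i) y + q"
    using tor_vanishesE[OF assms(5) I(3), of "u - u'"] uw(1) uw'(1) by auto
  obtain q1 q2 where q: "q1 \<in> part (Suc i) d" "in_ideal I F (Suc i) q1" "q2 \<in> part (Suc i) d"
      "in_ideal I' F (Suc i) q2" "q = q1 + q2"
    using in_ideal_sum_split[OF I(1,2) yq(2,3)] by blast
  have "bdry F i (bdry F (Suc i) y) = 0"
    using diff_bdry[OF free_moduleI[OF yq(1)]] by simp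
  moreover have "u = u' + (bdry F (Suc i) y + (q1 + q2))"
    using yq(4) q(5) by (metis add.commute diff_add_cancel)
  ultimately have "bdry F i u = bdry F i u' + (bdry F i q1 + bdry F i q2)"
    by (simp add: bdry_add)
  \<comment> \<open>One remainder in two forms: the first shows its coordinates in \<open>I\<close>,
    the second in \<open>I'\<close>.\<close>
  then have "z - bdry F i (u - q1) = w + bdry F i q1" "z - bdry F i (u - q1) = w' - bdry F i q2"
    using uw(4) uw'(4) by (simp_all add: bdry_diff algebra_simps)
  then have "in_ideal (I \<inter> I') F i (z - bdry F i (u - q1))"
    unfolding Int
    using in_ideal_add[OF I(1) uw(3) bdry_in_ideal[OF I(1) q(2)]]
      in_ideal_diff[OF I(2) uw'(3) bdry_in_ideal[OF I(2) q(4)]] by metis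
  moreover have "u - q1 \<in> part (Suc i) d"
    using uw(1) q(1) by simp
  moreover from this have "z - bdry F i (u - q1) \<in> part i d"
    using bdry_part z(1) by simp
  moreover have "z = bdry F i (u - q1) + (z - bdry F i (u - q1))"
    by simp
  ultimately show "\<exists>u w. u \<in> part (Suc i) d \<and> w \<in> part i d \<and> in_ideal (I \<inter> I') F i w \<and> z = bdry F i u + w"
    by blast
qed

lemma hideal_zero_ideal: "hideal N {0}"
  by (simp add: hideal_def)

text \<open>For the zero ideal the complex is \<open>F\<close> itself, whose homology is K in
  homological and internal degree zero.\<close>

lemma tor_vanishes_zero_ideal:
  assumes "i \<noteq> 0 \<or> d \<noteq> 0"
  shows "tor_vanishes N F {0} i d"
proof (rule tor_vanishesI[OF hideal_zero_ideal])
  fix z assume z: "z \<in> part i d" "in_ideal {0} F (i - 1) (diff F i z)"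
  have "\<exists>u. u \<in> part (Suc i) d \<and> z = bdry F i u"
  proof (cases i)
    case 0
    then show ?thesis
      using exact_0[of z d] augmentation_eq_0[of z d] assms z(1) by metis
  next
    case (Suc k)
    then have "bdry F k z \<in> part k d" "in_ideal {0} F k (bdry F k z)"
      using z bdry_part by auto
    then have "bdry F k z = 0"
      by (auto simp: in_ideal_def part_iff fun_eq_iff not_less[symmetric])
    then show ?thesis
      using exact_Suc[of z k d] z(1) Suc by metis
  qed
  then show "\<exists>u w. u \<in> part (Suc i) d \<and> w \<in> part i d \<and> in_ideal {0} F i w \<and> z = bdry F i u + w"
    by (metis add.right_neutral in_ideal_zero[OF hideal_zero_ideal] part_zero)
qed

text \<open>Tor_0 is a quotient of K, hence concentrated in internal degree 0.\<close>

lemma tor_vanishes_0: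
  assumes I: "hideal N I" and "d \<noteq> 0"
  shows "tor_vanishes N F I 0 d"
proof (rule tor_vanishesI[OF I])
  fix z assume "z \<in> part 0 d"
  then obtain u where "u \<in> part (Suc 0) d" "bdry F 0 u = z"
    using exact_0 augmentation_eq_0 assms(2) by metis
  then show "\<exists>u w. u \<in> part (Suc 0) d \<and> w \<in> part 0 d \<and> in_ideal I F 0 w \<and> z = bdry F 0 u + w"
    by (metis add.right_neutral in_ideal_zero[OF I] part_zero)
qed

end

section \<open>Ideals given by coefficient sums\<close>

text \<open>A label sends monomials to \<open>None\<close> or to the name of a class.  It defines the ideal
  of the polynomials whose coefficients sum to zero over each class; this ideal is spanned by the
  monomials labelled \<open>None\<close> and by the differences of monomials with equal labels.\<close>

definition label_ideal :: "nat \<Rightarrow> ((var \<Rightarrow>\<^sub>0 nat) \<Rightarrow> 'l option) \<Rightarrow> 'k::field mpoly set" where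
  "label_ideal N lab = {f \<in> polys N. \<forall>l. coeff_sum {t. lab t = Some l} f = 0}"

text \<open>The first two clauses let monomials act on the classes, which gives closure under
  products; the third makes every class homogeneous.\<close>

definition compatible :: "((var \<Rightarrow>\<^sub>0 nat) \<Rightarrow> 'l option) \<Rightarrow> bool" where
  "compatible lab \<longleftrightarrow>
     (\<forall>s t t'. lab t = lab t' \<longrightarrow> lab (s + t) = lab (s + t')) \<and>
     (\<forall>s t. lab t = None \<longrightarrow> lab (s + t) = None) \<and>
     (\<forall>t t'. lab t \<noteq> None \<longrightarrow> lab t = lab t' \<longrightarrow> mon_deg t = mon_deg t')"

text \<open>\<open>C\<close> is a union of classes, finitely many of which meet the support of
  \<open>f\<close>, so its coefficient sum splits into vanishing class sums.\<close>

lemma coeff_sum_saturated: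
  assumes "\<And>l. coeff_sum {t. lab t = Some l} f = 0"
    and "\<And>t. t \<in> C \<Longrightarrow> lab t \<noteq> None" "\<And>t t'. t \<in> C \<Longrightarrow> lab t' = lab t \<Longrightarrow> t' \<in> C"
  shows "coeff_sum C f = 0"
proof -
  let ?S = "{t \<in> keys f. t \<in> C}"
  have "coeff_sum C f = sum (lookup f) ?S"
    unfolding coeff_sum_def by (rule sum.mono_neutral_cong_right) auto
  also have "\<dots> = (\<Sum>y\<in>lab ` ?S. sum (lookup f) {t \<in> ?S. lab t = y})"
    by (rule sum.group[symmetric]) auto
  also have "\<dots> = 0"
  proof (rule sum.neutral, rule ballI)
    fix y assume "y \<in> lab ` ?S"
    then obtain t l where t: "t \<in> C" "lab t = y" "y = Some l"
      using assms(2) by blast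
    have "sum (lookup f) {t \<in> ?S. lab t = y} = coeff_sum {t. lab t = Some l} f"
      unfolding coeff_sum_def using t assms(3) by (intro sum.mono_neutral_cong_left) auto
    then show "sum (lookup f) {t \<in> ?S. lab t = y} = 0"
      by (simp add: assms(1))
  qed
  finally show ?thesis .
qed

lemma label_ideal_add: "f \<in> label_ideal N lab \<Longrightarrow> g \<in> label_ideal N lab \<Longrightarrow> f + g \<in> label_ideal N lab"
  by (simp add: label_ideal_def)

lemma hideal_label_ideal:
  assumes "compatible lab"
  shows "hideal N (label_ideal N lab :: 'k::field mpoly set)"
proof -
  have add: "lab (s + t) = lab (s + t')" if "lab t = lab t'" for s t t'
    using assms that unfolding compatible_def by blast
  have none: "lab t \<noteq> None" if "lab (s + t) = Some l" for s t l
    using assms that unfolding compatible_def by (metis option.distinct(1))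
  have deg: "mon_deg t' = mon_deg t" if "lab t = Some l" "lab t' = Some l" for t t' l
    using assms that unfolding compatible_def by (metis option.distinct(1))
  have "p * f \<in> label_ideal N lab" if f: "f \<in> label_ideal N lab" and p: "p \<in> polys N" for p f :: "'k mpoly"
  proof -
    have "coeff_sum {t. lab t = Some l} (single s c * f) = 0" for s l and c :: 'k
    proof -
      have "coeff_sum {t. lab (s + t) = Some l} f = 0"
      proof (rule coeff_sum_saturated[of lab])
        show "lab t \<noteq> None" if "t \<in> {t. lab (s + t) = Some l}" for t
          using that none by blast
        show "t' \<in> {t. lab (s + t) = Some l}" if "t \<in> {t. lab (s + t) = Some l}" "lab t' = lab t" for t t'
          using that add[of t' t s] by simp
      qed (use f in \<open>simp add: label_ideal_def\<close>)
      then show ?thesis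
        by (simp add: coeff_sum_monomial_mult)
    qed
    then have "coeff_sum {t. lab t = Some l} (p * f) = 0" for l
      by (subst poly_eq_sum_monomials[of p]) (simp add: sum_distrib_right coeff_sum_sum)
    then show ?thesis
      using f p by (simp add: label_ideal_def)
  qed
  moreover have "hom_comp d f \<in> label_ideal N lab" if f: "f \<in> label_ideal N lab" for d and f :: "'k mpoly"
  proof -
    have "coeff_sum {t. lab t = Some l \<and> int (mon_deg t) = d} f = 0" for l
    proof (rule coeff_sum_saturated[of lab])
      fix t t' assume "t \<in> {t. lab t = Some l \<and> int (mon_deg t) = d}" "lab t' = lab t"
      then show "t' \<in> {t. lab t = Some l \<and> int (mon_deg t) = d}"
        using deg[of t l t'] by simp
    qed (use f in \<open>auto simp: label_ideal_def\<close>)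
    then show ?thesis
      using f by (simp add: label_ideal_def hom_comp_def coeff_sum_restrict_mons)
  qed
  ultimately show ?thesis
    by (auto simp: hideal_def label_ideal_add) (auto simp: label_ideal_def)
qed

text \<open>Only the partition of \<open>mons N\<close> matters, not the names of the classes, which
  may even have different types. Ideals of minors and ideals of variables are compared in this
  way.\<close>

lemma label_ideal_mono:
  assumes "\<And>t. t \<in> mons N \<Longrightarrow> lab t = None \<longleftrightarrow> lab' t = None"
    and "\<And>t t'. t \<in> mons N \<Longrightarrow> t' \<in> mons N \<Longrightarrow> lab t \<noteq> None \<Longrightarrow> lab t = lab t' \<longleftrightarrow> lab' t = lab' t'"
  shows "label_ideal N lab \<subseteq> (label_ideal N lab' :: 'k::field mpoly set)"
proof
  fix f :: "'k mpoly" assume f: "f \<in> label_ideal N lab"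
  then have keys: "t \<in> mons N" if "t \<in> keys f" for t
    using that by (auto simp: label_ideal_def polys_iff)
  have "coeff_sum {t. lab' t = Some l} f = 0" for l
  proof (cases "\<exists>t0\<in>keys f. lab' t0 = Some l")
    case True
    then obtain t0 k where t0: "t0 \<in> keys f" "lab' t0 = Some l" "lab t0 = Some k"
      using assms(1) keys by fastforce
    have "coeff_sum {t. lab' t = Some l} f = coeff_sum {t. lab t = Some k} f"
    proof (rule coeff_sum_cong)
      fix t assume "t \<in> keys f"
      then have "lab t0 = lab t \<longleftrightarrow> lab' t0 = lab' t"
        using assms(2)[OF keys[OF t0(1)] keys] t0(3) by simp
      then show "t \<in> {t. lab' t = Some l} \<longleftrightarrow> t \<in> {t. lab t = Some k}"
        unfolding mem_Collect_eq t0(2,3) by metis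
    qed
    then show ?thesis
      using f by (simp add: label_ideal_def)
  next
    case False
    then show ?thesis
      by (intro coeff_sum_eq_0) auto
  qed
  then show "f \<in> label_ideal N lab'"
    using f by (simp add: label_ideal_def)
qed

lemma label_ideal_cong:
  assumes "\<And>t. t \<in> mons N \<Longrightarrow> lab t = None \<longleftrightarrow> lab' t = None"
    and "\<And>t t'. t \<in> mons N \<Longrightarrow> t' \<in> mons N \<Longrightarrow> lab t \<noteq> None \<Longrightarrow> lab t = lab t' \<longleftrightarrow> lab' t = lab' t'"
  shows "label_ideal N lab = label_ideal N lab'"
proof (rule equalityI)
  show "label_ideal N lab \<subseteq> label_ideal N lab'"
    by (rule label_ideal_mono[OF assms])
  have "lab' t = lab' t' \<longleftrightarrow> lab t = lab t'" if "t \<in> mons N" "t' \<in> mons N" "lab' t \<noteq> None" for t t'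
    using assms(1)[OF that(1)] assms(2)[OF that(1,2)] that(3) by blast
  then show "label_ideal N lab' \<subseteq> label_ideal N lab"
    using assms(1) by (intro label_ideal_mono) blast+
qed

text \<open>A class sum of x_v g is the sum of the coefficients of g over the preimage of the class
  under multiplication by x_v.\<close>

lemma label_ideal_colon:
  assumes "v \<in> vars N"
  shows "ideal_colon N (label_ideal N lab) (var_poly v) = label_ideal N (\<lambda>t. lab (single v 1 + t))"
  using assms polys_var[OF assms]
  by (auto simp: ideal_colon_def label_ideal_def coeff_sum_monomial_mult var_poly_def)

text \<open>Adjoining a variable kills exactly the classes containing one of its multiples:
  \<open>shift\<close> kills all multiples, \<open>none\<close> provides a multiple in every newly
  killed class, and \<open>some\<close> and \<open>fine\<close> keep the other classes as they
  were.\<close>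

lemma label_ideal_adjoin:
  fixes lab \<mu> :: "(var \<Rightarrow>\<^sub>0 nat) \<Rightarrow> 'l option"
  assumes v: "v \<in> vars N"
    and none: "\<And>t. t \<in> mons N \<Longrightarrow> \<mu> t = None \<Longrightarrow> lab t \<noteq> None \<Longrightarrow> \<exists>s\<in>mons N. lab (single v 1 + s) = lab t"
    and some: "\<And>t. t \<in> mons N \<Longrightarrow> \<mu> t \<noteq> None \<Longrightarrow> \<mu> t = lab t"
    and shift: "\<And>s. s \<in> mons N \<Longrightarrow> \<mu> (single v 1 + s) = None"
    and fine: "\<And>t t'. t \<in> mons N \<Longrightarrow> t' \<in> mons N \<Longrightarrow> lab t = lab t' \<Longrightarrow> \<mu> t = \<mu> t'"
  shows "ideal_adjoin N (label_ideal N lab) (var_poly v) = (label_ideal N \<mu> :: 'k::field mpoly set)"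
proof (intro equalityI subsetI)
  fix h :: "'k mpoly" assume "h \<in> ideal_adjoin N (label_ideal N lab) (var_poly v)"
  then obtain f g where h: "h = f + var_poly v * g" "f \<in> label_ideal N lab" "g \<in> polys N"
    by (auto simp: ideal_adjoin_def)
  have "coeff_sum {t. \<mu> t = Some l} f = 0" for l
  proof (cases "\<exists>t0\<in>keys f. \<mu> t0 = Some l")
    case True
    then obtain t0 where t0: "t0 \<in> keys f" "\<mu> t0 = Some l" by blast
    have mons: "t \<in> mons N" if "t \<in> keys f" for t
      using h(2) that by (auto simp: label_ideal_def polys_iff)
    have "\<mu> t = Some l \<longleftrightarrow> lab t = Some l" if "t \<in> keys f" for t
      using some[of t] some[of t0] fine[of t t0] mons[OF that] mons[OF t0(1)] t0(2)
      by (metis option.distinct(1))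
    then have "coeff_sum {t. \<mu> t = Some l} f = coeff_sum {t. lab t = Some l} f"
      by (intro coeff_sum_cong) auto
    then show ?thesis
      using h(2) by (simp add: label_ideal_def)
  qed (intro coeff_sum_eq_0, auto)
  moreover have "coeff_sum {t. \<mu> t = Some l} (var_poly v * g) = 0" for l
  proof (rule coeff_sum_eq_0)
    fix t assume "t \<in> keys (var_poly v * g)"
    then obtain s where "s \<in> keys g" "t = single v 1 + s"
      using keys_monomial_mult[of "single v 1" 1 g] unfolding var_poly_def by blast
    then have "\<mu> t = None"
      using h(3) shift[of s] by (auto simp: polys_iff)
    then show "t \<notin> {t. \<mu> t = Some l}"
      by simp
  qed
  ultimately show "h \<in> label_ideal N \<mu>"
    using h v by (simp add: label_ideal_def)
next
  fix f :: "'k mpoly" assume f: "f \<in> label_ideal N \<mu>"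
  then have mons: "t \<in> mons N" if "t \<in> keys f" for t
    using that by (auto simp: label_ideal_def polys_iff)
  \<comment> \<open>\<open>R\<close> collects the monomials of \<open>f\<close> in newly killed
    classes. Each is traded for a multiple of the variable in the same class, and \<open>g\<close>
    below gathers the cofactors, so that f - x_v g has all class sums zero.\<close>
  define R where "R = {t \<in> keys f. \<mu> t = None \<and> lab t \<noteq> None}"
  have "\<forall>t\<in>R. \<exists>s\<in>mons N. lab (single v 1 + s) = lab t"
    using none mons by (auto simp: R_def)
  then obtain \<sigma> where \<sigma>: "\<And>t. t \<in> R \<Longrightarrow> \<sigma> t \<in> mons N \<and> lab (single v 1 + \<sigma> t) = lab t"
    by metis
  define g where "g = (\<Sum>t\<in>R. single (\<sigma> t) (lookup f t))"
  have g: "g \<in> polys N"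
    using \<sigma> by (auto simp: g_def intro!: polys_sum)
  have vg: "var_poly v * g = (\<Sum>t\<in>R. single (single v 1 + \<sigma> t) (lookup f t))"
    by (simp add: g_def var_poly_def sum_distrib_left mult_single)
  have "coeff_sum {t. lab t = Some l} (f - var_poly v * g) = 0" for l
  proof -
    have "coeff_sum {t. lab t = Some l} (var_poly v * g) = (\<Sum>t\<in>R. lookup f t when lab t = Some l)"
      using \<sigma> by (auto simp: vg coeff_sum_sum intro!: sum.cong)
    also have "\<dots> = coeff_sum {t. lab t = Some l \<and> \<mu> t = None} f"
      unfolding coeff_sum_def by (rule sum.mono_neutral_cong_left) (auto simp: R_def when_def)
    finally have "coeff_sum {t. lab t = Some l} (f - var_poly v * g)
        = coeff_sum {t. lab t = Some l} f - coeff_sum {t. lab t = Some l \<and> \<mu> t = None} f"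
      by simp
    also have "\<dots> = coeff_sum {t. \<mu> t = Some l} f"
      unfolding coeff_sum_def sum_subtractf[symmetric]
      using some mons by (intro sum.cong) (auto simp: when_def)
    also have "\<dots> = 0"
      using f by (simp add: label_ideal_def)
    finally show ?thesis .
  qed
  then have "f - var_poly v * g \<in> label_ideal N lab"
    using f g v by (simp add: label_ideal_def)
  then show "f \<in> ideal_adjoin N (label_ideal N lab) (var_poly v)"
    using g unfolding ideal_adjoin_def by (force intro: exI[of _ "f - var_poly v * g"] exI[of _ g])
qed

section \<open>Ideals generated by variables\<close>

definition var_label :: "var set \<Rightarrow> (var \<Rightarrow>\<^sub>0 nat) \<Rightarrow> (var \<Rightarrow>\<^sub>0 nat) option" where
  "var_label W t = (if keys t \<inter> W = {} then Some t else None)"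

abbreviation var_ideal :: "nat \<Rightarrow> var set \<Rightarrow> 'k::field mpoly set" where
  "var_ideal N W \<equiv> label_ideal N (var_label W)"

lemma compatible_var_label: "compatible (var_label W)"
  by (auto simp: compatible_def var_label_def keys_add_nat split: if_splits)

lemma var_ideal_iff: "f \<in> var_ideal N W \<longleftrightarrow> f \<in> polys N \<and> (\<forall>t\<in>keys f. keys t \<inter> W \<noteq> {})"
proof -
  have "coeff_sum {t. var_label W t = Some l} f = (lookup f l when keys l \<inter> W = {})" for l
  proof (cases "keys l \<inter> W = {}")
    case True
    then have "{t. var_label W t = Some l} = {l}"
      by (auto simp: var_label_def split: if_splits)
    then show ?thesis
      using True by (simp add: coeff_sum_singleton)
  qed (auto simp: var_label_def split: if_splits intro!: coeff_sum_eq_0)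
  then show ?thesis
    by (auto simp: label_ideal_def when_def in_keys_iff)
qed

lemma keys_decompose:
  assumes "v \<in> keys (t :: var \<Rightarrow>\<^sub>0 nat)"
  obtains s where "t = single v 1 + s"
proof -
  have "t = single v 1 + (t - single v 1)"
    using assms by (intro poly_mapping_eqI) (auto simp: lookup_add lookup_minus lookup_single when_def in_keys_iff)
  then show ?thesis
    using that by blast
qed

lemma var_ideal_colon:
  assumes "w \<in> vars N" "w \<notin> W"
  shows "ideal_colon N (var_ideal N W) (var_poly w) = var_ideal N W"
  unfolding label_ideal_colon[OF assms(1)] using assms
  by (intro label_ideal_cong) (auto simp: var_label_def keys_add_nat split: if_splits)

lemma var_ideal_adjoin:
  assumes "w \<in> vars N"
  shows "ideal_adjoin N (var_ideal N W) (var_poly w) = var_ideal N (insert w W)"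
proof (rule label_ideal_adjoin[OF assms])
  fix t assume "t \<in> mons N" "var_label (insert w W) t = None" "var_label W t \<noteq> None"
  then have "w \<in> keys t"
    by (auto simp: var_label_def split: if_splits)
  then obtain s where "t = single w 1 + s"
    by (rule keys_decompose)
  then show "\<exists>s\<in>mons N. var_label W (single w 1 + s) = var_label W t"
    using \<open>t \<in> mons N\<close> by auto
qed (auto simp: var_label_def keys_add_nat split: if_splits)

lemma var_ideal_empty: "var_ideal N {} = {0}"
  by (auto simp: var_ideal_iff)

text \<open>The variables in \<open>W\<close> form a regular sequence of linear forms, and each of
  them allows only one further step from (i, d) to (i + 1, d + 1).\<close>

lemma (in resolution) tor_vanishes_var_ideal:
  assumes "W \<subseteq> vars N" and "\<not> (d = int i \<and> i \<le> card W)"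
  shows "tor_vanishes N F (var_ideal N W) i d"
proof -
  have "finite W"
    using assms(1) finite_subset[OF _ finite_vars] by blast
  then show ?thesis
    using assms
  proof (induction W arbitrary: i d rule: finite_induct)
    case empty
    then show ?case
      using tor_vanishes_zero_ideal[of i d] by (cases "i = 0") (auto simp: var_ideal_empty)
  next
    case (insert w W)
    then have w: "w \<in> vars N" "w \<notin> W" by auto
    have "tor_vanishes N F (ideal_adjoin N (var_ideal N W) (var_poly w)) i d"
    proof (rule tor_vanishes_right)
      show "tor_vanishes N F (var_ideal N W) i d"
        using insert by (intro insert.IH) auto
      show "i = 0 \<or> tor_vanishes N F (ideal_colon N (var_ideal N W) (var_poly w)) (i - 1) (d - 1)"
        unfolding var_ideal_colon[OF w] using insert by (cases i) (auto intro!: insert.IH)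
    qed (auto simp: w var_ideal_colon var_ideal_adjoin hideal_label_ideal compatible_var_label)
    then show ?case
      by (simp add: var_ideal_adjoin w)
  qed
qed

section \<open>The ideal of two-minors\<close>

definition vertex_deg :: "(var \<Rightarrow>\<^sub>0 nat) \<Rightarrow> nat \<Rightarrow> nat" where
  "vertex_deg t i = lookup t (VX i) + lookup t (VY i)"

definition x_deg :: "(var \<Rightarrow>\<^sub>0 nat) \<Rightarrow> nat" where
  "x_deg t = (\<Sum>v\<in>keys t. case v of VX i \<Rightarrow> lookup t v | VY i \<Rightarrow> 0)"

definition vertex_vars :: "nat set \<Rightarrow> var set" where
  "vertex_vars U = VX ` U \<union> VY ` U"

lemma vertex_deg_add [simp]: "vertex_deg (s + t) i = vertex_deg s i + vertex_deg t i"
  by (simp add: vertex_deg_def lookup_add)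

lemma vertex_deg_add_cancel [simp]: "vertex_deg (s + t) = vertex_deg (s + t') \<longleftrightarrow> vertex_deg t = vertex_deg t'"
  by (simp add: fun_eq_iff)

lemma vertex_deg_single [simp]:
  "vertex_deg (single (VX k) e) i = (if i = k then e else 0)"
  "vertex_deg (single (VY k) e) i = (if i = k then e else 0)"
  by (auto simp: vertex_deg_def lookup_single when_def)

lemma x_deg_eq_sum:
  assumes "finite A" "\<And>i. VX i \<in> keys t \<Longrightarrow> i \<in> A"
  shows "x_deg t = (\<Sum>i\<in>A. lookup t (VX i))"
proof -
  have "x_deg t = (\<Sum>v\<in>VX ` A. lookup t v)"
    unfolding x_deg_def
    by (rule sum.mono_neutral_cong) (use assms in \<open>auto simp: in_keys_iff split: var.splits\<close>)
  then show ?thesis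
    by (simp add: sum.reindex inj_on_def)
qed

lemma finite_VX_keys: "finite {i. VX i \<in> keys t}"
  using finite_vimageI[of "keys t" VX] by (simp add: vimage_def inj_on_def)

lemma x_deg_add [simp]: "x_deg (s + t) = x_deg s + x_deg t"
proof -
  let ?A = "{i. VX i \<in> keys s} \<union> {i. VX i \<in> keys t}"
  have "x_deg r = (\<Sum>i\<in>?A. lookup r (VX i))" if "keys r \<subseteq> keys s \<union> keys t" for r
    using that finite_VX_keys by (intro x_deg_eq_sum) auto
  from this[of s] this[of t] this[of "s + t"] show ?thesis
    by (simp add: keys_add_nat lookup_add sum.distrib)
qed

lemma x_deg_single [simp]: "x_deg (single (VX k) e) = e" "x_deg (single (VY k) e) = 0"
  by (simp_all add: x_deg_def)

lemma x_deg_zero [simp]: "x_deg 0 = 0"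
  by (simp add: x_deg_def)

lemma x_deg_eq_0_iff: "x_deg t = 0 \<longleftrightarrow> (\<forall>i. VX i \<notin> keys t)"
  using x_deg_eq_sum[OF finite_VX_keys, of t t] finite_VX_keys[of t] by (auto simp: in_keys_iff)

lemma vertex_deg_eq_0_iff: "vertex_deg t i = 0 \<longleftrightarrow> VX i \<notin> keys t \<and> VY i \<notin> keys t"
  by (auto simp: vertex_deg_def in_keys_iff)

lemma vertex_deg_avoid: "(\<forall>i\<in>U. vertex_deg t i = 0) \<longleftrightarrow> keys t \<inter> vertex_vars U = {}"
  by (auto simp: vertex_deg_eq_0_iff vertex_vars_def)

lemma vars_eq_vertex_vars: "vars N = vertex_vars {1..N}"
  by (simp add: vars_def vertex_vars_def)

lemma card_vertex_vars: "finite A \<Longrightarrow> card (vertex_vars A) = 2 * card A"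
  unfolding vertex_vars_def by (subst card_Un_disjoint) (auto simp: card_image inj_on_def)

lemma keys_subset_vertex_vars: "\<exists>A. finite A \<and> keys t \<subseteq> vertex_vars A"
proof -
  let ?ix = "case_var (\<lambda>i. i) (\<lambda>i. i)"
  have "v \<in> vertex_vars (?ix ` keys t)" if "v \<in> keys t" for v
    using imageI[OF that, of ?ix] by (cases v) (simp_all add: vertex_vars_def)
  then have "keys t \<subseteq> vertex_vars (?ix ` keys t)"
    by blast
  then show ?thesis
    by (intro exI[of _ "?ix ` keys t"]) simp
qed

lemma mon_deg_eq_vertex_deg:
  assumes "finite A" "keys t \<subseteq> vertex_vars A"
  shows "mon_deg t = (\<Sum>i\<in>A. vertex_deg t i)"
proof -
  have "mon_deg t = (\<Sum>v\<in>VX ` A \<union> VY ` A. lookup t v)"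
    using assms by (intro mon_deg_eq_sum) (auto simp: vertex_vars_def)
  also have "\<dots> = (\<Sum>v\<in>VX ` A. lookup t v) + (\<Sum>v\<in>VY ` A. lookup t v)"
    using assms(1) by (intro sum.union_disjoint) auto
  also have "\<dots> = (\<Sum>i\<in>A. vertex_deg t i)"
    by (simp add: sum.reindex inj_on_def vertex_deg_def sum.distrib)
  finally show ?thesis .
qed

lemma mon_deg_cong:
  assumes "vertex_deg t = vertex_deg t'"
  shows "mon_deg t = mon_deg t'"
proof -
  obtain A where A: "finite A" "keys t \<subseteq> vertex_vars A"
    using keys_subset_vertex_vars by blast
  have "vertex_deg t' i = 0" if "i \<notin> A" for i
    using A(2) that unfolding assms[symmetric] vertex_deg_eq_0_iff by (auto simp: vertex_vars_def)
  then have "keys t' \<subseteq> vertex_vars A"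
    unfolding vertex_deg_eq_0_iff vertex_vars_def
    by (metis UnI1 UnI2 imageI subsetI var.exhaust)
  then show ?thesis
    using A assms by (simp add: mon_deg_eq_vertex_deg)
qed

definition minor_label :: "nat set \<Rightarrow> (var \<Rightarrow>\<^sub>0 nat) \<Rightarrow> ((nat \<Rightarrow> nat) \<times> nat) option" where
  "minor_label U t = (if \<exists>i\<in>U. vertex_deg t i \<noteq> 0 then None else Some (vertex_deg t, x_deg t))"

text \<open>The label is the exponent vector of the image of a monomial under
  \<open>x\<^sub>i \<mapsto> s t\<^sub>i\<close>, \<open>y\<^sub>i \<mapsto> u t\<^sub>i\<close>, whose kernel is generated by the two-minors; so this is the
  ideal generated by the two-minors and the variables \<open>x\<^sub>i\<close>, \<open>y\<^sub>i\<close> with \<open>i \<in> U\<close>.\<close>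

abbreviation minor_ideal :: "nat \<Rightarrow> nat set \<Rightarrow> 'k::field mpoly set" where
  "minor_ideal N U \<equiv> label_ideal N (minor_label U)"

lemma minor_label_eq_None_iff: "minor_label U t = None \<longleftrightarrow> keys t \<inter> vertex_vars U \<noteq> {}"
  using vertex_deg_avoid[of U t] by (auto simp: minor_label_def)

lemma minor_label_eq_iff:
  "minor_label U t \<noteq> None \<Longrightarrow>
    minor_label U t = minor_label U t' \<longleftrightarrow> vertex_deg t = vertex_deg t' \<and> x_deg t = x_deg t'"
  by (auto simp: minor_label_def split: if_splits)

lemma compatible_minor_label: "compatible (minor_label U)"
  unfolding compatible_def
proof (intro conjI allI impI)
  fix s t t' :: "var \<Rightarrow>\<^sub>0 nat"
  show "minor_label U (s + t) = minor_label U (s + t')" if "minor_label U t = minor_label U t'"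
    using that by (auto simp: minor_label_def split: if_splits)
  show "minor_label U (s + t) = None" if "minor_label U t = None"
    using that by (auto simp: minor_label_def split: if_splits)
  show "mon_deg t = mon_deg t'" if "minor_label U t \<noteq> None" "minor_label U t = minor_label U t'"
    using that mon_deg_cong minor_label_eq_iff by blast
qed

lemma hideal_minor_ideal: "hideal N (minor_ideal N U)"
  by (rule hideal_label_ideal[OF compatible_minor_label])

lemma hideal_var_ideal: "hideal N (var_ideal N W)"
  by (rule hideal_label_ideal[OF compatible_var_label])

text \<open>Multiplication by x_k shifts the vertex degrees and the x-degree by fixed amounts, so
  for k outside \<open>U\<close> it neither merges nor kills classes: x_k is regular modulo
  T(U).\<close>

lemma minor_ideal_colon_x:
  assumes "k \<in> {1..N}" "k \<notin> U"
  shows "ideal_colon N (minor_ideal N U) (var_poly (VX k)) = minor_ideal N U"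
proof -
  have "VX k \<in> vars N"
    using assms by (simp add: vars_def)
  then show ?thesis
    unfolding label_ideal_colon[OF \<open>VX k \<in> vars N\<close>] using assms
    by (intro label_ideal_cong) (auto simp: minor_label_def split: if_splits)
qed

text \<open>The label of the ideal generated by \<open>minor_ideal N U\<close> and \<open>x\<^sub>k\<close>: modulo the
  two-minors, a monomial is divisible by \<open>x\<^sub>k\<close> iff it involves the vertex \<open>k\<close> and some \<open>x\<^sub>i\<close>.\<close>

definition minor_label_x :: "nat set \<Rightarrow> nat \<Rightarrow> (var \<Rightarrow>\<^sub>0 nat) \<Rightarrow> ((nat \<Rightarrow> nat) \<times> nat) option" where
  "minor_label_x U k t = (if vertex_deg t k \<noteq> 0 \<and> x_deg t \<noteq> 0 then None else minor_label U t)"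

lemma compatible_minor_label_x: "compatible (minor_label_x U k)"
  unfolding compatible_def
proof (intro conjI allI impI)
  fix s t t' :: "var \<Rightarrow>\<^sub>0 nat"
  show "minor_label_x U k (s + t) = minor_label_x U k (s + t')" if "minor_label_x U k t = minor_label_x U k t'"
    using that by (auto simp: minor_label_x_def minor_label_def split: if_splits)
  show "minor_label_x U k (s + t) = None" if "minor_label_x U k t = None"
    using that by (auto simp: minor_label_x_def minor_label_def split: if_splits)
  show "mon_deg t = mon_deg t'" if "minor_label_x U k t \<noteq> None" "minor_label_x U k t = minor_label_x U k t'"
    using that mon_deg_cong[of t t'] by (auto simp: minor_label_x_def minor_label_def split: if_splits)
qed

lemma minor_ideal_adjoin_x:
  assumes "k \<in> {1..N}"
  shows "ideal_adjoin N (minor_ideal N U) (var_poly (VX k)) = label_ideal N (minor_label_x U k)"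
proof (rule label_ideal_adjoin)
  show vk: "VX k \<in> vars N"
    using assms by (simp add: vars_def)
  fix t assume t: "t \<in> mons N" "minor_label_x U k t = None" "minor_label U t \<noteq> None"
  then have "VX k \<in> keys t \<or> VY k \<in> keys t" "x_deg t \<noteq> 0"
    using vertex_deg_eq_0_iff[of t k] by (auto simp: minor_label_x_def split: if_splits)
  then show "\<exists>s\<in>mons N. minor_label U (single (VX k) 1 + s) = minor_label U t"
  proof (elim disjE)
    assume "VX k \<in> keys t"
    then obtain s where "t = single (VX k) 1 + s"
      by (rule keys_decompose)
    then show ?thesis
      using t by auto
  next
    assume "VY k \<in> keys t"
    then obtain s where s: "t = single (VY k) 1 + s"
      by (rule keys_decompose)
    then have "x_deg s \<noteq> 0"
      using \<open>x_deg t \<noteq> 0\<close> by simp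
    then obtain i where "VX i \<in> keys s"
      by (auto simp: x_deg_eq_0_iff)
    then obtain r where r: "s = single (VX i) 1 + r"
      by (rule keys_decompose)
    \<comment> \<open>The minor exchanges y_k x_i for x_k y_i without changing the label, which
      brings out the factor x_k.\<close>
    let ?s = "single (VY i) 1 + r"
    have "vertex_deg (single (VX k) 1 + ?s) = vertex_deg t" "x_deg (single (VX k) 1 + ?s) = x_deg t"
      by (auto simp: s r fun_eq_iff)
    then have "minor_label U (single (VX k) 1 + ?s) = minor_label U t"
      by (simp add: minor_label_def)
    moreover have "?s \<in> mons N"
      using t(1) by (auto simp: s r vars_def)
    ultimately show ?thesis by blast
  qed
qed (auto simp: minor_label_x_def minor_label_def split: if_splits)

text \<open>A factor y_k makes the vertex k present, so y_k t dies as soon as t contains any x_i.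
  What survives are monomials in the y_i with i outside \<open>U\<close>, and these are determined
  by their vertex degrees.\<close>

lemma minor_ideal_adjoin_x_colon_y:
  assumes "k \<in> {1..N}" "k \<notin> U" "U \<subseteq> {1..N}"
  shows "ideal_colon N (label_ideal N (minor_label_x U k)) (var_poly (VY k))
    = (var_ideal N (VX ` {1..N} \<union> VY ` U) :: 'k::field mpoly set)"
proof -
  have "VY k \<in> vars N"
    using assms by (simp add: vars_def)
  have *: "minor_label_x U k (single (VY k) 1 + t) = None \<longleftrightarrow> var_label (VX ` {1..N} \<union> VY ` U) t = None"
    if "t \<in> mons N" for t
  proof -
    have "minor_label_x U k (single (VY k) 1 + t) = None \<longleftrightarrow> x_deg t \<noteq> 0 \<or> (\<exists>i\<in>U. vertex_deg t i \<noteq> 0)"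
      using assms by (auto simp: minor_label_x_def minor_label_def)
    also have "\<dots> \<longleftrightarrow> keys t \<inter> (VX ` {1..N} \<union> VY ` U) \<noteq> {}"
      using that by (auto simp: x_deg_eq_0_iff vertex_deg_eq_0_iff mons_def vars_def)
    finally show ?thesis
      by (simp add: var_label_def)
  qed
  have "label_ideal N (\<lambda>t. minor_label_x U k (single (VY k) 1 + t))
    = (var_ideal N (VX ` {1..N} \<union> VY ` U) :: 'k mpoly set)"
  proof (rule label_ideal_cong)
    fix t t' assume t: "t \<in> mons N" "t' \<in> mons N" "minor_label_x U k (single (VY k) 1 + t) \<noteq> None"
    show "minor_label_x U k (single (VY k) 1 + t) = minor_label_x U k (single (VY k) 1 + t') \<longleftrightarrow>
        var_label (VX ` {1..N} \<union> VY ` U) t = var_label (VX ` {1..N} \<union> VY ` U) t'"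
    proof
      assume eq: "minor_label_x U k (single (VY k) 1 + t) = minor_label_x U k (single (VY k) 1 + t')"
      then have "vertex_deg t = vertex_deg t'" "x_deg t = 0" "x_deg t' = 0"
        using t(3) by (auto simp: minor_label_x_def minor_label_def split: if_splits)
      then have "lookup t v = lookup t' v" for v
        by (cases v) (auto simp: x_deg_eq_0_iff in_keys_iff vertex_deg_def fun_eq_iff)
      then have "t = t'"
        by (rule poly_mapping_eqI)
      then show "var_label (VX ` {1..N} \<union> VY ` U) t = var_label (VX ` {1..N} \<union> VY ` U) t'"
        by simp
    next
      assume "var_label (VX ` {1..N} \<union> VY ` U) t = var_label (VX ` {1..N} \<union> VY ` U) t'"
      moreover have "var_label (VX ` {1..N} \<union> VY ` U) t \<noteq> None"
        using t(3) unfolding *[OF t(1)] .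
      ultimately show "minor_label_x U k (single (VY k) 1 + t) = minor_label_x U k (single (VY k) 1 + t')"
        by (auto simp: var_label_def split: if_splits)
    qed
  qed (simp only: *)
  then show ?thesis
    by (simp add: label_ideal_colon[OF \<open>VY k \<in> vars N\<close>])
qed

lemma minor_ideal_adjoin_xy:
  assumes "k \<in> {1..N}"
  shows "ideal_adjoin N (label_ideal N (minor_label_x U k)) (var_poly (VY k)) = minor_ideal N (insert k U)"
proof (rule label_ideal_adjoin)
  show vk: "VY k \<in> vars N"
    using assms by (simp add: vars_def)
  fix t assume t: "t \<in> mons N" "minor_label (insert k U) t = None" "minor_label_x U k t \<noteq> None"
  have "x_deg t = 0" "vertex_deg t k \<noteq> 0"
    using t by (auto simp: minor_label_x_def minor_label_def split: if_splits)
  then have "VY k \<in> keys t"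
    by (auto simp: vertex_deg_eq_0_iff x_deg_eq_0_iff)
  then obtain s where "t = single (VY k) 1 + s"
    by (rule keys_decompose)
  then show "\<exists>s\<in>mons N. minor_label_x U k (single (VY k) 1 + s) = minor_label_x U k t"
    using t by auto
qed (auto simp: minor_label_x_def minor_label_def split: if_splits)

lemma single_vertex_unique:
  assumes "{1..N} \<subseteq> insert k U" "t \<in> mons N" "t' \<in> mons N" "keys t \<inter> vertex_vars U = {}"
    and "vertex_deg t = vertex_deg t'" "x_deg t = x_deg t'"
  shows "t = t'"
proof -
  have 0: "vertex_deg t i = 0" if "i \<noteq> k" for i
  proof (cases "i \<in> U")
    case True
    then show ?thesis using assms(4) vertex_deg_avoid by blast
  next
    case False
    then show ?thesis
      using that assms(1,2) by (auto simp: vertex_deg_eq_0_iff mons_def vars_def)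
  qed
  have zero': "vertex_deg t' i = 0" if "i \<noteq> k" for i
    using 0[OF that] assms(5) by simp
  have x: "x_deg s = lookup s (VX k)" if s: "\<And>i. i \<noteq> k \<Longrightarrow> vertex_deg s i = 0" for s
  proof -
    have "i \<in> {k}" if "VX i \<in> keys s" for i
      using s[of i] that by (cases "i = k") (simp_all add: vertex_deg_eq_0_iff)
    then have "x_deg s = (\<Sum>i\<in>{k}. lookup s (VX i))"
      by (intro x_deg_eq_sum) simp_all
    then show ?thesis
      by simp
  qed
  have "lookup t v = lookup t' v" for v
  proof (cases "v = VX k \<or> v = VY k")
    case True
    have "lookup t (VX k) = lookup t' (VX k)"
      using x[of t, OF 0] x[of t', OF zero'] assms(6) by simp
    then show ?thesis
      using True fun_cong[OF assms(5), of k] by (auto simp: vertex_deg_def)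
  next
    case False
    then obtain i where "i \<noteq> k" "v = VX i \<or> v = VY i"
      by (cases v) auto
    then show ?thesis
      using 0[of i] zero'[of i] by (auto simp: vertex_deg_def)
  qed
  then show ?thesis
    by (rule poly_mapping_eqI)
qed

text \<open>At most one vertex avoids \<open>U\<close>, so no minor is left: a monomial in x_k and
  y_k can be recovered from its degree and its x-degree. This is the base of the induction on
  \<open>U\<close>.\<close>

lemma minor_ideal_single_vertex:
  assumes "{1..N} \<subseteq> insert k U"
  shows "minor_ideal N U = (var_ideal N (vertex_vars U) :: 'k::field mpoly set)"
proof (rule label_ideal_cong)
  show *: "minor_label U t = None \<longleftrightarrow> var_label (vertex_vars U) t = None" for t
    by (simp add: minor_label_eq_None_iff var_label_def)
  fix t t' assume t: "t \<in> mons N" "t' \<in> mons N" "minor_label U t \<noteq> None"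
  show "minor_label U t = minor_label U t' \<longleftrightarrow> var_label (vertex_vars U) t = var_label (vertex_vars U) t'"
  proof -
    have avoid: "keys t \<inter> vertex_vars U = {}"
      using t(3) unfolding minor_label_eq_None_iff by simp
    have "minor_label U t = minor_label U t' \<longleftrightarrow> t = t'"
      using single_vertex_unique[OF assms t(1,2) avoid] minor_label_eq_iff[OF t(3)] by blast
    moreover have "var_label (vertex_vars U) t = var_label (vertex_vars U) t' \<longleftrightarrow> t = t'"
      using avoid by (auto simp: var_label_def)
    ultimately show ?thesis
      by simp
  qed
qed

text \<open>Raising (i, d) to (i + 1, d + 1) keeps the row, and adding a vertex raises the bound N +
  |U| by one, so the hypothesis passes to \<open>insert k U\<close>. With one vertex left the ideal
  is generated by 2|U| = N + |U| - 1 variables, which fixes the bound.\<close>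

lemma (in resolution) tor_vanishes_minor_ideal:
  assumes "U \<subseteq> {1..N}" "U \<noteq> {1..N}"
    and "d \<noteq> int i \<and> d \<noteq> int i + 1 \<or> N + card U \<le> i"
  shows "tor_vanishes N F (minor_ideal N U) i d"
  using assms
proof (induction "card ({1..N} - U)" arbitrary: U i d rule: less_induct)
  case less
  then obtain k where k: "k \<in> {1..N}" "k \<notin> U"
    by blast
  have fin: "finite U"
    using less.prems(1) finite_subset by blast
  show ?case
  proof (cases "{1..N} = insert k U")
    case True
    then have "N = Suc (card U)"
      using k fin by (metis card_atLeastAtMost card_insert_disjoint diff_Suc_1)
    then show ?thesis
      unfolding minor_ideal_single_vertex[OF equalityD1[OF True]]
      using less.prems fin
      by (intro tor_vanishes_var_ideal) (auto simp: vertex_vars_def vars_def card_vertex_vars[unfolded vertex_vars_def])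
  next
    case False
    have v: "VX k \<in> vars N" "VY k \<in> vars N"
      using k(1) by (simp_all add: vars_def)
    let ?W = "VX ` {1..N} \<union> VY ` U"
    have "card ?W = N + card U"
      using fin by (subst card_Un_disjoint) (auto simp: card_image inj_on_def)
    moreover have "?W \<subseteq> vars N"
      using less.prems(1) by (auto simp: vars_def)
    \<comment> \<open>The colon ideal is generated by N + |U| variables and is needed in bidegree (i
      + 1, d), the degree of y_k being already subtracted. Its Tor could only survive for d = i + 1
      <= N + |U|, which the hypothesis excludes.\<close>
    ultimately have W: "tor_vanishes N F (var_ideal N ?W) (Suc i) (d + 1 - 1)"
      using less.prems(3) by (intro tor_vanishes_var_ideal) auto
    have "card ({1..N} - insert k U) < card ({1..N} - U)"
    proof (rule psubset_card_mono)
      show "{1..N} - insert k U \<subset> {1..N} - U"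
        using k by blast
    qed simp
    moreover have "insert k U \<subseteq> {1..N}" "insert k U \<noteq> {1..N}"
      using k less.prems(1) False by blast+
    moreover have "d + 1 \<noteq> int (Suc i) \<and> d + 1 \<noteq> int (Suc i) + 1 \<or> N + card (insert k U) \<le> Suc i"
      using less.prems(3) k(2) fin by (simp add: add.commute)
    ultimately have Uk: "tor_vanishes N F (minor_ideal N (insert k U)) (Suc i) (d + 1)"
      by (rule less.hyps)
    note colon = minor_ideal_adjoin_x_colon_y[OF k less.prems(1)]
    note adjoin = minor_ideal_adjoin_xy[OF k(1), of U]
    have "tor_vanishes N F (label_ideal N (minor_label_x U k)) (Suc i) (d + 1)"
      by (rule tor_vanishes_middle[where x = "var_poly (VY k)"])
        (simp_all only: colon adjoin W Uk hom_polys_var[OF v(2)] hideal_label_ideal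
          compatible_minor_label_x compatible_minor_label compatible_var_label)
    then have "tor_vanishes N F (ideal_adjoin N (minor_ideal N U) (var_poly (VX k))) (Suc i) (d + 1)"
      by (simp only: minor_ideal_adjoin_x[OF k(1)])
    moreover have "hideal N (ideal_adjoin N (minor_ideal N U) (var_poly (VX k)))"
      by (simp only: minor_ideal_adjoin_x[OF k(1)] hideal_label_ideal compatible_minor_label_x)
    ultimately show ?thesis
      using tor_vanishes_regular[OF hideal_minor_ideal _ minor_ideal_colon_x[OF k] hom_polys_var[OF v(1)]]
      by blast
  qed
qed

section \<open>Sums of ideals of minors with ideals of variables\<close>

lemma minor_label_eq_Some_iff:
  "minor_label U t = Some l \<longleftrightarrow> keys t \<inter> vertex_vars U = {} \<and> l = (vertex_deg t, x_deg t)"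
  using vertex_deg_avoid[of U t] by (auto simp: minor_label_def)

lemma keys_avoid_cong:
  assumes "vertex_deg t = vertex_deg t'"
  shows "keys t \<inter> vertex_vars U = {} \<longleftrightarrow> keys t' \<inter> vertex_vars U = {}"
  unfolding vertex_deg_avoid[symmetric] assms ..

text \<open>Both conditions depend only on the vertex degrees and the x-degree, so the set is a
  union of classes for \<open>U\<close>. The case \<open>V = {}\<close> serves restriction to
  monomials avoiding \<open>U\<close>, the other one monotonicity.\<close>

lemma minor_ideal_coeff_sum:
  assumes "f \<in> minor_ideal N U" "V = {} \<or> U \<subseteq> V"
  shows "coeff_sum {t. minor_label V t = Some l \<and> keys t \<inter> vertex_vars U = {}} f = 0"
proof (rule coeff_sum_saturated[of "minor_label U"])
  fix t t'
  assume t: "t \<in> {t. minor_label V t = Some l \<and> keys t \<inter> vertex_vars U = {}}"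
  then show "minor_label U t \<noteq> None"
    by (simp add: minor_label_eq_None_iff)
  assume "minor_label U t' = minor_label U t"
  moreover have "minor_label U t = Some (vertex_deg t, x_deg t)"
    using t by (simp add: minor_label_eq_Some_iff)
  ultimately have eq: "vertex_deg t' = vertex_deg t" "x_deg t' = x_deg t"
    by (simp_all add: minor_label_eq_Some_iff)
  show "t' \<in> {t. minor_label V t = Some l \<and> keys t \<inter> vertex_vars U = {}}"
    using t unfolding mem_Collect_eq minor_label_eq_Some_iff keys_avoid_cong[OF eq(1)] eq by simp
qed (use assms(1) in \<open>simp add: label_ideal_def del: split_paired_All\<close>)

lemma minor_ideal_mono:
  assumes "U \<subseteq> U'"
  shows "minor_ideal N U \<subseteq> (minor_ideal N U' :: 'k::field mpoly set)"
proof
  fix f :: "'k mpoly" assume f: "f \<in> minor_ideal N U"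
  have "coeff_sum {t. minor_label U' t = Some l} f = 0" for l
  proof -
    have "{t. minor_label U' t = Some l} = {t. minor_label U' t = Some l \<and> keys t \<inter> vertex_vars U = {}}"
      using assms by (auto simp: minor_label_eq_Some_iff vertex_vars_def)
    then show ?thesis
      using minor_ideal_coeff_sum[OF f, of U' l] assms by simp
  qed
  then show "f \<in> minor_ideal N U'"
    using f by (simp add: label_ideal_def)
qed

lemma var_ideal_le_minor_ideal:
  "var_ideal N (vertex_vars U) \<subseteq> (minor_ideal N U :: 'k::field mpoly set)"
proof
  fix f :: "'k mpoly" assume f: "f \<in> var_ideal N (vertex_vars U)"
  have "coeff_sum {t. minor_label U t = Some l} f = 0" for l
  proof (rule coeff_sum_eq_0)
    fix t assume "t \<in> keys f"
    then show "t \<notin> {t. minor_label U t = Some l}"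
      using f by (simp add: var_ideal_iff minor_label_eq_Some_iff)
  qed
  moreover have "f \<in> polys N"
    using f by (simp add: label_ideal_def)
  ultimately show "f \<in> minor_ideal N U"
    by (simp add: label_ideal_def)
qed

lemma minor_ideal_restrict:
  assumes f: "f \<in> minor_ideal N U"
  shows "restrict_mons (\<lambda>t. keys t \<inter> vertex_vars U = {}) f \<in> minor_ideal N {}"
proof -
  have "f \<in> polys N"
    using f by (simp add: label_ideal_def)
  then show ?thesis
    using minor_ideal_coeff_sum[OF f, of "{}"] by (simp add: label_ideal_def coeff_sum_restrict_mons)
qed

text \<open>An element of T(U) splits into the monomials that avoid \<open>U\<close>, which have
  vanishing class sums, and the rest, which lies in the ideal of variables. In the second case a
  monomial avoiding \<open>U\<close> meets \<open>A\<close> unless it is 1, so it remains to see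
  that the constant term is zero.\<close>

lemma minor_ideal_sum_var_ideal:
  fixes I :: "'k::field mpoly set"
  assumes "I = minor_ideal N {} \<or> (I = minor_ideal N {} \<inter> var_ideal N (vertex_vars A) \<and> A \<union> U = {1..N})"
  shows "ideal_sum I (var_ideal N (vertex_vars U)) = minor_ideal N U"
proof (intro equalityI subsetI)
  fix h :: "'k mpoly" assume "h \<in> ideal_sum I (var_ideal N (vertex_vars U))"
  then obtain f g where "h = f + g" "f \<in> minor_ideal N {}" "g \<in> var_ideal N (vertex_vars U)"
    using assms unfolding ideal_sum_def by blast
  then show "h \<in> minor_ideal N U"
    using minor_ideal_mono[of "{}" U N] var_ideal_le_minor_ideal[of N U] label_ideal_add by blast
next
  fix h :: "'k mpoly" assume h: "h \<in> minor_ideal N U"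
  let ?f = "restrict_mons (\<lambda>t. keys t \<inter> vertex_vars U = {}) h"
  let ?g = "restrict_mons (\<lambda>t. \<not> keys t \<inter> vertex_vars U = {}) h"
  have hp: "h \<in> polys N"
    using h by (simp add: label_ideal_def)
  have "?f \<in> I"
    using assms
  proof (elim disjE conjE)
    assume I: "I = minor_ideal N {} \<inter> var_ideal N (vertex_vars A)" and A: "A \<union> U = {1..N}"
    have "keys t \<inter> vertex_vars A \<noteq> {}" if t: "t \<in> keys ?f" for t
    proof
      assume "keys t \<inter> vertex_vars A = {}"
      then have "keys t = {}"
      proof -
        have "vertex_vars A \<union> vertex_vars U = vars N"
          unfolding vars_eq_vertex_vars A[symmetric] by (auto simp: vertex_vars_def)
        moreover have "keys t \<subseteq> vars N" "keys t \<inter> vertex_vars U = {}"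
          using t hp by (auto simp: keys_restrict_mons polys_iff mons_def)
        ultimately show ?thesis
          using \<open>keys t \<inter> vertex_vars A = {}\<close> by blast
      qed
      then have "t = 0"
        by simp
      \<comment> \<open>The monomial 1 is alone in its class, so its class sum is the constant
        coefficient.\<close>
      have "minor_label U s = Some (vertex_deg 0, x_deg 0) \<longleftrightarrow> s = 0" for s
      proof
        assume "minor_label U s = Some (vertex_deg 0, x_deg 0)"
        then have "vertex_deg s = vertex_deg 0"
          by (simp add: minor_label_eq_Some_iff)
        then have "mon_deg s = mon_deg 0"
          by (rule mon_deg_cong)
        then show "s = 0"
          by simp
      qed (simp add: minor_label_eq_Some_iff)
      then have "{s. minor_label U s = Some (vertex_deg 0, x_deg 0)} = {0}"
        by blast
      moreover have "coeff_sum {s. minor_label U s = Some (vertex_deg 0, x_deg 0)} h = 0"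
        using h by (simp add: label_ideal_def)
      ultimately have "coeff_sum {0} h = 0"
        by simp
      then show False
        using t \<open>t = 0\<close> by (simp add: coeff_sum_singleton keys_restrict_mons in_keys_iff)
    qed
    then show ?thesis
      using minor_ideal_restrict[OF h] hp by (simp add: I var_ideal_iff)
  qed (use minor_ideal_restrict[OF h] in simp)
  moreover have "?g \<in> var_ideal N (vertex_vars U)"
    using hp by (auto simp: var_ideal_iff keys_restrict_mons)
  ultimately show "h \<in> ideal_sum I (var_ideal N (vertex_vars U))"
    using restrict_mons_split[of "\<lambda>t. keys t \<inter> vertex_vars U = {}" h] unfolding ideal_sum_def by force
qed

text \<open>A minor involves two vertices, hence one of \<open>U\<close> when \<open>U\<close>
  misses at most one. For star graphs this makes components of the decomposition redundant.\<close>

lemma minor_ideal_le_var_ideal: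
  assumes "{1..N} \<subseteq> insert k U"
  shows "minor_ideal N {} \<subseteq> (var_ideal N (vertex_vars U) :: 'k::field mpoly set)"
  unfolding minor_ideal_single_vertex[OF assms, symmetric] by (rule minor_ideal_mono) simp

section \<open>The binomial edge ideal of a complete bipartite graph\<close>

definition xy :: "nat \<Rightarrow> nat \<Rightarrow> var \<Rightarrow>\<^sub>0 nat" where
  "xy i j = single (VX i) 1 + single (VY j) 1"

definition edge_binomial :: "nat \<Rightarrow> nat \<Rightarrow> 'k::field mpoly" where
  "edge_binomial i j = single (xy i j) 1 - single (xy j i) 1"

lemma edge_binomial_eq:
  "var_poly (VX i) * var_poly (VY j) - var_poly (VX j) * var_poly (VY i) = edge_binomial i j"
  by (simp add: edge_binomial_def xy_def var_poly_def mult_single)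

lemma xy_eq_iff [simp]: "xy i j = xy i' j' \<longleftrightarrow> i = i' \<and> j = j'"
proof
  assume "xy i j = xy i' j'"
  then have "lookup (xy i j) (VX i) = lookup (xy i' j') (VX i)" "lookup (xy i j) (VY j) = lookup (xy i' j') (VY j)"
    by simp_all
  then show "i = i' \<and> j = j'"
    by (auto simp: xy_def lookup_add lookup_single when_def split: if_splits)
qed simp

lemma xy_mons: "i \<in> {1..N} \<Longrightarrow> j \<in> {1..N} \<Longrightarrow> xy i j \<in> mons N"
  by (simp add: xy_def vars_def)

lemma mon_deg_xy [simp]: "mon_deg (xy i j) = 2"
  by (simp add: xy_def)

lemma keys_xy: "keys (xy i j) = {VX i, VY j}"
  by (auto simp: xy_def keys_add_nat)

lemma edge_binomial_hom: "i \<in> {1..N} \<Longrightarrow> j \<in> {1..N} \<Longrightarrow> edge_binomial i j \<in> hom_polys N 2"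
  by (simp add: edge_binomial_def hom_polys_single xy_mons)

lemma lookup_edge_binomial: "lookup (edge_binomial i j) t = (1 when xy i j = t) - (1 when xy j i = t)"
  by (simp add: edge_binomial_def lookup_minus lookup_single)

locale complete_bipartite =
  fixes N :: nat and A B :: "nat set"
  assumes partition: "A \<union> B = {1..N}" and disjoint: "A \<inter> B = {}"
begin

text \<open>Binomials are oriented from \<open>A\<close> to \<open>B\<close> and coefficients are
  indexed by edges, so that in degree two they can be read off at the monomials x_a y_b.\<close>

definition edge_ideal :: "'k::field mpoly set" where
  "edge_ideal = {\<Sum>(a, b)\<in>A \<times> B. c a b * edge_binomial a b | c. \<forall>a\<in>A. \<forall>b\<in>B. c a b \<in> polys N}"

lemma finite_parts [simp]: "finite A" "finite B"
  using partition finite_subset[of _ "{1..N}"] by auto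

lemma edge_idealE:
  assumes "f \<in> edge_ideal"
  obtains c where "f = (\<Sum>(a, b)\<in>A \<times> B. c a b * edge_binomial a b)" "\<And>a b. a \<in> A \<Longrightarrow> b \<in> B \<Longrightarrow> c a b \<in> polys N"
  using assms unfolding edge_ideal_def by blast

lemma edge_ideal_add: "f \<in> edge_ideal \<Longrightarrow> g \<in> edge_ideal \<Longrightarrow> f + g \<in> edge_ideal"
proof -
  assume "f \<in> edge_ideal" "g \<in> edge_ideal"
  obtain c where c: "f = (\<Sum>(a, b)\<in>A \<times> B. c a b * edge_binomial a b)" "\<And>a b. a \<in> A \<Longrightarrow> b \<in> B \<Longrightarrow> c a b \<in> polys N"
    using \<open>f \<in> edge_ideal\<close> by (rule edge_idealE) blast
  obtain d where d: "g = (\<Sum>(a, b)\<in>A \<times> B. d a b * edge_binomial a b)" "\<And>a b. a \<in> A \<Longrightarrow> b \<in> B \<Longrightarrow> d a b \<in> polys N"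
    using \<open>g \<in> edge_ideal\<close> by (rule edge_idealE) blast
  have "f + g = (\<Sum>(a, b)\<in>A \<times> B. (c a b + d a b) * edge_binomial a b)"
    by (simp add: c(1) d(1) split_def distrib_right sum.distrib)
  then show ?thesis
    unfolding edge_ideal_def using c(2) d(2) by (auto intro!: exI[of _ "\<lambda>a b. c a b + d a b"])
qed

lemma edge_ideal_mult:
  assumes "f \<in> edge_ideal" "p \<in> polys N"
  shows "p * f \<in> edge_ideal"
proof -
  obtain c where c: "f = (\<Sum>(a, b)\<in>A \<times> B. c a b * edge_binomial a b)" "\<And>a b. a \<in> A \<Longrightarrow> b \<in> B \<Longrightarrow> c a b \<in> polys N"
    using assms(1) by (rule edge_idealE) blast
  have "p * f = (\<Sum>(a, b)\<in>A \<times> B. (p * c a b) * edge_binomial a b)"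
    by (simp add: c(1) split_def sum_distrib_left mult.assoc)
  then show ?thesis
    unfolding edge_ideal_def using c(2) assms(2) by (auto intro!: exI[of _ "\<lambda>a b. p * c a b"])
qed

lemma edge_ideal_uminus: "f \<in> edge_ideal \<Longrightarrow> - f \<in> edge_ideal"
  using edge_ideal_mult[of f "- 1"] by simp

lemma edge_ideal_zero: "0 \<in> edge_ideal"
  unfolding edge_ideal_def by (auto intro!: exI[of _ "\<lambda>a b. 0"])

lemma edge_binomial_mem:
  assumes "a \<in> A" "b \<in> B"
  shows "edge_binomial a b \<in> (edge_ideal :: 'k::field mpoly set)"
proof -
  have "(\<Sum>(a', b')\<in>A \<times> B. (if (a', b') = (a, b) then 1 else 0) * edge_binomial a' b')
      = (\<Sum>e\<in>A \<times> B. if e = (a, b) then edge_binomial a b else (0 :: 'k mpoly))"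
    by (intro sum.cong) (auto split: if_splits)
  also have "\<dots> = edge_binomial a b"
    using assms by simp
  finally show ?thesis
    unfolding edge_ideal_def
    by (auto intro!: exI[of _ "\<lambda>a' b'. if (a', b') = (a, b) then 1 else 0"])
qed

lemma edge_binomial_hom': "a \<in> A \<Longrightarrow> b \<in> B \<Longrightarrow> edge_binomial a b \<in> hom_polys N 2"
  using partition by (intro edge_binomial_hom) auto

lemma edge_ideal_hom_comp:
  assumes "f \<in> edge_ideal"
  obtains c where "hom_comp d f = (\<Sum>(a, b)\<in>A \<times> B. c a b * edge_binomial a b)"
    "\<And>a b. a \<in> A \<Longrightarrow> b \<in> B \<Longrightarrow> c a b \<in> hom_polys N (d - 2)"
proof -
  obtain c where c: "f = (\<Sum>(a, b)\<in>A \<times> B. c a b * edge_binomial a b)" "\<And>a b. a \<in> A \<Longrightarrow> b \<in> B \<Longrightarrow> c a b \<in> polys N"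
    using assms(1) by (rule edge_idealE) blast
  have "hom_comp d (c a b * edge_binomial a b) = hom_comp (d - 2) (c a b) * edge_binomial a b"
    if "a \<in> A" "b \<in> B" for a b
    using hom_comp_mult[OF edge_binomial_hom'[OF that], of d "c a b"] by (simp add: mult.commute)
  then have "hom_comp d f = (\<Sum>(a, b)\<in>A \<times> B. hom_comp (d - 2) (c a b) * edge_binomial a b)"
    unfolding c(1) hom_comp_sum by (intro sum.cong) auto
  then show ?thesis
    using that[of "\<lambda>a b. hom_comp (d - 2) (c a b)"] c(2) by simp
qed

lemma edge_ideal_hom:
  assumes "f \<in> edge_ideal" "f \<in> hom_polys N d"
  obtains c where "f = (\<Sum>(a, b)\<in>A \<times> B. c a b * edge_binomial a b)"
    "\<And>a b. a \<in> A \<Longrightarrow> b \<in> B \<Longrightarrow> c a b \<in> hom_polys N (d - 2)"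
proof -
  obtain c where "hom_comp d f = (\<Sum>(a, b)\<in>A \<times> B. c a b * edge_binomial a b)"
      "\<And>a b. a \<in> A \<Longrightarrow> b \<in> B \<Longrightarrow> c a b \<in> hom_polys N (d - 2)"
    using assms(1) by (rule edge_ideal_hom_comp) blast
  then show ?thesis
    using that[of c] by (simp add: hom_comp_id[OF assms(2)])
qed

lemma edge_ideal_polys: "edge_ideal \<subseteq> polys N"
proof
  fix f :: "'k::field mpoly" assume "f \<in> edge_ideal"
  then obtain c where c: "f = (\<Sum>(a, b)\<in>A \<times> B. c a b * edge_binomial a b)" "\<And>a b. a \<in> A \<Longrightarrow> b \<in> B \<Longrightarrow> c a b \<in> polys N"
    by (rule edge_idealE) blast
  show "f \<in> polys N"
    unfolding c(1) using c(2) edge_binomial_hom'[THEN hom_polysD] by (auto intro!: polys_sum polys_mult)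
qed

lemma hideal_edge_ideal: "hideal N (edge_ideal :: 'k::field mpoly set)"
proof -
  have "hom_comp d f \<in> edge_ideal" if f: "f \<in> edge_ideal" for d and f :: "'k mpoly"
  proof -
    obtain c where "hom_comp d f = (\<Sum>(a, b)\<in>A \<times> B. c a b * edge_binomial a b)"
      "\<And>a b. a \<in> A \<Longrightarrow> b \<in> B \<Longrightarrow> c a b \<in> hom_polys N (d - 2)"
      using f by (rule edge_ideal_hom_comp) blast
    then show ?thesis
      unfolding edge_ideal_def using hom_polysD by blast
  qed
  then show ?thesis
    unfolding hideal_def
    by (intro conjI ballI allI edge_ideal_polys edge_ideal_zero edge_ideal_add edge_ideal_mult)
qed

subsection \<open>Its primary decomposition\<close>

lemma edge_binomial_minor_ideal:
  assumes "a \<in> {1..N}" "b \<in> {1..N}"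
  shows "edge_binomial a b \<in> (minor_ideal N {} :: 'k::field mpoly set)"
proof -
  have "minor_label {} (xy a b) = minor_label {} (xy b a)"
    by (simp add: minor_label_def xy_def fun_eq_iff)
  then have "coeff_sum {t. minor_label {} t = Some l} (edge_binomial a b :: 'k mpoly) = 0" for l
    by (simp add: edge_binomial_def)
  then show ?thesis
    using hom_polysD[OF edge_binomial_hom[OF assms]] by (simp add: label_ideal_def del: split_paired_All)
qed

lemma edge_binomial_var_ideal:
  assumes "a \<in> {1..N}" "b \<in> {1..N}" "a \<in> U \<or> b \<in> U"
  shows "edge_binomial a b \<in> (var_ideal N (vertex_vars U) :: 'k::field mpoly set)"
proof -
  have "keys (edge_binomial a b :: 'k mpoly) \<subseteq> {xy a b, xy b a}"
    by (auto simp: in_keys_iff lookup_edge_binomial when_def split: if_splits)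
  then show ?thesis
    using hom_polysD[OF edge_binomial_hom[OF assms(1,2)]] assms(3)
    by (auto simp: var_ideal_iff keys_xy vertex_vars_def)
qed

lemma edge_ideal_subset:
  assumes "hideal N I" "\<And>a b. a \<in> A \<Longrightarrow> b \<in> B \<Longrightarrow> edge_binomial a b \<in> I"
  shows "edge_ideal \<subseteq> (I :: 'k::field mpoly set)"
proof
  fix f :: "'k mpoly" assume "f \<in> edge_ideal"
  then obtain c where c: "f = (\<Sum>(a, b)\<in>A \<times> B. c a b * edge_binomial a b)" "\<And>a b. a \<in> A \<Longrightarrow> b \<in> B \<Longrightarrow> c a b \<in> polys N"
    by (rule edge_idealE) blast
  show "f \<in> I"
    unfolding c(1) using c(2) assms(2) by (auto intro!: hideal_sum[OF assms(1)] hideal_mult[OF assms(1)])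
qed

text \<open>The congruence on monomials modulo the edge ideal. The type argument fixes the
  coefficient field, which the monomials do not determine.\<close>

definition linked :: "'k::field itself \<Rightarrow> (var \<Rightarrow>\<^sub>0 nat) \<Rightarrow> (var \<Rightarrow>\<^sub>0 nat) \<Rightarrow> bool" where
  "linked _ s t \<longleftrightarrow> (single s 1 - single t 1 :: 'k mpoly) \<in> edge_ideal"

lemma linked_refl: "linked K t t"
  by (simp add: linked_def edge_ideal_zero)

lemma linked_sym: "linked K s t \<Longrightarrow> linked K t s"
  unfolding linked_def by (drule edge_ideal_uminus) simp

lemma linked_trans [trans]: "linked K r s \<Longrightarrow> linked K s t \<Longrightarrow> linked K r t"
  unfolding linked_def by (drule (1) edge_ideal_add) simp

lemma linked_edge:
  assumes "r \<in> mons N" "i \<in> A \<and> j \<in> B \<or> i \<in> B \<and> j \<in> A"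
  shows "linked K (xy i j + r) (xy j i + r)"
proof -
  have *: "linked K (xy a b + r) (xy b a + r)" if "a \<in> A" "b \<in> B" for a b
  proof -
    have "single r 1 * edge_binomial a b = (single (xy a b + r) 1 - single (xy b a + r) 1 :: 'k::field mpoly)"
      by (simp add: edge_binomial_def right_diff_distrib mult_single add.commute)
    then show ?thesis
      unfolding linked_def using edge_ideal_mult[OF edge_binomial_mem[OF that] polys_single[OF assms(1)]] by metis
  qed
  then show ?thesis
    using assms(2) linked_sym by blast
qed

text \<open>If \<open>i\<close> and \<open>j\<close> lie in the same part, the exchange goes through a vertex of the other part.\<close>

lemma linked_exchange:
  assumes "i \<in> A \<and> j \<in> A \<and> b \<in> B \<or> i \<in> B \<and> j \<in> B \<and> b \<in> A"
    and r: "r \<in> mons N" "vertex_deg r b \<noteq> 0"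
  shows "linked K (xy i j + r) (xy j i + r)"
proof -
  have ij: "i \<in> {1..N}" "j \<in> {1..N}"
    using assms(1) partition by auto
  note edge = linked_edge[where K = K]
  consider "VX b \<in> keys r" | "VY b \<in> keys r"
    using r(2) by (auto simp: vertex_deg_eq_0_iff)
  then show ?thesis
  proof cases
    case 1
    then obtain q where q: "r = single (VX b) 1 + q"
      by (rule keys_decompose)
    then have "single (VX i) 1 + q \<in> mons N" "single (VX j) 1 + q \<in> mons N"
      using r(1) ij by (simp_all add: vars_def)
    \<comment> \<open>Two exchanges along edges at \<open>b\<close>: x_b y_j x_i becomes x_j y_b
      x_i, and then x_i y_b x_j becomes x_b y_i x_j.\<close>
    then have "linked K (xy b j + (single (VX i) 1 + q)) (xy j b + (single (VX i) 1 + q))"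
      "linked K (xy i b + (single (VX j) 1 + q)) (xy b i + (single (VX j) 1 + q))"
      using assms(1) by (auto intro!: edge)
    moreover have "xy b j + (single (VX i) 1 + q) = xy i j + r"
      "xy j b + (single (VX i) 1 + q) = xy i b + (single (VX j) 1 + q)"
      "xy b i + (single (VX j) 1 + q) = xy j i + r"
      by (simp_all add: xy_def q ac_simps)
    ultimately show ?thesis
      using linked_trans by metis
  next
    case 2
    then obtain q where q: "r = single (VY b) 1 + q"
      by (rule keys_decompose)
    then have "single (VY i) 1 + q \<in> mons N" "single (VY j) 1 + q \<in> mons N"
      using r(1) ij by (simp_all add: vars_def)
    then have "linked K (xy i b + (single (VY j) 1 + q)) (xy b i + (single (VY j) 1 + q))"
      "linked K (xy b j + (single (VY i) 1 + q)) (xy j b + (single (VY i) 1 + q))"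
      using assms(1) by (auto intro!: edge)
    moreover have "xy i b + (single (VY j) 1 + q) = xy i j + r"
      "xy b i + (single (VY j) 1 + q) = xy b j + (single (VY i) 1 + q)"
      "xy j b + (single (VY i) 1 + q) = xy j i + r"
      by (simp_all add: xy_def q ac_simps)
    ultimately show ?thesis
      using linked_trans by metis
  qed
qed

text \<open>If some x_i is in excess in t compared with t', equal x-degrees give an x_j in deficit,
  and equal vertex degrees then force y_j to occur in t. Replacing x_i y_j by x_j y_i brings t
  closer to t'; as both parts are met by t, this is a link even when i and j lie in the same
  part.\<close>

lemma linked_if_same_label:
  assumes "t \<in> mons N" "t' \<in> mons N" "vertex_deg t = vertex_deg t'" "x_deg t = x_deg t'"
    and "\<exists>a\<in>A. vertex_deg t a \<noteq> 0" "\<exists>b\<in>B. vertex_deg t b \<noteq> 0"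
  shows "linked K t t'"
  using assms
\<comment> \<open>The measure is the total excess of x-exponents over those of \<open>t'\<close>;
  the truncated subtraction ignores the deficits.\<close>
proof (induction "\<Sum>i\<in>{1..N}. lookup t (VX i) - lookup t' (VX i)" arbitrary: t rule: less_induct)
  case less
  have xdeg: "x_deg s = (\<Sum>i\<in>{1..N}. lookup s (VX i))" if "s \<in> mons N" for s
    using that by (intro x_deg_eq_sum) (auto simp: mons_def vars_def)
  have sums: "(\<Sum>i\<in>{1..N}. lookup t (VX i)) = (\<Sum>i\<in>{1..N}. lookup t' (VX i))"
    using less.prems(4) by (simp only: xdeg[OF less.prems(1)] xdeg[OF less.prems(2)])
  have vd: "lookup t (VX i) + lookup t (VY i) = lookup t' (VX i) + lookup t' (VY i)" for i
    using fun_cong[OF less.prems(3), of i] by (simp only: vertex_deg_def)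
  have outside: "lookup s v = 0" if "s \<in> mons N" "v \<notin> vars N" for s v
    using that by (auto simp: mons_def in_keys_iff)
  show ?case
  proof (cases "\<forall>i\<in>{1..N}. lookup t (VX i) \<le> lookup t' (VX i)")
    case True
    then have X: "lookup t (VX i) = lookup t' (VX i)" if "i \<in> {1..N}" for i
      using sum_mono_inv[OF sums _ that] by blast
    have "lookup t v = lookup t' v" for v
    proof (cases "v \<in> vars N")
      case True
      then obtain i where "i \<in> {1..N}" "v = VX i \<or> v = VY i"
        unfolding vars_def by blast
      then show ?thesis
        using X[of i] vd[of i] by (elim disjE) simp_all
    next
      case False
      then show ?thesis
        using outside less.prems(1,2) by simp
    qed
    then have "t = t'"
      by (rule poly_mapping_eqI)
    then show ?thesis
      by (simp add: linked_refl)
  next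
    case False
    then obtain i where i: "i \<in> {1..N}" "lookup t (VX i) > lookup t' (VX i)"
      by (auto simp: not_le)
    have "\<exists>j\<in>{1..N}. lookup t (VX j) < lookup t' (VX j)"
    proof (rule ccontr)
      assume "\<not> ?thesis"
      then have "\<forall>j\<in>{1..N}. lookup t' (VX j) \<le> lookup t (VX j)"
        by (simp add: not_less)
      then have "(\<Sum>i\<in>{1..N}. lookup t' (VX i)) < (\<Sum>i\<in>{1..N}. lookup t (VX i))"
        using i by (intro sum_strict_mono_ex1) auto
      then show False
        using sums by simp
    qed
    then obtain j where j: "j \<in> {1..N}" "lookup t (VX j) < lookup t' (VX j)"
      by blast
    have "i \<noteq> j"
      using i(2) j(2) by auto
    have "VX i \<in> keys t"
      using i(2) by (simp add: in_keys_iff)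
    then obtain q where q: "t = single (VX i) 1 + q"
      by (rule keys_decompose)
    have "lookup t (VY j) \<noteq> 0"
      using j(2) vd[of j] by linarith
    then have "VY j \<in> keys q"
      by (simp add: in_keys_iff q lookup_add lookup_single)
    then obtain r where "q = single (VY j) 1 + r"
      by (rule keys_decompose)
    then have t: "t = xy i j + r"
      by (simp add: q xy_def add.assoc)
    define s where "s = xy j i + r"
    have r: "r \<in> mons N"
      using less.prems(1) by (simp add: t)
    have "linked K t s"
    proof (cases "i \<in> A \<and> j \<in> B \<or> i \<in> B \<and> j \<in> A")
      case True
      then show ?thesis
        unfolding t s_def by (intro linked_edge r)
    next
      case False
      have AB: "i \<in> A \<or> i \<in> B" "j \<in> A \<or> j \<in> B"
        using i(1) j(1) partition by blast+
      obtain a b where ab: "a \<in> A" "vertex_deg t a \<noteq> 0" "b \<in> B" "vertex_deg t b \<noteq> 0"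
        using less.prems(5,6) by blast
      have vr: "vertex_deg t k = vertex_deg r k" if "k \<noteq> i" "k \<noteq> j" for k
        using that by (simp add: t xy_def)
      from AB False consider "i \<in> A" "j \<in> A" | "i \<in> B" "j \<in> B"
        by blast
      then show ?thesis
      proof cases
        case 1
        then have "b \<noteq> i" "b \<noteq> j"
          using ab(3) disjoint by blast+
        then show ?thesis
          unfolding t s_def using 1 ab vr[of b] by (intro linked_exchange[of i j b] r) simp_all
      next
        case 2
        then have "a \<noteq> i" "a \<noteq> j"
          using ab(1) disjoint by blast+
        then show ?thesis
          unfolding t s_def using 2 ab vr[of a] by (intro linked_exchange[of i j a] r) simp_all
      qed
    qed
    also have "linked K s t'"
    proof (rule less.hyps)
      have s_i: "lookup t (VX k) = lookup s (VX k) + (if k = i then 1 else 0) - (if k = j then 1 else 0)" for k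
        using \<open>i \<noteq> j\<close> by (simp add: t s_def xy_def lookup_add lookup_single when_def)
      show "(\<Sum>k\<in>{1..N}. lookup s (VX k) - lookup t' (VX k)) < (\<Sum>k\<in>{1..N}. lookup t (VX k) - lookup t' (VX k))"
      proof (rule sum_strict_mono_ex1)
        have "lookup s (VX k) - lookup t' (VX k) \<le> lookup t (VX k) - lookup t' (VX k)" for k
          using j(2) by (cases "k = j") (simp_all add: t s_def xy_def lookup_add lookup_single when_def)
        then show "\<forall>k\<in>{1..N}. lookup s (VX k) - lookup t' (VX k) \<le> lookup t (VX k) - lookup t' (VX k)"
          by blast
        have "lookup s (VX i) - lookup t' (VX i) < lookup t (VX i) - lookup t' (VX i)"
          using i(2) \<open>i \<noteq> j\<close> by (simp add: t s_def xy_def lookup_add lookup_single when_def)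
        then show "\<exists>k\<in>{1..N}. lookup s (VX k) - lookup t' (VX k) < lookup t (VX k) - lookup t' (VX k)"
          using i(1) by blast
      qed simp
      show "s \<in> mons N"
        using i(1) j(1) r by (simp add: s_def xy_mons)
      have vs: "vertex_deg s = vertex_deg t"
        by (simp add: t s_def xy_def fun_eq_iff)
      have "x_deg s = x_deg t"
        by (simp add: t s_def xy_def)
      then show "vertex_deg s = vertex_deg t'" "x_deg s = x_deg t'" "\<exists>a\<in>A. vertex_deg s a \<noteq> 0" "\<exists>b\<in>B. vertex_deg s b \<noteq> 0"
        unfolding vs using less.prems by simp_all
    qed (fact less.prems)
    finally show ?thesis .
  qed
qed

text \<open>For the inclusion from right to left the number of monomials of f is reduced: the two
  ideals of variables make each monomial t meet both parts, and its vanishing class sum provides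
  another monomial s of f in the same class. Subtracting a multiple of t - s removes t and adds
  nothing new.\<close>

lemma edge_ideal_eq:
  "edge_ideal = minor_ideal N {} \<inter> var_ideal N (vertex_vars A) \<inter> (var_ideal N (vertex_vars B) :: 'k::field mpoly set)"
    (is "_ = ?I")
proof (intro equalityI subsetI)
  have AB: "a \<in> {1..N}" if "a \<in> A \<or> a \<in> B" for a
    using that partition by blast
  have sub: "edge_ideal \<subseteq> ?I"
    using edge_ideal_subset[OF hideal_minor_ideal edge_binomial_minor_ideal]
      edge_ideal_subset[OF hideal_var_ideal edge_binomial_var_ideal] AB by blast
  then show "f \<in> ?I" if "f \<in> edge_ideal" for f
    using that by blast
  fix f assume "f \<in> ?I"
  then show "f \<in> edge_ideal"
  proof (induction "card (keys f)" arbitrary: f rule: less_induct)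
    case less
    have I: "f \<in> minor_ideal N {}" "f \<in> var_ideal N (vertex_vars A)" "f \<in> var_ideal N (vertex_vars B)"
      using less.prems by blast+
    show ?case
    proof (cases "f = 0")
      case True
      then show ?thesis
        by (simp add: edge_ideal_zero)
    next
      case False
      then obtain t where t: "t \<in> keys f"
        by (metis ex_in_conv keys_eq_empty)
      let ?C = "{s. minor_label {} s = Some (vertex_deg t, x_deg t)}"
      have "coeff_sum ?C f = 0"
        using I(1) by (simp add: label_ideal_def)
      moreover have "coeff_sum ?C f = lookup f t" if "\<And>s. s \<in> keys f \<Longrightarrow> s \<in> ?C \<Longrightarrow> s = t"
      proof -
        have "coeff_sum ?C f = coeff_sum {t} f"
          using that by (intro coeff_sum_cong) (auto simp: minor_label_def)
        then show ?thesis
          by (simp add: coeff_sum_singleton)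
      qed
      ultimately obtain s where s: "s \<in> keys f" "s \<in> ?C" "s \<noteq> t"
        using t by (metis in_keys_iff)
      then have lab: "vertex_deg t = vertex_deg s" "x_deg t = x_deg s"
        by (simp_all add: minor_label_def)
      have keys: "keys f \<subseteq> mons N"
        using I(1) by (simp add: label_ideal_def polys_iff)
      have "keys t \<inter> vertex_vars A \<noteq> {}" "keys t \<inter> vertex_vars B \<noteq> {}"
        using I(2,3) t by (simp_all add: var_ideal_iff)
      then have "\<exists>a\<in>A. vertex_deg t a \<noteq> 0" "\<exists>b\<in>B. vertex_deg t b \<noteq> 0"
        unfolding vertex_deg_avoid[symmetric] by simp_all
      then have "linked TYPE('k) t s"
        using lab keys t s(1) by (intro linked_if_same_label) blast+
      then have link: "single t 1 - single s 1 \<in> (edge_ideal :: 'k mpoly set)"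
        by (simp add: linked_def)
      let ?g = "const_poly (lookup f t) * (single t 1 - single s 1)"
      have g: "?g \<in> edge_ideal"
        using link by (intro edge_ideal_mult) simp_all
      have g_eq: "?g = single t (lookup f t) - single s (lookup f t)"
        by (simp add: const_poly_def right_diff_distrib mult_single)
      have "keys (f - ?g) \<subseteq> keys f - {t}"
        using s by (auto simp: g_eq in_keys_iff lookup_minus lookup_single when_def split: if_splits)
      then have "card (keys (f - ?g)) < card (keys f)"
        using t by (intro psubset_card_mono) auto
      moreover have "f - ?g \<in> ?I"
        using less.prems g sub hideal_diff[OF hideal_minor_ideal] hideal_diff[OF hideal_var_ideal] by blast
      ultimately have "f - ?g \<in> edge_ideal"
        by (rule less.hyps)
      then show ?thesis
        using edge_ideal_add[OF _ g, of "f - ?g"] by simp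
    qed
  qed
qed

end

text \<open>\<open>ideal_gen\<close> indexes coefficients by the generators themselves. Translating
  from edges therefore uses that different edges have different binomials.\<close>

lemma binomial_edge_ideal_complete_bipartite:
  "binomial_edge_ideal (m + n) (complete_bipartite_edges m n)
    = (complete_bipartite.edge_ideal (m + n) {1..n} {n+1..n+m} :: 'k::field mpoly set)"
proof -
  interpret complete_bipartite "m + n" "{1..n}" "{n+1..n+m}"
    by unfold_locales auto
  let ?E = "{1..n} \<times> {n+1..n+m}"
  let ?f = "\<lambda>(a, b). edge_binomial a b :: 'k mpoly"
  let ?G = "{var_poly (VX i) * var_poly (VY j) - var_poly (VX j) * var_poly (VY i) | i j.
      i \<in> {1..m+n} \<and> j \<in> {1..m+n} \<and> i < j \<and> {i, j} \<in> complete_bipartite_edges m n} :: 'k mpoly set"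
  have edge: "{i, j} \<in> complete_bipartite_edges m n \<longleftrightarrow> i \<in> {1..n} \<and> j \<in> {n+1..n+m}" if "i < j" for i j
    using that by (auto simp: complete_bipartite_edges_def doubleton_eq_iff)
  have G: "?G = ?f ` ?E"
  proof (intro equalityI subsetI)
    fix g :: "'k mpoly" assume "g \<in> ?G"
    then obtain i j where "g = edge_binomial i j" "i < j" "{i, j} \<in> complete_bipartite_edges m n"
      unfolding edge_binomial_eq by blast
    then show "g \<in> ?f ` ?E"
      using edge[of i j] by (intro image_eqI[of _ _ "(i, j)"]) auto
  next
    fix g :: "'k mpoly" assume "g \<in> ?f ` ?E"
    then obtain i j where ij: "g = edge_binomial i j" "i \<in> {1..n}" "j \<in> {n+1..n+m}"
      by auto
    then have "i < j" "i \<in> {1..m+n}" "j \<in> {1..m+n}"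
      by auto
    then show "g \<in> ?G"
      unfolding edge_binomial_eq using ij edge by blast
  qed
  have inj: "inj_on ?f ?E"
  proof (rule inj_onI)
    fix e e' assume e: "e \<in> ?E" "e' \<in> ?E" "?f e = ?f e'"
    obtain a b a' b' where [simp]: "e = (a, b)" "e' = (a', b')"
      by (cases e, cases e')
    have "edge_binomial a b = (edge_binomial a' b' :: 'k mpoly)"
      using e(3) by simp
    then have "lookup (edge_binomial a b :: 'k mpoly) (xy a b) = lookup (edge_binomial a' b') (xy a b)"
      by simp
    then show "e = e'"
      using e(1,2) by (auto simp: lookup_edge_binomial when_def split: if_splits)
  qed
  show ?thesis
  proof (intro equalityI subsetI)
    fix f :: "'k mpoly" assume "f \<in> binomial_edge_ideal (m + n) (complete_bipartite_edges m n)"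
    then obtain S c where S: "f = (\<Sum>g\<in>S. c g * g)" "finite S" "S \<subseteq> ?G" "\<forall>g\<in>S. c g \<in> polys (m + n)"
      unfolding binomial_edge_ideal_def ideal_gen_def by blast
    have "g \<in> edge_ideal" if "g \<in> S" for g
    proof -
      have "g \<in> ?f ` ?E"
        using S(3) that unfolding G by blast
      then obtain a b where "g = edge_binomial a b" "a \<in> {1..n}" "b \<in> {n+1..n+m}"
        by auto
      then show ?thesis
        using edge_binomial_mem by metis
    qed
    then show "f \<in> edge_ideal"
      unfolding S(1) using S(4) by (intro hideal_sum[OF hideal_edge_ideal] edge_ideal_mult) blast+
  next
    fix f :: "'k mpoly" assume "f \<in> edge_ideal"
    then obtain c where c: "f = (\<Sum>(a, b)\<in>?E. c a b * edge_binomial a b)"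
      "\<And>a b. a \<in> {1..n} \<Longrightarrow> b \<in> {n+1..n+m} \<Longrightarrow> c a b \<in> polys (m + n)"
      by (rule edge_idealE) blast
    define d where "d g = case_prod c (the_inv_into ?E ?f g)" for g
    have d: "d (?f e) = case_prod c e" if "e \<in> ?E" for e
      unfolding d_def using the_inv_into_f_f[OF inj that] by simp
    have "(\<Sum>g\<in>?f ` ?E. d g * g) = (\<Sum>e\<in>?E. d (?f e) * ?f e)"
      by (rule sum.reindex[OF inj, unfolded o_def])
    also have "\<dots> = f"
      unfolding c(1) using d by (intro sum.cong) auto
    finally have "f = (\<Sum>g\<in>?G. d g * g)"
      unfolding G by (rule sym)
    moreover have "d g \<in> polys (m + n)" if "g \<in> ?G" for g
    proof -
      obtain e where e: "e \<in> ?E" "g = ?f e"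
        using \<open>g \<in> ?G\<close> unfolding G by (elim imageE) blast
      have "case_prod c e \<in> polys (m + n)"
        using e(1) c(2) by (cases e) (simp only: mem_Sigma_iff prod.case)
      then show ?thesis
        unfolding e(2) d[OF e(1)] .
    qed
    moreover have "finite (?f ` ?E)"
      by simp
    then have "finite ?G"
      by (simp only: G)
    ultimately show "f \<in> binomial_edge_ideal (m + n) (complete_bipartite_edges m n)"
      unfolding binomial_edge_ideal_def ideal_gen_def by blast
  qed
qed

section \<open>The Koszul complex\<close>

text \<open>The mapping cone of multiplication by \<open>w\<close>: \<open>G\<^sub>i \<oplus> G\<^sub>i\<^sub>-\<^sub>1\<close> in homological degree \<open>i\<close>, with
  differential \<open>(a, c) \<mapsto> (\<partial>a + wc, -\<partial>c)\<close>; the basis of \<open>G\<^sub>i\<close> comes first.\<close>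

definition cone :: "var \<Rightarrow> 'k::field free_complex \<Rightarrow> 'k free_complex" where
  "cone w G = \<lparr>
     rk = (\<lambda>i. rk G i + (case i of 0 \<Rightarrow> 0 | Suc k \<Rightarrow> rk G k)),
     gdeg = (\<lambda>i b. int i),
     entry = (\<lambda>i a b.
       if a < rk G i then
         if b < rk G (Suc i) then entry G i a b else if b = rk G (Suc i) + a then var_poly w else 0
       else if b < rk G (Suc i) then 0
       else (case i of 0 \<Rightarrow> 0 | Suc k \<Rightarrow> - entry G k (a - rk G i) (b - rk G (Suc i)))),
     aug = (\<lambda>b. 1) \<rparr>"

fun koszul :: "var list \<Rightarrow> 'k::field free_complex" where
  "koszul [] = \<lparr>rk = (\<lambda>i. if i = 0 then 1 else 0), gdeg = (\<lambda>i b. int i), entry = (\<lambda>i a b. 0), aug = (\<lambda>b. 1)\<rparr>"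
| "koszul (w # ws) = cone w (koszul ws)"

definition join :: "nat \<Rightarrow> (nat \<Rightarrow> 'a) \<Rightarrow> (nat \<Rightarrow> 'a) \<Rightarrow> nat \<Rightarrow> 'a" where
  "join r a c = (\<lambda>b. if b < r then a b else c (b - r))"

lemma sum_lessThan_plus:
  "(\<Sum>b<r + s. f b) = (\<Sum>b<r. f b) + (\<Sum>b<s. f (r + b) :: 'a::comm_monoid_add)" for r s :: nat
  by (induction s) (simp_all add: add.assoc)

lemma rk_cone_0 [simp]: "rk (cone w G) 0 = rk G 0"
  by (simp add: cone_def)

lemma rk_cone_Suc [simp]: "rk (cone w G) (Suc i) = rk G (Suc i) + rk G i"
  by (simp add: cone_def)

lemma bdry_outside: "rk G i \<le> a \<Longrightarrow> bdry G i v a = 0"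
  by (simp add: bdry_def)

lemma bdry_cone:
  assumes "\<And>b. rk G i \<le> b \<Longrightarrow> c b = 0"
  shows "bdry (cone w G) i (join (rk G (Suc i)) a c)
    = join (rk G i) (bdry G i a + smult (var_poly w) c) (- diff G i c)"
proof
  fix \<alpha>
  let ?e = "entry (cone w G) i \<alpha>"
  have sum: "(\<Sum>b<rk (cone w G) (Suc i). ?e b * join (rk G (Suc i)) a c b)
      = (\<Sum>b<rk G (Suc i). ?e b * a b) + (\<Sum>b<rk G i. ?e (rk G (Suc i) + b) * c b)"
    by (simp add: sum_lessThan_plus join_def)
  have lhs: "bdry (cone w G) i (join (rk G (Suc i)) a c) \<alpha>
      = (\<Sum>b<rk G (Suc i). ?e b * a b) + (\<Sum>b<rk G i. ?e (rk G (Suc i) + b) * c b)" if "\<alpha> < rk (cone w G) i"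
    unfolding sum[symmetric] using that by (simp only: bdry_def if_True)
  consider "\<alpha> < rk G i" | k where "\<not> \<alpha> < rk G i" "i = Suc k" "\<alpha> < rk G i + rk G k" |
    "\<not> \<alpha> < rk (cone w G) i"
    by (cases i) force+
  then show "bdry (cone w G) i (join (rk G (Suc i)) a c) \<alpha>
    = join (rk G i) (bdry G i a + smult (var_poly w) c) (- diff G i c) \<alpha>"
  proof cases
    case 1
    then have "(\<Sum>b<rk G (Suc i). ?e b * a b) = bdry G i a \<alpha>"
      by (simp add: cone_def bdry_def)
    moreover have "(\<Sum>b<rk G i. ?e (rk G (Suc i) + b) * c b) = (\<Sum>b<rk G i. if b = \<alpha> then var_poly w * c b else 0)"
      using 1 by (intro sum.cong) (auto simp: cone_def)
    ultimately show ?thesis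
      using 1 lhs by (cases i) (simp_all add: join_def)
  next
    case (2 k)
    then have "(\<Sum>b<rk G (Suc i). ?e b * a b) = 0"
      by (intro sum.neutral) (simp add: cone_def)
    moreover have "(\<Sum>b<rk G i. ?e (rk G (Suc i) + b) * c b) = - bdry G k c (\<alpha> - rk G i)"
      using 2 by (simp add: cone_def bdry_def less_diff_conv2 flip: sum_negf)
    ultimately show ?thesis
      using 2 lhs by (simp add: join_def)
  next
    case 3
    then show ?thesis
      using assms by (cases i) (auto simp: bdry_def[of "cone w G"] join_def diff_def bdry_outside)
  qed
qed

lemma free_module_cone_Suc:
  "v \<in> free_module N (cone w G) (Suc i) \<longleftrightarrow>
    (\<exists>a\<in>free_module N G (Suc i). \<exists>c\<in>free_module N G i. v = join (rk G (Suc i)) a c)"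
proof
  assume v: "v \<in> free_module N (cone w G) (Suc i)"
  let ?r = "rk G (Suc i)"
  have "v = join ?r (\<lambda>b. if b < ?r then v b else 0) (\<lambda>b. v (?r + b))"
    by (simp add: join_def fun_eq_iff)
  moreover have "(\<lambda>b. if b < ?r then v b else 0) \<in> free_module N G (Suc i)" "(\<lambda>b. v (?r + b)) \<in> free_module N G i"
    using v by (simp_all add: free_module_def)
  ultimately show "\<exists>a\<in>free_module N G (Suc i). \<exists>c\<in>free_module N G i. v = join ?r a c"
    by blast
qed (auto simp: free_module_def join_def)

lemma bdry_cone_image:
  "v \<in> bdry (cone w G) i ` free_module N (cone w G) (Suc i) \<longleftrightarrow>
    (\<exists>a c. a \<in> free_module N G (Suc i) \<and> c \<in> free_module N G i \<and> v = bdry (cone w G) i (join (rk G (Suc i)) a c))"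
  unfolding image_iff Bex_def free_module_cone_Suc by blast

lemma free_module_cone_0: "free_module N (cone w G) 0 = free_module N G 0"
  by (simp add: free_module_def)

lemma free_module_add: "v \<in> free_module N F i \<Longrightarrow> w \<in> free_module N F i \<Longrightarrow> v + w \<in> free_module N F i"
  by (simp add: free_module_def)

lemma free_module_uminus: "v \<in> free_module N F i \<Longrightarrow> - v \<in> free_module N F i"
  by (simp add: free_module_def)

lemma free_module_smult: "p \<in> polys N \<Longrightarrow> v \<in> free_module N F i \<Longrightarrow> smult p v \<in> free_module N F i"
  by (simp add: free_module_def)

lemma join_eq_zeroD:
  assumes "join r a c = 0" "\<And>b. r \<le> b \<Longrightarrow> a b = 0"
  shows "a = 0" "c = (0 :: nat \<Rightarrow> 'a::zero)"
proof -
  show "a = 0"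
  proof
    fix b show "a b = 0 b"
      using fun_cong[OF assms(1), of b] assms(2) by (cases "b < r") (simp_all add: join_def)
  qed
  show "c = 0"
  proof
    fix b show "c b = 0 b"
      using fun_cong[OF assms(1), of "r + b"] by (simp add: join_def)
  qed
qed

lemma join_zero [simp]: "join r 0 (0 :: nat \<Rightarrow> 'a::zero) = 0"
  by (simp add: join_def fun_eq_iff)

text \<open>A linear resolution of S/(W). The partial Koszul complexes of the induction resolve
  these quotients and become resolutions of K only when \<open>W\<close> contains all
  variables.\<close>

definition koszul_exact :: "nat \<Rightarrow> var set \<Rightarrow> 'k::field free_complex \<Rightarrow> bool" where
  "koszul_exact N W G \<longleftrightarrow> rk G 0 = 1 \<and>
     (\<forall>i. \<forall>a<rk G i. \<forall>b<rk G (Suc i). entry G i a b \<in> hom_polys N 1) \<and>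
     bdry G 0 ` free_module N G (Suc 0) = {v \<in> free_module N G 0. v 0 \<in> var_ideal N W} \<and>
     (\<forall>i. bdry G (Suc i) ` free_module N G (Suc (Suc i)) = {v \<in> free_module N G (Suc i). bdry G i v = 0})"

text \<open>The variable w is regular modulo (W), so the cone of multiplication by w on a resolution
  of S/(W) resolves the cokernel S/(W, w).\<close>

lemma koszul_exact_cone:
  fixes G :: "'k::field free_complex"
  assumes G: "koszul_exact N W G" and w: "w \<in> vars N" "w \<notin> W"
  shows "koszul_exact N (insert w W) (cone w G)"
proof -
  let ?C = "cone w G" and ?x = "var_poly w :: 'k mpoly"
  have rk0: "rk G 0 = 1" and entry: "\<And>i a b. a < rk G i \<Longrightarrow> b < rk G (Suc i) \<Longrightarrow> entry G i a b \<in> hom_polys N 1"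
    and exact0: "bdry G 0 ` free_module N G (Suc 0) = {v \<in> free_module N G 0. v 0 \<in> var_ideal N W}"
    and exact: "\<And>i. bdry G (Suc i) ` free_module N G (Suc (Suc i)) = {v \<in> free_module N G (Suc i). bdry G i v = 0}"
    using G by (auto simp: koszul_exact_def)
  have x: "?x \<in> polys N"
    using w by simp
  have bdry_free: "bdry G i v \<in> free_module N G i" if "v \<in> free_module N G (Suc i)" for i v
    using that exact0 exact by (cases i) blast+
  have dd: "bdry G i (bdry G (Suc i) v) = 0" if "v \<in> free_module N G (Suc (Suc i))" for i v
    using that exact by blast
  have bdry_cone': "bdry ?C i (join (rk G (Suc i)) a c) = join (rk G i) (bdry G i a + smult ?x c) (- diff G i c)"
    if "c \<in> free_module N G i" for i a c
    using that by (intro bdry_cone) (rule free_module_outside)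
  have "entry ?C i a b \<in> hom_polys N 1" if "a < rk ?C i" "b < rk ?C (Suc i)" for i a b
  proof (cases i)
    case 0
    then show ?thesis
      using that entry[of a 0 b] w by (simp add: cone_def)
  next
    case (Suc k)
    then show ?thesis
      using that entry[of a i b] entry[of "a - rk G i" k "b - rk G (Suc i)"] w
      by (simp add: cone_def less_diff_conv2)
  qed
  moreover have "bdry ?C 0 ` free_module N ?C (Suc 0) = {v \<in> free_module N ?C 0. v 0 \<in> var_ideal N (insert w W)}"
  proof (intro equalityI subsetI)
    fix v assume "v \<in> bdry ?C 0 ` free_module N ?C (Suc 0)"
    then obtain a c where ac: "a \<in> free_module N G (Suc 0)" "c \<in> free_module N G 0"
        "v = bdry ?C 0 (join (rk G (Suc 0)) a c)"
      unfolding bdry_cone_image by blast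
    have c0: "c 0 \<in> polys N"
      using ac(2) rk0 by (simp add: free_module_def)
    have a: "bdry G 0 a \<in> free_module N G 0" "bdry G 0 a 0 \<in> var_ideal N W"
      using exact0 ac(1) by blast+
    have v: "v = join (rk G 0) (bdry G 0 a + smult ?x c) (- diff G 0 c)"
      using ac bdry_cone' by simp
    have "bdry G 0 a 0 + ?x * c 0 \<in> ideal_adjoin N (var_ideal N W) ?x"
      using a(2) c0 unfolding ideal_adjoin_def by blast
    then have "v 0 \<in> var_ideal N (insert w W)"
      by (simp add: v rk0 join_def var_ideal_adjoin w)
    moreover have "v \<in> free_module N ?C 0"
      using a(1) ac(2) x c0 by (auto simp: v free_module_def join_def rk0)
    ultimately show "v \<in> {v \<in> free_module N ?C 0. v 0 \<in> var_ideal N (insert w W)}"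
      by blast
  next
    fix v assume "v \<in> {v \<in> free_module N ?C 0. v 0 \<in> var_ideal N (insert w W)}"
    then have v: "v \<in> free_module N G 0" "v 0 \<in> ideal_adjoin N (var_ideal N W) ?x"
      by (simp_all add: free_module_cone_0 var_ideal_adjoin w)
    then obtain f g where fg: "f \<in> var_ideal N W" "g \<in> polys N" "v 0 = f + ?x * g"
      unfolding ideal_adjoin_def by blast
    have "f \<in> polys N"
      using fg(1) by (simp add: label_ideal_def)
    then have "(\<lambda>b. if b = 0 then f else 0) \<in> {v \<in> free_module N G 0. v 0 \<in> var_ideal N W}"
      using fg(1) rk0 by (simp add: free_module_def)
    then obtain a where a: "a \<in> free_module N G (Suc 0)" "bdry G 0 a = (\<lambda>b. if b = 0 then f else 0)"
      unfolding exact0[symmetric] by (elim imageE) metis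
    define c where "c = (\<lambda>b :: nat. if b = 0 then g else 0)"
    have c: "c \<in> free_module N G 0"
      using fg(2) rk0 by (simp add: c_def free_module_def)
    have "v = bdry ?C 0 (join (rk G (Suc 0)) a c)"
    proof
      fix b show "v b = bdry ?C 0 (join (rk G (Suc 0)) a c) b"
        unfolding bdry_cone'[OF c] a(2)
        using fg(3) v(1) rk0 by (cases "b = 0") (simp_all add: c_def join_def free_module_def)
    qed
    then show "v \<in> bdry ?C 0 ` free_module N ?C (Suc 0)"
      unfolding bdry_cone_image using a(1) c by blast
  qed
  moreover have "bdry ?C (Suc i) ` free_module N ?C (Suc (Suc i)) = {v \<in> free_module N ?C (Suc i). bdry ?C i v = 0}" for i
  proof (intro equalityI subsetI)
    fix v assume "v \<in> bdry ?C (Suc i) ` free_module N ?C (Suc (Suc i))"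
    then obtain a c where ac: "a \<in> free_module N G (Suc (Suc i))" "c \<in> free_module N G (Suc i)"
        "v = bdry ?C (Suc i) (join (rk G (Suc (Suc i))) a c)"
      unfolding bdry_cone_image by blast
    have v: "v = join (rk G (Suc i)) (bdry G (Suc i) a + smult ?x c) (- bdry G i c)"
      using ac bdry_cone' by simp
    have c: "- bdry G i c \<in> free_module N G i"
      using bdry_free[OF ac(2)] by (rule free_module_uminus)
    have "bdry G (Suc i) a + smult ?x c \<in> free_module N G (Suc i)"
      using bdry_free[OF ac(1)] ac(2) x by (intro free_module_add free_module_smult)
    then have "v \<in> free_module N ?C (Suc i)"
      unfolding free_module_cone_Suc v using c by blast
    moreover have "bdry G i (bdry G (Suc i) a + smult ?x c) + smult ?x (- bdry G i c) = 0"
      using dd[OF ac(1)] by (simp add: bdry_add bdry_smult fun_eq_iff)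
    moreover have "diff G i (- bdry G i c) = 0"
      using dd ac(2) by (cases i) (simp_all add: bdry_uminus)
    ultimately show "v \<in> {v \<in> free_module N ?C (Suc i). bdry ?C i v = 0}"
      by (simp add: v bdry_cone'[OF c])
  next
    fix v assume "v \<in> {v \<in> free_module N ?C (Suc i). bdry ?C i v = 0}"
    then obtain a c where ac: "a \<in> free_module N G (Suc i)" "c \<in> free_module N G i"
        "v = join (rk G (Suc i)) a c" "bdry ?C i v = 0"
      unfolding mem_Collect_eq free_module_cone_Suc by blast
    have zero: "join (rk G i) (bdry G i a + smult ?x c) (- diff G i c) = 0"
      using ac bdry_cone' by metis
    have out: "(bdry G i a + smult ?x c) b = 0" if "rk G i \<le> b" for b
      using bdry_free[OF ac(1)] ac(2) that by (simp add: free_module_outside)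
    have 1: "bdry G i a + smult ?x c = 0" "- diff G i c = 0"
      using join_eq_zeroD[OF zero out] by blast+
    \<comment> \<open>Regularity of w is used here, in degree 0: w c_0 lies in (W), hence so does
      c_0. In higher degrees exactness of \<open>G\<close> suffices.\<close>
    have "c \<in> bdry G i ` free_module N G (Suc i)"
    proof (cases i)
      case 0
      have "bdry G 0 a 0 \<in> var_ideal N W"
        using exact0 ac(1) 0 by blast
      moreover have "?x * c 0 = - bdry G 0 a 0"
        using fun_cong[OF 1(1), of 0] 0 by (simp add: eq_neg_iff_add_eq_0 add.commute)
      moreover have "c 0 \<in> polys N"
        using ac(2) rk0 0 by (simp add: free_module_def)
      ultimately have "c 0 \<in> ideal_colon N (var_ideal N W) ?x"
        using hideal_uminus[OF hideal_var_ideal] by (simp add: ideal_colon_def)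
      then have "c \<in> {v \<in> free_module N G 0. v 0 \<in> var_ideal N W}"
        using ac(2) 0 by (simp add: var_ideal_colon w)
      then show ?thesis
        unfolding 0 exact0 .
    next
      case (Suc k)
      have "bdry G k c = 0"
        using 1(2) Suc by simp
      then show ?thesis
        using ac(2) exact[of k] unfolding Suc by blast
    qed
    then obtain c' where c': "c' \<in> free_module N G (Suc i)" "c = bdry G i c'"
      by blast
    have "a + smult ?x c' \<in> free_module N G (Suc i)"
      using ac(1) c'(1) x by (intro free_module_add free_module_smult)
    moreover have "bdry G i (a + smult ?x c') = 0"
      using 1(1) by (simp add: bdry_add bdry_smult c'(2))
    ultimately obtain a' where a': "a' \<in> free_module N G (Suc (Suc i))" "a + smult ?x c' = bdry G (Suc i) a'"
      using exact[of i] by blast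
    \<comment> \<open>The sign compensates for the -d in the second component of the cone: (a', -c')
      is mapped to (d a' - w c', d c') = (a, c).\<close>
    have mc': "- c' \<in> free_module N G (Suc i)"
      using c'(1) by (rule free_module_uminus)
    have "bdry G (Suc i) a' + smult ?x (- c') = a"
      unfolding a'(2)[symmetric] by (simp add: fun_eq_iff)
    moreover have "- diff G (Suc i) (- c') = c"
      by (simp add: c'(2) bdry_uminus)
    ultimately have "v = bdry ?C (Suc i) (join (rk G (Suc (Suc i))) a' (- c'))"
      unfolding bdry_cone'[OF mc'] ac(3) by simp
    then show "v \<in> bdry ?C (Suc i) ` free_module N ?C (Suc (Suc i))"
      unfolding bdry_cone_image using a'(1) mc' by blast
  qed
  ultimately show ?thesis
    unfolding koszul_exact_def using rk0 by simp
qed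

lemma koszul_exact_koszul:
  "distinct ws \<Longrightarrow> set ws \<subseteq> vars N \<Longrightarrow> koszul_exact N (set ws) (koszul ws :: 'k::field free_complex)"
proof (induction ws)
  case Nil
  have [simp]: "bdry (koszul []) i v = 0" for i and v :: "nat \<Rightarrow> 'k mpoly"
    by (simp add: bdry_def fun_eq_iff)
  have "free_module N (koszul [] :: 'k free_complex) (Suc i) = {0}" for i
    by (auto simp: free_module_def fun_eq_iff)
  moreover have "0 \<in> free_module N (koszul [] :: 'k free_complex) 0"
    by (simp add: free_module_def)
  moreover have "v = 0" if "v \<in> free_module N (koszul [] :: 'k free_complex) 0" "v 0 = 0" for v
  proof
    fix b show "v b = 0 b"
      using that by (cases "b = 0") (auto simp: free_module_def)
  qed
  ultimately show ?case
    by (auto simp: koszul_exact_def var_ideal_empty simp del: koszul.simps) simp_all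
next
  case (Cons w ws)
  then show ?case
    using koszul_exact_cone[of N "set ws" "koszul ws" w] by simp
qed

lemma gdeg_koszul [simp]: "gdeg (koszul ws) i b = int i"
  by (cases ws) (simp_all add: cone_def)

lemma aug_koszul [simp]: "aug (koszul ws) b = 1"
  by (cases ws) (simp_all add: cone_def)

lemma var_ideal_vars: "f \<in> var_ideal N (vars N) \<longleftrightarrow> f \<in> polys N \<and> lookup f 0 = 0"
proof (cases "f \<in> polys N")
  case True
  have "keys t \<inter> vars N \<noteq> {} \<longleftrightarrow> t \<noteq> 0" if "t \<in> keys f" for t
  proof -
    have "keys t \<inter> vars N = keys t"
      using True that by (auto simp: polys_iff mons_def)
    then show ?thesis
      by simp
  qed
  then show ?thesis
    using True by (auto simp: var_ideal_iff in_keys_iff)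
qed (simp add: var_ideal_iff)

lemma resolution_koszul:
  assumes "distinct ws" "set ws = vars N"
  shows "resolution N (koszul ws :: 'k::field free_complex)"
proof
  let ?G = "koszul ws :: 'k free_complex"
  have G: "koszul_exact N (vars N) ?G"
    using koszul_exact_koszul[of ws N] assms by simp
  then have rk: "rk ?G 0 = 1"
    by (simp add: koszul_exact_def)
  then have aug: "augmentation ?G v = lookup (v 0) 0" for v
    by (simp add: augmentation_def)
  have "x \<in> augmentation ?G ` free_module N ?G 0" for x :: 'k
  proof (rule image_eqI)
    show "x = augmentation ?G (\<lambda>b. if b = 0 then const_poly x else 0)"
      by (simp add: aug const_poly_def)
    show "(\<lambda>b. if b = 0 then const_poly x else 0) \<in> free_module N ?G 0"
      by (simp add: free_module_def rk)
  qed
  then have "augmentation ?G ` free_module N ?G 0 = UNIV"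
    by blast
  moreover have "v 0 \<in> var_ideal N (vars N) \<longleftrightarrow> augmentation ?G v = 0" if "v \<in> free_module N ?G 0" for v
    using that rk by (simp add: var_ideal_vars aug free_module_def)
  then have "{v \<in> free_module N ?G 0. v 0 \<in> var_ideal N (vars N)} = {v \<in> free_module N ?G 0. augmentation ?G v = 0}"
    by blast
  ultimately show "graded_free_resolution N ?G"
    using G unfolding koszul_exact_def graded_free_resolution_def by simp
qed

text \<open>Each cone puts the old basis first, so the head of the list owns the last column; this
  explains the reversal.\<close>

lemma koszul_1:
  "rk (koszul ws :: 'k::field free_complex) 0 = 1 \<and> rk (koszul ws :: 'k free_complex) (Suc 0) = length ws \<and>
    (\<forall>j<length ws. entry (koszul ws) 0 0 j = (var_poly (rev ws ! j) :: 'k mpoly))"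
  by (induction ws) (auto simp: cone_def nth_append)

lemma bdry_koszul_0:
  "bdry (koszul ws) 0 z 0 = (\<Sum>j<length ws. var_poly (rev ws ! j) * (z j :: 'k::field mpoly))"
  using koszul_1[where 'k = 'k and ws = ws] by (simp add: bdry_def)

text \<open>If \<open>(a, c)\<close> is a cycle of the cone, then \<open>c\<close> is a cycle, and \<open>a\<close> is one once \<open>c = 0\<close>; so
  induction along the cones reduces the claim to homological degree one.\<close>

lemma koszul_no_cycles:
  fixes Q :: "'k::field mpoly set"
  assumes syz: "\<And>(l :: var list) h. distinct l \<Longrightarrow> set l \<subseteq> vars N \<Longrightarrow> (\<And>j. j < length l \<Longrightarrow> h j \<in> Q) \<Longrightarrow>
      (\<Sum>j<length l. var_poly (l ! j) * h j) = 0 \<Longrightarrow> (\<forall>j<length l. h j = 0)"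
  shows "distinct ws \<Longrightarrow> set ws \<subseteq> vars N \<Longrightarrow> z \<in> free_module N (koszul ws) (Suc k) \<Longrightarrow>
    (\<And>b. b < rk (koszul ws :: 'k free_complex) (Suc k) \<Longrightarrow> z b \<in> Q) \<Longrightarrow> bdry (koszul ws) k z = 0 \<Longrightarrow> z = 0"
proof (induction ws arbitrary: z k)
  case Nil
  then show ?case
    by (simp add: free_module_def fun_eq_iff)
next
  case (Cons w ws)
  let ?G = "koszul ws :: 'k free_complex"
  have ws: "distinct ws" "set ws \<subseteq> vars N"
    using Cons.prems(1,2) by simp_all
  show ?case
  proof (cases k)
    case 0
    let ?ws = "w # ws"
    have rk: "rk (koszul ?ws :: 'k free_complex) (Suc 0) = length ?ws"
      using koszul_1 by blast
    have "(\<Sum>j<length (rev ?ws). var_poly (rev ?ws ! j) * z j) = 0"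
      using fun_cong[OF Cons.prems(5), of 0] bdry_koszul_0[of ?ws z] 0 by (simp del: koszul.simps)
    moreover have "distinct (rev ?ws)" "set (rev ?ws) \<subseteq> vars N"
      using Cons.prems(1,2) by simp_all
    moreover have "z j \<in> Q" if "j < length (rev ?ws)" for j
      using Cons.prems(4) that 0 rk by (simp del: koszul.simps)
    ultimately have "\<forall>j<length (rev ?ws). z j = 0"
      using syz[of "rev ?ws" z] by blast
    moreover have "z j = 0" if "length ?ws \<le> j" for j
      using Cons.prems(3) that 0 rk by (auto simp: free_module_def simp del: koszul.simps)
    ultimately show ?thesis
      by (auto simp: fun_eq_iff) (metis length_Cons less_Suc_eq_le not_less)
  next
    case (Suc i)
    obtain a c where ac: "a \<in> free_module N ?G (Suc k)" "c \<in> free_module N ?G k" "z = join (rk ?G (Suc k)) a c"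
      using Cons.prems(3) free_module_cone_Suc[of z N w ?G k] by auto
    \<comment> \<open>The coordinates of \<open>a\<close> and \<open>c\<close> are coordinates of
      \<open>z\<close>, so membership in \<open>Q\<close> passes to both.\<close>
    have aQ: "a b \<in> Q" if "b < rk ?G (Suc k)" for b
      using Cons.prems(4)[of b] that by (simp add: ac(3) join_def)
    have cQ: "c b \<in> Q" if "b < rk ?G k" for b
      using Cons.prems(4)[of "rk ?G (Suc k) + b"] that by (simp add: ac(3) join_def)
    have eq: "bdry (cone w ?G) k (join (rk ?G (Suc k)) a c)
        = join (rk ?G k) (bdry ?G k a + smult (var_poly w) c) (- diff ?G k c)"
      using ac(2) by (intro bdry_cone) (rule free_module_outside)
    have zero: "join (rk ?G k) (bdry ?G k a + smult (var_poly w) c) (- diff ?G k c) = 0"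
      unfolding eq[symmetric] using Cons.prems(5) unfolding koszul.simps ac(3) .
    have out: "(bdry ?G k a + smult (var_poly w) c) b = 0" if "rk ?G k \<le> b" for b
      using ac(2) that by (simp add: free_module_outside bdry_outside)
    have 1: "bdry ?G k a + smult (var_poly w) c = 0" "- diff ?G k c = 0"
      using join_eq_zeroD[OF zero out] by blast+
    have "bdry ?G i c = 0"
      using 1(2) by (simp add: Suc)
    then have "c = 0"
      using Cons.IH[OF ws ac(2)[unfolded Suc] cQ] Suc by blast
    moreover from this have "bdry ?G k a = 0"
      using 1(1) by (simp add: fun_eq_iff)
    then have "a = 0"
      using Cons.IH[OF ws ac(1) aQ] by blast
    ultimately show ?thesis
      by (simp add: ac(3))
  qed
qed

section \<open>The linear strand\<close>

lemma hom_polys_neg: "p \<in> hom_polys N d \<Longrightarrow> d < 0 \<Longrightarrow> p = 0"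
  by (rule poly_mapping_eqI) (use hom_polys_lookup[of p N d] in auto)

lemma hom_polys_0_const: "p \<in> hom_polys N 0 \<Longrightarrow> p = const_poly (lookup p 0)"
  by (rule poly_mapping_eqI) (auto simp: const_poly_def lookup_single when_def hom_polys_lookup)

text \<open>The monomial \<sigma>_j x_a y_b arises from no other term of the syzygy. In a second
  factorization \<sigma>_i u the variable \<sigma>_j would divide u; being neither an x of
  \<open>A\<close> nor a y of \<open>B\<close>, it forces u = x_b' y_a'. The other variable of u
  must then be x_a or y_b, which puts one vertex into both parts.\<close>

lemma no_linear_syzygy_aux:
  fixes h :: "'i \<Rightarrow> 'k::field mpoly"
  assumes "finite J" "inj_on \<sigma> J" "A \<inter> B = {}"
    and supp: "\<And>i u. i \<in> J \<Longrightarrow> u \<in> keys (h i) \<Longrightarrow> \<exists>a\<in>A. \<exists>b\<in>B. u = xy a b \<or> u = xy b a"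
    and syz: "(\<Sum>i\<in>J. var_poly (\<sigma> i) * h i) = 0"
    and j: "j \<in> J" "\<sigma> j \<notin> VX ` A \<union> VY ` B" and ab: "a \<in> A" "b \<in> B"
  shows "lookup (h j) (xy a b) = 0"
proof -
  let ?t = "single (\<sigma> j) 1 + xy a b"
  have "lookup (var_poly (\<sigma> i) * h i) ?t = 0" if i: "i \<in> J" "i \<noteq> j" for i
  proof (rule ccontr)
    assume *: "lookup (var_poly (\<sigma> i) * h i) ?t \<noteq> 0"
    then obtain u where u: "?t = single (\<sigma> i) 1 + u"
      unfolding var_poly_def using lookup_monomial_mult_eq_0 by blast
    then have "u \<in> keys (h i)"
      using * by (simp add: var_poly_def in_keys_iff)
    then obtain a' b' where u': "a' \<in> A" "b' \<in> B" "u = xy a' b' \<or> u = xy b' a'"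
      using supp[OF i(1)] by blast
    have "\<sigma> i \<noteq> \<sigma> j"
      using assms(2) i j(1) by (auto dest: inj_onD)
    have keys: "{\<sigma> j, VX a, VY b} = insert (\<sigma> i) (keys u)"
      using arg_cong[OF u, of keys] by (simp add: keys_add_nat keys_xy insert_commute)
    show False
    proof (cases "u = xy a' b'")
      case True
      then have S: "{\<sigma> j, VX a, VY b} = {\<sigma> i, VX a', VY b'}"
        using keys by (simp add: keys_xy)
      have "\<sigma> j \<in> {\<sigma> i, VX a', VY b'}"
        unfolding S[symmetric] by simp
      then show False
        using j(2) u'(1,2) \<open>\<sigma> i \<noteq> \<sigma> j\<close> by auto
    next
      case False
      then have S: "{\<sigma> j, VX a, VY b} = {\<sigma> i, VX b', VY a'}"
        using keys u'(3) by (simp add: keys_xy)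
      have "\<sigma> j \<in> {\<sigma> i, VX b', VY a'}"
        unfolding S[symmetric] by simp
      then consider "\<sigma> j = VX b'" | "\<sigma> j = VY a'"
        using \<open>\<sigma> i \<noteq> \<sigma> j\<close> by fastforce
      then have "b' = a \<or> a' = b"
      proof cases
        case 1
        have "VY a' \<in> {\<sigma> j, VX a, VY b}"
          unfolding S by simp
        then show ?thesis
          using 1 by simp
      next
        case 2
        have "VX b' \<in> {\<sigma> j, VX a, VY b}"
          unfolding S by simp
        then show ?thesis
          using 2 by simp
      qed
      then show False
        using assms(3) ab u'(1,2) by blast
    qed
  qed
  then have "(\<Sum>i\<in>J. lookup (var_poly (\<sigma> i) * h i) ?t) = lookup (var_poly (\<sigma> j) * h j) ?t"
    using assms(1) j(1) by (subst sum.remove[of J j]) simp_all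
  moreover have "(\<Sum>i\<in>J. lookup (var_poly (\<sigma> i) * h i) ?t) = 0"
    using arg_cong[OF syz, of "\<lambda>p. lookup p ?t"] by (simp add: lookup_sum)
  ultimately show ?thesis
    by (simp add: var_poly_def)
qed

context complete_bipartite
begin

lemma lookup_edge_binomial_sum:
  fixes \<gamma> :: "nat \<Rightarrow> nat \<Rightarrow> 'k::field"
  shows "lookup (\<Sum>(a, b)\<in>A \<times> B. const_poly (\<gamma> a b) * edge_binomial a b) u
    = (\<Sum>(a, b)\<in>A \<times> B. \<gamma> a b * ((1 when xy a b = u) - (1 when xy b a = u)))"
proof -
  have "lookup (const_poly x * g) u = x * lookup g u" for x and g :: "'k mpoly"
    using lookup_monomial_mult[of 0 x g u] by (simp add: const_poly_def)
  then show ?thesis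
    by (simp add: lookup_sum split_def lookup_edge_binomial)
qed

lemma lookup_edge_binomial_sum_xy:
  assumes "a \<in> A" "b \<in> B"
  shows "lookup (\<Sum>(a, b)\<in>A \<times> B. const_poly (\<gamma> a b) * edge_binomial a b) (xy a b) = \<gamma> a b"
proof -
  have "a' \<noteq> b'" if "a' \<in> A" "b' \<in> B" for a' b'
    using that disjoint by blast
  then have "lookup (\<Sum>(a, b)\<in>A \<times> B. const_poly (\<gamma> a b) * edge_binomial a b) (xy a b)
      = (\<Sum>e\<in>A \<times> B. if e = (a, b) then \<gamma> a b else 0)"
    unfolding lookup_edge_binomial_sum using assms
    by (intro sum.cong) (auto simp: when_def split: if_splits)
  then show ?thesis
    using assms by simp
qed

text \<open>In degree two the coefficients are constants, and since the parts are disjoint x_a y_b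
  occurs in just one generator, with x_b y_a as its partner of opposite sign.\<close>

lemma edge_ideal_hom_2:
  assumes "f \<in> edge_ideal" "f \<in> hom_polys N 2"
  shows "f = (\<Sum>(a, b)\<in>A \<times> B. const_poly (lookup f (xy a b)) * edge_binomial a b)"
    and "a \<in> A \<Longrightarrow> b \<in> B \<Longrightarrow> lookup f (xy b a) = - lookup f (xy a b)"
    and "u \<in> keys f \<Longrightarrow> \<exists>a\<in>A. \<exists>b\<in>B. u = xy a b \<or> u = xy b a"
proof -
  obtain c where c: "f = (\<Sum>(a, b)\<in>A \<times> B. c a b * edge_binomial a b)"
    "\<And>a b. a \<in> A \<Longrightarrow> b \<in> B \<Longrightarrow> c a b \<in> hom_polys N 0"
    using edge_ideal_hom[OF assms] by auto
  define \<gamma> where "\<gamma> a b = lookup (c a b) 0" for a b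
  have f: "f = (\<Sum>(a, b)\<in>A \<times> B. const_poly (\<gamma> a b) * edge_binomial a b)"
    unfolding c(1) \<gamma>_def using hom_polys_0_const[OF c(2)] by (intro sum.cong) auto
  have lookup: "lookup f u = (\<Sum>(a, b)\<in>A \<times> B. \<gamma> a b * ((1 when xy a b = u) - (1 when xy b a = u)))" for u
    by (subst f) (rule lookup_edge_binomial_sum)
  have AB: "a \<noteq> b" if "a \<in> A" "b \<in> B" for a b
    using that disjoint by blast
  have l1: "lookup f (xy a b) = \<gamma> a b" if "a \<in> A" "b \<in> B" for a b
    by (subst f) (rule lookup_edge_binomial_sum_xy[OF that])
  have l2: "lookup f (xy b a) = - \<gamma> a b" if "a \<in> A" "b \<in> B" for a b
  proof -
    have "lookup f (xy b a) = (\<Sum>e\<in>A \<times> B. if e = (a, b) then - \<gamma> a b else 0)"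
      unfolding lookup using AB that by (intro sum.cong) (auto simp: when_def split: if_splits)
    then show ?thesis
      using that by simp
  qed
  show "f = (\<Sum>(a, b)\<in>A \<times> B. const_poly (lookup f (xy a b)) * edge_binomial a b)"
    by (subst f) (intro sum.cong, auto simp: l1)
  show "lookup f (xy b a) = - lookup f (xy a b)" if "a \<in> A" "b \<in> B"
    using that by (simp add: l1 l2)
  show "\<exists>a\<in>A. \<exists>b\<in>B. u = xy a b \<or> u = xy b a" if "u \<in> keys f"
  proof (rule ccontr)
    assume "\<not> ?thesis"
    then have "lookup f u = 0"
      unfolding lookup by (intro sum.neutral) (auto simp: when_def)
    then show False
      using that by (simp add: in_keys_iff)
  qed
qed

text \<open>A variable that is an x of \<open>A\<close> or a y of \<open>B\<close> is neither an x
  of \<open>B\<close> nor a y of \<open>A\<close>. So the auxiliary lemma applies to the parts in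
  one order or the other, and antisymmetry of the coefficients carries the result back.\<close>

lemma no_linear_syzygy:
  fixes h :: "nat \<Rightarrow> 'k::field mpoly"
  assumes "distinct l" and Q: "\<And>j. j < length l \<Longrightarrow> h j \<in> edge_ideal \<inter> hom_polys N 2"
    and syz: "(\<Sum>j<length l. var_poly (l ! j) * h j) = 0"
  shows "\<forall>j<length l. h j = 0"
proof (intro allI impI)
  fix j assume j: "j < length l"
  have inj: "inj_on ((!) l) {..<length l}"
    using assms(1) by (simp add: inj_on_nth)
  have hQ: "h i \<in> edge_ideal" "h i \<in> hom_polys N 2" if "i \<in> {..<length l}" for i
    using Q that by auto
  have "lookup (h j) (xy a b) = 0" if ab: "a \<in> A" "b \<in> B" for a b
  proof (cases "l ! j \<in> VX ` A \<union> VY ` B")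
    case False
    then show ?thesis
      using no_linear_syzygy_aux[OF _ inj disjoint edge_ideal_hom_2(3)[OF hQ] syz _ False ab] j by simp
  next
    case True
    then have "l ! j \<notin> VX ` B \<union> VY ` A"
      using disjoint by auto
    moreover have "\<exists>b\<in>B. \<exists>a\<in>A. u = xy b a \<or> u = xy a b" if "i \<in> {..<length l}" "u \<in> keys (h i)" for i u
      using edge_ideal_hom_2(3)[OF hQ[OF that(1)] that(2)] by blast
    moreover have "B \<inter> A = {}"
      using disjoint by blast
    ultimately have "lookup (h j) (xy b a) = 0"
      using no_linear_syzygy_aux[OF _ inj _ _ syz _ _ ab(2,1)] j by simp
    then show ?thesis
      using edge_ideal_hom_2(2)[OF hQ ab] j by simp
  qed
  note coeffs = this
  have "h j = (\<Sum>(a, b)\<in>A \<times> B. const_poly (lookup (h j) (xy a b)) * edge_binomial a b)"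
    by (rule edge_ideal_hom_2(1)) (use j hQ in simp_all)
  also have "\<dots> = 0"
    using coeffs by (intro sum.neutral) (auto simp: const_poly_def)
  finally show "h j = 0" .
qed

lemma edge_ideal_hom_1:
  assumes "f \<in> edge_ideal" "f \<in> hom_polys N d" "d < 2"
  shows "f = 0"
proof -
  obtain c where c: "f = (\<Sum>(a, b)\<in>A \<times> B. c a b * edge_binomial a b)"
    "\<And>a b. a \<in> A \<Longrightarrow> b \<in> B \<Longrightarrow> c a b \<in> hom_polys N (d - 2)"
    using edge_ideal_hom[OF assms(1,2)] by auto
  have "c a b = 0" if "a \<in> A" "b \<in> B" for a b
    using hom_polys_neg[OF c(2)[OF that]] assms(3) by simp
  then show ?thesis
    unfolding c(1) by (intro sum.neutral) auto
qed

text \<open>In the Koszul complex F_{i-1} is generated in degree i - 1, so the boundary of a cycle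
  has coordinates in the edge ideal of degree 1 (row 0) or 2 (row 1). The former are zero, the
  latter would form a linear syzygy; hence the cycle is already one in the exact complex. In row 1
  the case i = 1 is excluded because the generators live there.\<close>

lemma tor_vanishes_linear_strand:
  fixes F :: "'k::field free_complex"
  assumes F: "resolution N F" and i: "i \<noteq> 0" and d: "d = int i \<or> d = int i + 1 \<and> i \<noteq> 1"
  shows "tor_vanishes N F edge_ideal i d"
proof -
  obtain ws where ws: "distinct ws" "set ws = vars N"
    using finite_distinct_list[OF finite_vars] by blast
  let ?G = "koszul ws :: 'k free_complex"
  interpret G: resolution N ?G
    using ws by (rule resolution_koszul)
  obtain k where k: "i = Suc k"
    using i by (cases i) auto
  have "tor_vanishes N ?G edge_ideal i d"
  proof (rule tor_vanishesI[OF hideal_edge_ideal])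
    fix z assume z: "z \<in> G.part i d" "in_ideal edge_ideal ?G (i - 1) (diff ?G i z)"
    have dz: "bdry ?G k z \<in> G.part k d"
      using z(1) k G.bdry_part by blast
    then have hom: "bdry ?G k z b \<in> hom_polys N (d - int k)" if "b < rk ?G k" for b
      using that by (simp add: part_iff)
    have J: "bdry ?G k z b \<in> edge_ideal" if "b < rk ?G k" for b
      using z(2) that by (simp add: k in_ideal_def)
    have "bdry ?G k z = 0"
      using d
    proof (elim disjE conjE)
      assume d: "d = int i"
      show ?thesis
      proof
        fix b show "bdry ?G k z b = 0 b"
          using edge_ideal_hom_1[OF J hom] by (cases "b < rk ?G k") (simp_all add: d k bdry_outside)
      qed
    next
      assume d: "d = int i + 1" "i \<noteq> 1"
      then obtain k' where k': "k = Suc k'"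
        using k by (cases k) auto
      show ?thesis
      proof (rule koszul_no_cycles[where Q = "edge_ideal \<inter> hom_polys N 2" and k = k' and ws = ws])
        show "\<forall>j<length l. h j = 0" if "distinct l" "set l \<subseteq> vars N"
          "\<And>j. j < length l \<Longrightarrow> h j \<in> edge_ideal \<inter> hom_polys N 2"
          "(\<Sum>j<length l. var_poly (l ! j) * h j) = 0" for l and h :: "nat \<Rightarrow> 'k mpoly"
          using no_linear_syzygy[OF that(1,3,4)] .
        show "bdry ?G k z \<in> free_module N ?G (Suc k')"
          using free_moduleI[OF dz] k' by simp
        show "bdry ?G k z b \<in> edge_ideal \<inter> hom_polys N 2" if "b < rk ?G (Suc k')" for b
          using J[of b] hom[of b] that k' d k by simp
        have "z \<in> free_module N ?G (Suc k)"
          using free_moduleI[OF z(1)] k by simp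
        from G.diff_bdry[OF this] show "bdry ?G k' (bdry ?G k z) = 0"
          by (simp add: k')
      qed (use ws in auto)
    qed
    then obtain u where "u \<in> G.part (Suc i) d" "bdry ?G i u = z"
      using G.exact_Suc[of z k d] z(1) k by blast
    then show "\<exists>u w. u \<in> G.part (Suc i) d \<and> w \<in> G.part i d \<and> in_ideal edge_ideal ?G i w \<and> z = bdry ?G i u + w"
      by (metis add.right_neutral in_ideal_zero[OF hideal_edge_ideal] part_zero)
  qed
  then show ?thesis
    using tor_vanishes_transfer[OF F G.resolution_axioms hideal_edge_ideal] by blast
qed

end

section \<open>Dimensions\<close>

text \<open>The family \<open>v\<close> represents a basis of V/U; a basis of \<open>U\<close> is
  extended by it one vector at a time.\<close>

lemma (in vector_space) dim_eq_dim_plus_card: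
  fixes v :: "'e \<Rightarrow> 'b" and E :: "'e set"
  assumes U: "subspace U" "U \<subseteq> span S" "finite S" and V: "subspace V" "U \<subseteq> V"
    and E: "finite E" "\<And>e. e \<in> E \<Longrightarrow> v e \<in> V"
    and indep: "\<And>k. (\<Sum>e\<in>E. k e *s v e) \<in> U \<Longrightarrow> \<forall>e\<in>E. k e = 0"
    and spanning: "\<And>x. x \<in> V \<Longrightarrow> \<exists>k. x - (\<Sum>e\<in>E. k e *s v e) \<in> U"
  shows "dim V = dim U + card E"
proof -
  obtain B where B: "B \<subseteq> U" "independent B" "U \<subseteq> span B" "card B = dim U"
    using basis_exists by blast
  have finB: "finite B"
    using independent_span_bound[OF U(3) B(2)] B(1) U(2) by blast
  have spanB: "span B = U"
    using B(1,3) U(1) span_minimal by blast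
  have zero: "\<forall>e\<in>E'. k e = 0" if "E' \<subseteq> E" "(\<Sum>e\<in>E'. k e *s v e) \<in> U" for E' k
  proof -
    have "(\<Sum>e\<in>E'. k e *s v e) = (\<Sum>e\<in>E. (if e \<in> E' then k e else 0) *s v e)"
      using E(1) that(1) by (intro sum.mono_neutral_cong_left) auto
    then have "\<forall>e\<in>E. (if e \<in> E' then k e else 0) = 0"
      using indep[of "\<lambda>e. if e \<in> E' then k e else 0"] that(2) by simp
    then show ?thesis
      using that(1) by (metis subsetD)
  qed
  \<comment> \<open>The span is carried along explicitly: membership of the next vector in it would
    be a linear relation modulo \<open>U\<close>.\<close>
  have "finite E' \<Longrightarrow> E' \<subseteq> E \<Longrightarrow> independent (B \<union> v ` E') \<and> card (B \<union> v ` E') = card B + card E' \<and>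
      span (B \<union> v ` E') = {x + (\<Sum>e\<in>E'. k e *s v e) | x k. x \<in> U}" for E'
  proof (induction E' rule: finite_induct)
    case empty
    then show ?case
      using B(2) spanB by simp
  next
    case (insert e E')
    then have IH: "independent (B \<union> v ` E')" "card (B \<union> v ` E') = card B + card E'"
      "span (B \<union> v ` E') = {x + (\<Sum>e\<in>E'. k e *s v e) | x k. x \<in> U}"
      by auto
    have e: "v e \<notin> span (B \<union> v ` E')"
    proof
      assume "v e \<in> span (B \<union> v ` E')"
      then obtain x k where x: "x \<in> U" "v e = x + (\<Sum>e\<in>E'. k e *s v e)"
        unfolding IH(3) by blast
      have "(\<Sum>e'\<in>insert e E'. (if e' = e then 1 else - k e') *s v e')
          = v e + (\<Sum>e'\<in>E'. (if e' = e then 1 else - k e') *s v e')"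
        using insert.hyps by simp
      also have "(\<Sum>e'\<in>E'. (if e' = e then 1 else - k e') *s v e') = (\<Sum>e'\<in>E'. - (k e' *s v e'))"
        using insert.hyps by (intro sum.cong) auto
      also have "\<dots> = - (\<Sum>e'\<in>E'. k e' *s v e')"
        by (rule sum_negf)
      finally have "(\<Sum>e'\<in>insert e E'. (if e' = e then 1 else - k e') *s v e') \<in> U"
        using x by simp
      then have "(if e = e then 1 else - k e) = (0 :: 'a)"
        using zero[OF insert.prems, of "\<lambda>e'. if e' = e then 1 else - k e'"] by blast
      then show False
        by simp
    qed
    have "independent (insert (v e) (B \<union> v ` E'))"
      using e IH(1) by (rule independent_insertI)
    moreover have "card (insert (v e) (B \<union> v ` E')) = Suc (card (B \<union> v ` E'))"
      using e span_base finB insert.hyps(1) by (intro card_insert_disjoint) auto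
    moreover have "span (insert (v e) (B \<union> v ` E')) = {x + (\<Sum>e\<in>insert e E'. k e *s v e) | x k. x \<in> U}"
    proof (intro equalityI subsetI)
      fix y assume "y \<in> span (insert (v e) (B \<union> v ` E'))"
      then obtain c where "y - c *s v e \<in> span (B \<union> v ` E')"
        unfolding span_insert by blast
      then obtain x k where x: "x \<in> U" "y - c *s v e = x + (\<Sum>e\<in>E'. k e *s v e)"
        unfolding IH(3) by blast
      have "(\<Sum>e'\<in>insert e E'. (k(e := c)) e' *s v e') = c *s v e + (\<Sum>e'\<in>E'. k e' *s v e')"
        using insert.hyps by (auto intro!: sum.cong)
      then have "y = x + (\<Sum>e'\<in>insert e E'. (k(e := c)) e' *s v e')"
        using x(2) by (simp add: algebra_simps)
      then show "y \<in> {x + (\<Sum>e\<in>insert e E'. k e *s v e) | x k. x \<in> U}"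
        using x(1) by blast
    next
      fix y assume "y \<in> {x + (\<Sum>e\<in>insert e E'. k e *s v e) | x k. x \<in> U}"
      then obtain x k where x: "x \<in> U" "y = x + (\<Sum>e\<in>insert e E'. k e *s v e)"
        by blast
      have "y - k e *s v e = x + (\<Sum>e\<in>E'. k e *s v e)"
        using x(2) insert.hyps by simp
      then have "y - k e *s v e \<in> span (B \<union> v ` E')"
        unfolding IH(3) using x(1) by blast
      then show "y \<in> span (insert (v e) (B \<union> v ` E'))"
        unfolding span_insert by blast
    qed
    ultimately show ?case
      using IH(2) insert.hyps by simp
  qed
  from this[OF E(1) subset_refl]
  have ind: "independent (B \<union> v ` E)" and card: "card (B \<union> v ` E) = card B + card E"
    and span: "span (B \<union> v ` E) = {x + (\<Sum>e\<in>E. k e *s v e) | x k. x \<in> U}"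
    by auto
  have "B \<union> v ` E \<subseteq> V"
    using B(1) V(2) E(2) by blast
  moreover have "V \<subseteq> span (B \<union> v ` E)"
  proof
    fix x assume "x \<in> V"
    then obtain k where "x - (\<Sum>e\<in>E. k e *s v e) \<in> U"
      using spanning by blast
    moreover have "x = (x - (\<Sum>e\<in>E. k e *s v e)) + (\<Sum>e\<in>E. k e *s v e)"
      by simp
    ultimately show "x \<in> span (B \<union> v ` E)"
      unfolding span by blast
  qed
  ultimately show ?thesis
    using dim_unique[OF _ _ ind] card B(4) by simp
qed

lemma vscale_eq_smult: "vscale c v = smult (const_poly c) v"
  by (simp add: vscale_def smult_def)

lemma finite_mons_of_deg: "finite {t \<in> mons N. mon_deg t = e}"
proof -
  let ?S = "{t \<in> mons N. mon_deg t = e}"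
  have "lookup t v \<le> e" if "t \<in> ?S" for t v
  proof (cases "v \<in> keys t")
    case True
    then have "lookup t v \<le> mon_deg t"
      unfolding mon_deg_def by (intro member_le_sum) auto
    then show ?thesis
      using that by simp
  qed (simp add: in_keys_iff)
  moreover have "lookup t v = 0" if "t \<in> ?S" "v \<notin> vars N" for t v
    using that by (auto simp: mons_def in_keys_iff)
  ultimately have "lookup ` ?S \<subseteq> {f. \<forall>v. (v \<in> vars N \<longrightarrow> f v \<in> {..e}) \<and> (v \<notin> vars N \<longrightarrow> f v = 0)}"
    by auto
  moreover have "finite {f. \<forall>v. (v \<in> vars N \<longrightarrow> f v \<in> {..e}) \<and> (v \<notin> vars N \<longrightarrow> f v = 0)}"
    by (rule finite_set_of_finite_funs) simp_all
  ultimately have "finite (lookup ` ?S)"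
    by (rule finite_subset)
  then show ?thesis
    by (rule finite_imageD) (auto simp: inj_on_def poly_mapping.lookup_inject)
qed

lemma part_sum:
  assumes "\<And>e. e \<in> E \<Longrightarrow> f e \<in> free_module_part N F i d"
  shows "sum f E \<in> free_module_part N F i d"
  using assms by (induction E rule: infinite_finite_induct) (simp_all only: sum.infinite sum.empty
      sum.insert not_False_eq_True part_zero part_add insert_iff simp_thms)

text \<open>The difference of dimensions measures the quotient only in finite dimension. Each degree
  part is spanned by finitely many monomial multiples of basis vectors.\<close>

lemma part_finite_dim: "\<exists>S. finite S \<and> free_module_part N F i d \<subseteq> coord.span S"
proof -
  define umon where "umon b t = (\<lambda>a. if a = b then single t 1 else 0 :: 'a mpoly)" for b :: nat and t
  define T where "T b = {t \<in> mons N. mon_deg t = nat (d - gdeg F i b)}" for b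
  let ?S = "\<Union>b<rk F i. umon b ` T b"
  have "v \<in> coord.span ?S" if v: "v \<in> free_module_part N F i d" for v
  proof -
    have "v = (\<Sum>b<rk F i. \<Sum>t\<in>keys (v b). vscale (lookup (v b) t) (umon b t))"
    proof
      fix a
      have sum_apply: "(\<Sum>x\<in>X. f x) a = (\<Sum>x\<in>X. f x a)" for f :: "'x \<Rightarrow> nat \<Rightarrow> 'a mpoly" and X a
        by (induction X rule: infinite_finite_induct) auto
      have "(\<Sum>t\<in>keys (v b). vscale (lookup (v b) t) (umon b t)) a = (if a = b then v b else 0)" for b
        using poly_eq_sum_monomials[of "v b"]
        by (cases "a = b") (simp_all add: sum_apply vscale_def umon_def const_poly_def mult_single)
      then show "v a = (\<Sum>b<rk F i. \<Sum>t\<in>keys (v b). vscale (lookup (v b) t) (umon b t)) a"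
        using v by (simp add: sum_apply part_iff)
    qed
    also have "\<dots> \<in> coord.span ?S"
    proof (intro coord.span_sum coord.span_scale coord.span_base)
      fix b t assume bt: "b \<in> {..<rk F i}" "t \<in> keys (v b)"
      then have "v b \<in> hom_polys N (d - gdeg F i b)"
        using v by (simp add: part_iff)
      then have "t \<in> T b"
        using bt(2) unfolding T_def hom_polys_def polys_iff by auto
      then show "umon b t \<in> ?S"
        using bt(1) by blast
    qed
    finally show ?thesis .
  qed
  moreover have "finite ?S"
    by (auto simp: T_def finite_mons_of_deg)
  ultimately show ?thesis
    by blast
qed

context resolution
begin

lemma tor_boundaries_subset_cycles:
  assumes "hideal N I"
  shows "tor_boundaries N F I i d \<subseteq> tor_cycles N F I i d"
proof
  fix z assume "z \<in> tor_boundaries N F I i d"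
  then obtain u w where uw: "u \<in> part (Suc i) d" "w \<in> part i d" "in_ideal I F i w" "z = bdry F i u + w"
    unfolding tor_boundaries_eq by blast
  have "diff F i z = diff F i w"
    using diff_bdry[OF free_moduleI[OF uw(1)]] by (simp add: uw(4) diff_add)
  then show "z \<in> tor_cycles N F I i d"
    using diff_in_ideal[OF assms uw(3)] bdry_part[OF uw(1)] uw(2,4) by (simp add: tor_cycles_eq[OF assms])
qed

lemma dim_eq_if_tor_vanishes:
  assumes "hideal N I" "tor_vanishes N F I i d"
  shows "coord.dim (tor_cycles N F I i d) - coord.dim (tor_boundaries N F I i d) = 0"
proof -
  have "tor_cycles N F I i d = tor_boundaries N F I i d"
    using tor_boundaries_subset_cycles[OF assms(1)] assms(2) unfolding tor_vanishes_def by blast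
  then show ?thesis
    by simp
qed

lemma part_vscale: "v \<in> part i d \<Longrightarrow> vscale c v \<in> part i d"
  by (drule part_smult[OF hom_polys_const[of c]]) (simp add: vscale_eq_smult)

lemma subspace_tor_cycles:
  assumes "hideal N I"
  shows "coord.subspace (tor_cycles N F I i d)"
  unfolding coord.subspace_def tor_cycles_eq[OF assms]
  using assms in_ideal_add[OF assms] diff_add[of F i] part_vscale
  by (auto simp: vscale_eq_smult diff_smult in_ideal_def hideal_zero hideal_mult)
    (metis diff_0 diff_diff diff_self hideal_zero zero_fun_apply)

lemma subspace_tor_boundaries:
  assumes "hideal N I"
  shows "coord.subspace (tor_boundaries N F I i d)"
  unfolding coord.subspace_def
proof (intro conjI ballI allI)
  show "0 \<in> tor_boundaries N F I i d"
    unfolding tor_boundaries_eq mem_Collect_eq using in_ideal_zero[OF assms]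
    by (intro exI[of _ 0]) simp
next
  fix y z assume "y \<in> tor_boundaries N F I i d" "z \<in> tor_boundaries N F I i d"
  then obtain u w u' w' where "u \<in> part (Suc i) d" "w \<in> part i d" "in_ideal I F i w" "y = bdry F i u + w"
    "u' \<in> part (Suc i) d" "w' \<in> part i d" "in_ideal I F i w'" "z = bdry F i u' + w'"
    unfolding tor_boundaries_eq by blast
  then show "y + z \<in> tor_boundaries N F I i d"
    unfolding tor_boundaries_eq mem_Collect_eq using in_ideal_add[OF assms]
    by (intro exI[of _ "u + u'"] exI[of _ "w + w'"]) (simp add: bdry_add)
next
  fix c z assume "z \<in> tor_boundaries N F I i d"
  then obtain u w where uw: "u \<in> part (Suc i) d" "w \<in> part i d" "in_ideal I F i w" "z = bdry F i u + w"
    unfolding tor_boundaries_eq by blast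
  have "vscale c z = bdry F i (vscale c u) + vscale c w"
    by (simp add: uw(4) vscale_eq_smult bdry_smult) (simp add: fun_eq_iff distrib_left)
  moreover have "in_ideal I F i (vscale c w)"
    using uw(3) hideal_mult[OF assms] by (simp add: in_ideal_def vscale_eq_smult)
  ultimately show "vscale c z \<in> tor_boundaries N F I i d"
    unfolding tor_boundaries_eq mem_Collect_eq using uw(1,2) part_vscale by blast
qed

lemma dim_tor_cycles:
  fixes E :: "'e set"
  assumes I: "hideal N I" and E: "finite E" "\<And>e. e \<in> E \<Longrightarrow> v e \<in> tor_cycles N F I i d"
    and "\<And>k. (\<Sum>e\<in>E. vscale (k e) (v e)) \<in> tor_boundaries N F I i d \<Longrightarrow> \<forall>e\<in>E. k e = 0"
    and "\<And>x. x \<in> tor_cycles N F I i d \<Longrightarrow> \<exists>k. x - (\<Sum>e\<in>E. vscale (k e) (v e)) \<in> tor_boundaries N F I i d"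
  shows "coord.dim (tor_cycles N F I i d) - coord.dim (tor_boundaries N F I i d) = card E"
proof -
  obtain S where S: "finite S" "part i d \<subseteq> coord.span S"
    using part_finite_dim by blast
  have "tor_boundaries N F I i d \<subseteq> part i d"
    using tor_boundaries_subset_cycles[OF I, of i d] unfolding tor_cycles_eq[OF I] by blast
  then have "tor_boundaries N F I i d \<subseteq> coord.span S"
    using S(2) by blast
  then have "coord.dim (tor_cycles N F I i d) = coord.dim (tor_boundaries N F I i d) + card E"
    using coord.dim_eq_dim_plus_card[OF subspace_tor_boundaries[OF I] _ S(1) subspace_tor_cycles[OF I]
        tor_boundaries_subset_cycles[OF I] E assms(4,5)] by blast
  then show ?thesis
    by simp
qed

section \<open>Homological degrees zero and one\<close>

lemma augmentation_in_ideal: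
  assumes "\<And>f. f \<in> I \<Longrightarrow> lookup f 0 = 0" "in_ideal I F 0 w"
  shows "augmentation F w = 0"
  using assms by (simp add: augmentation_def in_ideal_def)

text \<open>The augmentation identifies Tor_0 in degree 0 with K: on degree 0 its kernel is the
  space of boundaries, because elements of \<open>I\<close> have no constant term.\<close>

lemma dim_tor_0_0:
  assumes I: "hideal N I" "\<And>f. f \<in> I \<Longrightarrow> lookup f 0 = 0"
  shows "coord.dim (tor_cycles N F I 0 0) - coord.dim (tor_boundaries N F I 0 0) = 1"
proof -
  obtain g where g: "g \<in> part 0 0" "augmentation F g = 1"
    by (rule generator_0)
  have cycles: "tor_cycles N F I 0 0 = part 0 0"
    by (simp add: tor_cycles_def)
  have bdry: "z \<in> tor_boundaries N F I 0 0 \<longleftrightarrow> augmentation F z = 0" if z: "z \<in> part 0 0" for z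
  proof
    assume "z \<in> tor_boundaries N F I 0 0"
    then obtain u w where "u \<in> part (Suc 0) 0" "in_ideal I F 0 w" "z = bdry F 0 u + w"
      unfolding tor_boundaries_eq by blast
    then show "augmentation F z = 0"
      using augmentation_bdry[OF free_moduleI] augmentation_in_ideal[OF I(2)] by (simp add: augmentation_add)
  next
    assume "augmentation F z = 0"
    then obtain u where "u \<in> part (Suc 0) 0" "bdry F 0 u = z"
      using exact_0[OF z] by blast
    then show "z \<in> tor_boundaries N F I 0 0"
      unfolding tor_boundaries_eq mem_Collect_eq using in_ideal_zero[OF I(1)]
      by (intro exI[of _ u] exI[of _ 0]) simp
  qed
  have aug: "augmentation F (vscale c g) = c" for c
    by (simp add: vscale_eq_smult augmentation_smult g const_poly_def)
  have "coord.dim (tor_cycles N F I 0 0) - coord.dim (tor_boundaries N F I 0 0) = card {()}"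
  proof (rule dim_tor_cycles[OF I(1), where v = "\<lambda>_. g"])
    fix k assume "(\<Sum>e\<in>{()}. vscale (k e) g) \<in> tor_boundaries N F I 0 0"
    then show "\<forall>e\<in>{()}. k e = 0"
      using bdry[OF part_vscale[OF g(1)]] aug by simp
  next
    fix x assume "x \<in> tor_cycles N F I 0 0"
    then have x: "x \<in> part 0 0"
      by (simp add: cycles)
    have "x - vscale (augmentation F x) g \<in> tor_boundaries N F I 0 0"
      using bdry[of "x - vscale (augmentation F x) g"] x part_vscale[OF g(1)] aug by (simp add: augmentation_diff)
    then show "\<exists>k. x - (\<Sum>e\<in>{()}. vscale (k e) g) \<in> tor_boundaries N F I 0 0"
      by (intro exI[of _ "\<lambda>_. augmentation F x"]) simp
  qed (simp_all add: cycles g)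
  then show ?thesis
    by simp
qed

text \<open>\<open>Tor\<^sub>1\<close> is \<open>I/\<mm>I\<close>: a cycle \<open>z\<close> corresponds to the image of \<open>\<partial>z \<in> IF\<^sub>0\<close> in \<open>I \<otimes> K\<close>,
  which is the class of the following element of \<open>I\<close>.\<close>

definition tor_1_class :: "(nat \<Rightarrow> 'k mpoly) \<Rightarrow> 'k mpoly" where
  "tor_1_class z = (\<Sum>b<rk F 0. const_poly (aug F b) * bdry F 0 z b)"

lemma tor_1_class_add: "tor_1_class (y + z) = tor_1_class y + tor_1_class z"
  by (simp add: tor_1_class_def bdry_add distrib_left sum.distrib)

lemma tor_1_class_smult: "tor_1_class (smult p z) = p * tor_1_class z"
  by (simp add: tor_1_class_def bdry_smult sum_distrib_left mult.left_commute)

lemma tor_1_class_diff: "tor_1_class (y - z) = tor_1_class y - tor_1_class z"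
  by (simp add: tor_1_class_def bdry_diff right_diff_distrib sum_subtractf)

lemma tor_1_class_sum: "tor_1_class (sum f E) = (\<Sum>e\<in>E. tor_1_class (f e))"
proof -
  have "tor_1_class 0 = 0"
    by (simp add: tor_1_class_def)
  then show ?thesis
    by (induction E rule: infinite_finite_induct)
      (simp_all only: sum.infinite sum.empty sum.insert not_False_eq_True tor_1_class_add)
qed

lemma aug_hom:
  assumes "w \<in> part 0 d" "b < rk F 0"
  shows "const_poly (aug F b) * w b \<in> hom_polys N d"
proof (cases "aug F b = 0")
  case True
  then show ?thesis
    by (simp add: const_poly_def)
next
  case False
  have "w b \<in> hom_polys N (d - gdeg F 0 b)"
    using assms by (simp add: part_iff)
  then have "w b \<in> hom_polys N d"
    by (simp add: gdeg_0[OF assms(2) False])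
  then show ?thesis
    using hom_polys_mult[OF hom_polys_const, of "w b" N d "aug F b"] by simp
qed

lemma tor_1_class_hom: "z \<in> part (Suc 0) d \<Longrightarrow> tor_1_class z \<in> hom_polys N d"
  unfolding tor_1_class_def using aug_hom[OF bdry_part] by (intro hom_polys_sum) simp

lemma tor_1_class_in_ideal:
  "hideal N I \<Longrightarrow> in_ideal I F 0 (bdry F 0 z) \<Longrightarrow> tor_1_class z \<in> I"
  unfolding tor_1_class_def in_ideal_def by (intro hideal_sum hideal_mult) simp_all

text \<open>Injectivity of the map from Tor_1 to I modulo its product with the maximal ideal: the
  coefficients \<open>c e\<close> without constant term witness that the class of \<open>z\<close>
  is zero there.\<close>

lemma tor_1_kernel:
  assumes I: "hideal N I" and z: "z \<in> part (Suc 0) d" "in_ideal I F 0 (bdry F 0 z)"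
    and h: "finite E" "\<And>e. e \<in> E \<Longrightarrow> h e \<in> I \<inter> hom_polys N l"
    and c: "\<And>e. e \<in> E \<Longrightarrow> c e \<in> hom_polys N (d - l)" "\<And>e. e \<in> E \<Longrightarrow> lookup (c e) 0 = 0"
    and eq: "tor_1_class z = (\<Sum>e\<in>E. c e * h e)"
  shows "z \<in> tor_boundaries N F I (Suc 0) d"
proof -
  obtain g where g: "g \<in> part 0 0" "augmentation F g = 1"
    by (rule generator_0)
  let ?w = "bdry F 0 z"
  have w: "?w \<in> part 0 d"
    using z(1) by (rule bdry_part)
  have "\<exists>q. q \<in> part (Suc 0) (gdeg F 0 b) \<and> bdry F 0 q = vunit b - smult (const_poly (aug F b)) g"
    if b: "b < rk F 0" for b
  proof -
    have "smult (const_poly (aug F b)) g \<in> part 0 (gdeg F 0 b)"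
    proof (cases "aug F b = 0")
      case True
      then have "smult (const_poly (aug F b)) g = 0"
        by (simp add: const_poly_def fun_eq_iff)
      then show ?thesis by simp
    next
      case False
      then show ?thesis
        using part_smult[OF hom_polys_const g(1), of "aug F b"] gdeg_0[OF b] by simp
    qed
    then have "vunit b - smult (const_poly (aug F b)) g \<in> part 0 (gdeg F 0 b)"
      using part_vunit[OF b] by simp
    moreover have "augmentation F (vunit b) = (\<Sum>b'<rk F 0. if b' = b then aug F b else 0)"
      unfolding augmentation_def vunit_def by (intro sum.cong) auto
    then have "augmentation F (vunit b - smult (const_poly (aug F b)) g) = 0"
      using b by (simp add: augmentation_diff augmentation_smult g const_poly_def)
    ultimately show ?thesis
      using exact_0 by metis
  qed
  then obtain q where q: "\<And>b. b < rk F 0 \<Longrightarrow> q b \<in> part (Suc 0) (gdeg F 0 b) \<and>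
      bdry F 0 (q b) = vunit b - smult (const_poly (aug F b)) g"
    by metis
  have "\<exists>r. r \<in> part (Suc 0) (d - l) \<and> bdry F 0 r = smult (c e) g" if e: "e \<in> E" for e
  proof -
    have "smult (c e) g \<in> part 0 (d - l)"
      using part_smult[OF c(1)[OF e] g(1)] by simp
    moreover have "augmentation F (smult (c e) g) = 0"
      using c(2)[OF e] by (simp add: augmentation_smult)
    ultimately show ?thesis
      using exact_0 by metis
  qed
  then obtain r where r: "\<And>e. e \<in> E \<Longrightarrow> r e \<in> part (Suc 0) (d - l) \<and> bdry F 0 (r e) = smult (c e) g"
    by metis
  \<comment> \<open>A vector with coordinates in \<open>I\<close> and the same boundary as
    \<open>z\<close>. The part \<open>?y1\<close> accounts for the difference between d z and its
    class times \<open>g\<close>, the part \<open>?y2\<close> for the class times \<open>g\<close>;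
    then \<open>z\<close> minus their sum is a cycle of \<open>F\<close>.\<close>
  let ?y1 = "lin (rk F 0) q ?w" and ?y2 = "\<Sum>e\<in>E. smult (h e) (r e)"
  have sum_apply: "(\<Sum>x\<in>X. f x) a = (\<Sum>x\<in>X. f x a)" for f :: "'x \<Rightarrow> nat \<Rightarrow> 'k mpoly" and X a
    by (induction X rule: infinite_finite_induct) auto
  have bdry_sum: "bdry F 0 (\<Sum>e\<in>E'. f e) = (\<Sum>e\<in>E'. bdry F 0 (f e))" for f :: "'e \<Rightarrow> nat \<Rightarrow> 'k mpoly" and E'
    by (induction E' rule: infinite_finite_induct)
      (simp_all only: sum.infinite sum.empty sum.insert not_False_eq_True bdry_add bdry_zero)
  have "bdry F 0 ?y1 = lin (rk F 0) (\<lambda>b. vunit b - smult (const_poly (aug F b)) g) ?w"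
    unfolding bdry_lin using q by (intro lin_cong) blast
  also have "\<dots> = ?w - smult (tor_1_class z) g"
  proof -
    have "lin (rk F 0) (\<lambda>b. smult (const_poly (aug F b)) g) ?w = smult (tor_1_class z) g"
      by (simp add: lin_def tor_1_class_def fun_eq_iff sum_distrib_left mult_ac)
    moreover have "lin (rk F 0) vunit ?w = ?w"
      by (rule lin_id) (rule bdry_outside)
    ultimately show ?thesis
      by (simp add: lin_diff_matrix)
  qed
  finally have "bdry F 0 ?y1 = ?w - smult (tor_1_class z) g" .
  moreover have "bdry F 0 ?y2 = smult (tor_1_class z) g"
  proof -
    have "bdry F 0 ?y2 = (\<Sum>e\<in>E. smult (h e) (smult (c e) g))"
      unfolding bdry_sum bdry_smult using r by (intro sum.cong) auto
    then show ?thesis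
      unfolding eq by (simp add: fun_eq_iff sum_apply sum_distrib_left mult_ac)
  qed
  ultimately have "bdry F 0 (z - (?y1 + ?y2)) = 0"
    by (simp add: bdry_diff bdry_add)
  moreover have "?y1 \<in> part (Suc 0) d"
    using lin_part[of F 0 q N F "Suc 0" 0, OF _ w] q by simp
  moreover have "smult (h e) (r e) \<in> part (Suc 0) d" if "e \<in> E" for e
    using part_smult[of "h e" N l "r e" F "Suc 0" "d - l"] h(2)[OF that] r[OF that] by simp
  then have "?y2 \<in> part (Suc 0) d"
    by (rule part_sum)
  ultimately have y: "?y1 + ?y2 \<in> part (Suc 0) d" and ker: "bdry F 0 (z - (?y1 + ?y2)) = 0"
    by simp_all
  obtain u where u: "u \<in> part (Suc (Suc 0)) d" "bdry F (Suc 0) u = z - (?y1 + ?y2)"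
    using exact_Suc[OF part_diff[OF z(1) y] ker] by blast
  have "q b a \<in> polys N" if "b < rk F 0" for a b
    using q[OF that] part_polys by blast
  then have "in_ideal I F (Suc 0) ?y1"
    using in_ideal_lin[OF I z(2), of q] by (simp add: in_ideal_def)
  moreover have "in_ideal I F (Suc 0) ?y2"
    unfolding in_ideal_def sum_apply
  proof (intro allI impI hideal_sum[OF I])
    fix b e assume "e \<in> E"
    then have "h e \<in> I" "r e b \<in> polys N"
      using h(2) r part_polys by blast+
    then show "smult (h e) (r e) b \<in> I"
      using hideal_mult[OF I, of "h e" "r e b"] by (simp add: mult.commute)
  qed
  ultimately have "in_ideal I F (Suc 0) (?y1 + ?y2)"
    by (rule in_ideal_add[OF I])
  moreover have "z = bdry F (Suc 0) u + (?y1 + ?y2)"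
    by (simp add: u(2))
  ultimately show ?thesis
    unfolding tor_boundaries_eq mem_Collect_eq using u(1) y by blast
qed

text \<open>The class is the sum of products \<epsilon>_c w_c, where \<epsilon>_c has no constant
  term. If the c-th generator has positive degree, w_c lies in \<open>I\<close> below its initial
  degree and is zero; otherwise \<epsilon>_c has degree at most 0 and is zero. Generators of degree
  <= 0 can occur because \<open>F\<close> may fail to be minimal.\<close>

lemma tor_1_class_boundary:
  assumes w: "w \<in> part (Suc 0) l" "in_ideal I F (Suc 0) w"
    and low: "\<And>f e. f \<in> I \<Longrightarrow> f \<in> hom_polys N e \<Longrightarrow> e < l \<Longrightarrow> f = 0"
  shows "tor_1_class w = 0"
proof -
  define \<epsilon> where "\<epsilon> c = (\<Sum>b<rk F 0. const_poly (aug F b) * entry F 0 b c)" for c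
  have \<epsilon>: "\<epsilon> c = tor_1_class (vunit c)" if "c < rk F (Suc 0)" for c
  proof -
    have "bdry F 0 (vunit c) b = entry F 0 b c" if "b < rk F 0" for b
      using that \<open>c < rk F (Suc 0)\<close>
      by (simp add: bdry_def vunit_def if_distrib[of "\<lambda>x. _ * x"] cong: if_cong)
    then show ?thesis
      by (simp add: \<epsilon>_def tor_1_class_def)
  qed
  have "tor_1_class w = (\<Sum>b<rk F 0. \<Sum>c<rk F (Suc 0). const_poly (aug F b) * entry F 0 b c * w c)"
    by (simp add: tor_1_class_def bdry_def sum_distrib_left mult.assoc)
  also have "\<dots> = (\<Sum>c<rk F (Suc 0). \<epsilon> c * w c)"
    unfolding \<epsilon>_def sum_distrib_right by (rule sum.swap)
  also have "\<dots> = 0"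
  proof (rule sum.neutral, rule ballI)
    fix c assume "c \<in> {..<rk F (Suc 0)}"
    then have c: "c < rk F (Suc 0)"
      by simp
    have wc: "w c \<in> I" "w c \<in> hom_polys N (l - gdeg F (Suc 0) c)"
      using w c by (simp_all add: in_ideal_def part_iff)
    have vc: "vunit c \<in> part (Suc 0) (gdeg F (Suc 0) c)"
      using c by (rule part_vunit)
    have hom: "\<epsilon> c \<in> hom_polys N (gdeg F (Suc 0) c)"
      unfolding \<epsilon>[OF c] using vc by (rule tor_1_class_hom)
    have const: "lookup (\<epsilon> c) 0 = 0"
    proof -
      have "lookup (\<epsilon> c) 0 = augmentation F (bdry F 0 (vunit c))"
        unfolding \<epsilon>[OF c] tor_1_class_def augmentation_def
        by (simp add: lookup_sum lookup_mult_zero const_poly_def mult.commute)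
      then show ?thesis
        using augmentation_bdry[OF free_moduleI[OF vc]] by simp
    qed
    show "\<epsilon> c * w c = 0"
    proof (cases "gdeg F (Suc 0) c > 0")
      case True
      then have "w c = 0"
        using low[OF wc] by simp
      then show ?thesis by simp
    next
      case False
      have "\<epsilon> c = 0"
      proof (cases "gdeg F (Suc 0) c = 0")
        case True
        then show ?thesis
          using hom_polys_0_const[of "\<epsilon> c" N] hom const by (simp add: const_poly_def)
      next
        case False
        then show ?thesis
          using hom_polys_neg[OF hom] \<open>\<not> gdeg F (Suc 0) c > 0\<close> by simp
      qed
      then show ?thesis by simp
    qed
  qed
  finally show ?thesis .
qed

end

section \<open>The Betti diagram\<close>

context complete_bipartite
begin

text \<open>The edge binomials form a basis of J modulo its product with the maximal ideal, all in
  degree two.\<close>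

lemma edge_ideal_tor_1:
  fixes F :: "'k::field free_complex"
  assumes F: "resolution N F"
  shows "d \<noteq> 2 \<Longrightarrow> tor_vanishes N F edge_ideal (Suc 0) d"
    and "coord.dim (tor_cycles N F edge_ideal (Suc 0) 2) - coord.dim (tor_boundaries N F edge_ideal (Suc 0) 2)
      = card (A \<times> B)"
proof -
  interpret F: resolution N F by fact
  let ?J = "edge_ideal :: 'k mpoly set" and ?f = "\<lambda>(a, b). edge_binomial a b :: 'k mpoly"
  note J = hideal_edge_ideal[where 'k = 'k]
  have cycles: "tor_cycles N F ?J (Suc 0) d = {z \<in> F.part (Suc 0) d. in_ideal ?J F 0 (bdry F 0 z)}" for d
    using tor_cycles_eq[OF J, of F "Suc 0" d] by simp
  have f: "?f e \<in> ?J \<inter> hom_polys N 2" if "e \<in> A \<times> B" for e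
    using that by (cases e) (simp add: edge_binomial_mem edge_binomial_hom')
  have kernel: "z \<in> tor_boundaries N F ?J (Suc 0) d"
    if z: "z \<in> tor_cycles N F ?J (Suc 0) d"
      and c: "F.tor_1_class z = (\<Sum>(a, b)\<in>A \<times> B. c a b * edge_binomial a b)"
        "\<And>a b. a \<in> A \<Longrightarrow> b \<in> B \<Longrightarrow> c a b \<in> hom_polys N (d - 2) \<and> lookup (c a b) 0 = 0" for z d c
  proof (rule F.tor_1_kernel[OF J, where E = "A \<times> B" and h = ?f and c = "case_prod c" and l = 2])
    show "F.tor_1_class z = (\<Sum>e\<in>A \<times> B. case_prod c e * ?f e)"
      unfolding c(1) by (intro sum.cong) auto
  qed (use z f c(2) in \<open>auto simp: cycles\<close>)
  show "tor_vanishes N F ?J (Suc 0) d" if "d \<noteq> 2"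
    unfolding tor_vanishes_def
  proof
    fix z assume z: "z \<in> tor_cycles N F ?J (Suc 0) d"
    then have "F.tor_1_class z \<in> ?J" "F.tor_1_class z \<in> hom_polys N d"
      using F.tor_1_class_in_ideal[OF J] F.tor_1_class_hom by (simp_all add: cycles)
    then obtain c where c: "F.tor_1_class z = (\<Sum>(a, b)\<in>A \<times> B. c a b * edge_binomial a b)"
      "\<And>a b. a \<in> A \<Longrightarrow> b \<in> B \<Longrightarrow> c a b \<in> hom_polys N (d - 2)"
      by (rule edge_ideal_hom) blast
    \<comment> \<open>The coefficients are homogeneous of degree d - 2, which is nonzero, so they
      lie in the maximal ideal.\<close>
    have "lookup (c a b) 0 = 0" if "a \<in> A" "b \<in> B" for a b
      using hom_polys_lookup[OF c(2)[OF that], of 0] \<open>d \<noteq> 2\<close> by simp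
    then show "z \<in> tor_boundaries N F ?J (Suc 0) d"
      using kernel[OF z c(1)] c(2) by blast
  qed
  obtain g where g: "g \<in> F.part 0 0" "augmentation F g = 1"
    by (rule F.generator_0)
  have "(\<Sum>b<rk F 0. const_poly (aug F b) * g b) = (1 :: 'k mpoly)"
  proof -
    let ?s = "\<Sum>b<rk F 0. const_poly (aug F b) * g b"
    have "?s \<in> hom_polys N 0"
      using F.aug_hom[OF g(1)] by (intro hom_polys_sum) simp
    moreover have "lookup ?s 0 = augmentation F g"
      by (simp add: lookup_sum lookup_mult_zero const_poly_def augmentation_def mult.commute)
    ultimately show ?thesis
      using hom_polys_0_const[of ?s N] g(2) by (simp add: const_poly_def)
  qed
  note g_class = this
  \<comment> \<open>Cycles representing the generators: f_e g has degree 2, so it is killed by the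
    augmentation and has a preimage in F_1.\<close>
  have "\<exists>v. v \<in> F.part (Suc 0) 2 \<and> bdry F 0 v = smult (?f e) g" if e: "e \<in> A \<times> B" for e
  proof -
    have "smult (?f e) g \<in> F.part 0 2"
      using part_smult[of "?f e" N 2 g F 0 0] f[OF e] g(1) by simp
    then show ?thesis
      using F.exact_0 F.augmentation_eq_0[of "smult (?f e) g" 2] by (metis zero_neq_numeral)
  qed
  then obtain v where v: "\<And>e. e \<in> A \<times> B \<Longrightarrow> v e \<in> F.part (Suc 0) 2 \<and> bdry F 0 (v e) = smult (?f e) g"
    by metis
  have v_class: "F.tor_1_class (v e) = ?f e" if "e \<in> A \<times> B" for e
  proof -
    have "F.tor_1_class (v e) = ?f e * (\<Sum>b<rk F 0. const_poly (aug F b) * g b)"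
      using v[OF that] by (simp add: F.tor_1_class_def sum_distrib_left mult.left_commute)
    then show ?thesis
      by (simp add: g_class)
  qed
  have sum_class: "F.tor_1_class (\<Sum>e\<in>A \<times> B. vscale (k e) (v e))
      = (\<Sum>(a, b)\<in>A \<times> B. const_poly (k (a, b)) * edge_binomial a b)" for k
    unfolding F.tor_1_class_sum vscale_eq_smult F.tor_1_class_smult
    using v_class by (intro sum.cong) auto
  have v_cycle: "v e \<in> tor_cycles N F ?J (Suc 0) 2" if e: "e \<in> A \<times> B" for e
  proof -
    have "in_ideal ?J F 0 (smult (?f e) g)"
      using hideal_mult[OF J, of "?f e"] f[OF e] part_polys[OF g(1)]
      by (simp add: in_ideal_def mult.commute)
    then show ?thesis
      using v[OF e] by (simp add: cycles)
  qed
  show "coord.dim (tor_cycles N F ?J (Suc 0) 2) - coord.dim (tor_boundaries N F ?J (Suc 0) 2) = card (A \<times> B)"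
  proof (rule F.dim_tor_cycles[OF J, where v = v])
    fix k assume "(\<Sum>e\<in>A \<times> B. vscale (k e) (v e)) \<in> tor_boundaries N F ?J (Suc 0) 2"
    then obtain u w where uw: "u \<in> F.part (Suc (Suc 0)) 2" "w \<in> F.part (Suc 0) 2" "in_ideal ?J F (Suc 0) w"
        "(\<Sum>e\<in>A \<times> B. vscale (k e) (v e)) = bdry F (Suc 0) u + w"
      unfolding tor_boundaries_eq by blast
    have "bdry F 0 (bdry F (Suc 0) u) = 0"
      using F.diff_bdry[OF free_moduleI[OF uw(1)]] by simp
    then have "F.tor_1_class (bdry F (Suc 0) u) = 0"
      by (simp add: F.tor_1_class_def)
    moreover have "F.tor_1_class w = 0"
      using F.tor_1_class_boundary[OF uw(2,3)] edge_ideal_hom_1 by blast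
    ultimately have zero: "(\<Sum>(a, b)\<in>A \<times> B. const_poly (k (a, b)) * edge_binomial a b) = (0 :: 'k mpoly)"
      unfolding sum_class[symmetric] uw(4) by (simp add: F.tor_1_class_add)
    have "k (a, b) = 0" if "a \<in> A" "b \<in> B" for a b
      using lookup_edge_binomial_sum_xy[OF that, of "\<lambda>a b. k (a, b)"] unfolding zero by simp
    then show "\<forall>e\<in>A \<times> B. k e = 0"
      by auto
  next
    fix x assume x: "x \<in> tor_cycles N F ?J (Suc 0) 2"
    define k where "k e = lookup (F.tor_1_class x) (xy (fst e) (snd e))" for e
    have "F.tor_1_class x \<in> ?J" "F.tor_1_class x \<in> hom_polys N 2"
      using x F.tor_1_class_in_ideal[OF J] F.tor_1_class_hom by (simp_all add: cycles)
    then have "F.tor_1_class x = (\<Sum>(a, b)\<in>A \<times> B. const_poly (k (a, b)) * edge_binomial a b)"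
      unfolding k_def fst_conv snd_conv by (rule edge_ideal_hom_2(1))
    then have "F.tor_1_class (x - (\<Sum>e\<in>A \<times> B. vscale (k e) (v e))) = 0"
      by (simp add: F.tor_1_class_diff sum_class)
    moreover have "x - (\<Sum>e\<in>A \<times> B. vscale (k e) (v e)) \<in> tor_cycles N F ?J (Suc 0) 2"
      using x v_cycle F.subspace_tor_cycles[OF J]
      by (intro coord.subspace_diff coord.subspace_sum coord.subspace_scale)
    ultimately have "x - (\<Sum>e\<in>A \<times> B. vscale (k e) (v e)) \<in> tor_boundaries N F ?J (Suc 0) 2"
      by (intro kernel[of _ 2 "\<lambda>a b. 0"]) auto
    then show "\<exists>k. x - (\<Sum>e\<in>A \<times> B. vscale (k e) (v e)) \<in> tor_boundaries N F ?J (Suc 0) 2"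
      by blast
  qed (use v_cycle in simp_all)
qed

text \<open>The last homological degrees allowed by the pieces are N - 1 for T(empty), 2|A| and 2|B|
  for the components, and N + |A| - 2 and N + |B| - 2 for T(A) and T(B) after the connecting map.
  For |A| > 1 the largest is N + |B| - 2 = 2|B| + |A| - 2. For |A| = 1 the pieces belonging to
  \<open>B\<close> drop out.\<close>

lemma tor_vanishes_edge_ideal:
  fixes F :: "'k::field free_complex"
  assumes F: "resolution N F" and AB: "A \<noteq> {}" "B \<noteq> {}" "card A \<le> card B"
    and i: "d \<noteq> int i \<and> d \<noteq> int i + 1 \<and> d \<noteq> int i + 2 \<or>
      (if card A = 1 then card B else 2 * card B + card A - 2) < i"
  shows "tor_vanishes N F edge_ideal i d"
proof -
  interpret F: resolution N F by fact
  let ?T = "minor_ideal N {} :: 'k mpoly set"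
  let ?VA = "var_ideal N (vertex_vars A) :: 'k mpoly set" and ?VB = "var_ideal N (vertex_vars B) :: 'k mpoly set"
  have N: "N = card A + card B"
    using card_Un_disjoint[OF _ _ disjoint] partition by simp
  have pos: "card A \<ge> 1" "card B \<ge> 1"
    using AB by (simp_all add: Suc_le_eq card_gt_0_iff)
  have sub: "A \<subseteq> {1..N}" "B \<subseteq> {1..N}" "A \<noteq> {1..N}" "B \<noteq> {1..N}" "{} \<noteq> {1..N}"
    using partition disjoint AB by blast+
  have vars: "vertex_vars U \<subseteq> vars N" if "U \<subseteq> {1..N}" for U
    using that unfolding vars_eq_vertex_vars vertex_vars_def by blast
  note ideals = hideal_minor_ideal[where 'a = 'k] hideal_var_ideal[where 'a = 'k]
  have hInt: "hideal N (I \<inter> I')" if "hideal N I" "hideal N I'" for I I' :: "'k mpoly set"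
    using that unfolding hideal_def by blast
  have T: "tor_vanishes N F ?T i d" if "d \<noteq> int i \<and> d \<noteq> int i + 1 \<or> N \<le> i"
    using F.tor_vanishes_minor_ideal[of "{}" d i] sub that by simp
  have sum1: "ideal_sum ?T ?VA = minor_ideal N A"
    by (rule minor_ideal_sum_var_ideal) simp
  have sum2: "ideal_sum (?T \<inter> ?VA) ?VB = minor_ideal N B"
    by (rule minor_ideal_sum_var_ideal[where A = A]) (use partition in simp)
  have TA: "tor_vanishes N F (?T \<inter> ?VA) i d"
    if "d \<noteq> int i \<and> d \<noteq> int i + 1 \<and> d \<noteq> int i + 2 \<or> N \<le> i \<and> N + card A \<le> Suc i \<and> 2 * card A < i"
  proof (rule F.tor_vanishes_Int)
    show "tor_vanishes N F (ideal_sum ?T ?VA) (Suc i) d"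
      unfolding sum1 using that sub by (intro F.tor_vanishes_minor_ideal) auto
    show "tor_vanishes N F ?T i d"
      using that T by blast
    show "tor_vanishes N F ?VA i d"
      using that vars[OF sub(1)] by (intro F.tor_vanishes_var_ideal) (auto simp: card_vertex_vars)
  qed (simp_all only: sum1 ideals hInt)
  have J: "tor_vanishes N F edge_ideal i d"
    if "d \<noteq> int i \<and> d \<noteq> int i + 1 \<and> d \<noteq> int i + 2 \<or>
      N \<le> i \<and> N + card A \<le> Suc i \<and> 2 * card A < i \<and> N + card B \<le> Suc i \<and> 2 * card B < i"
    unfolding edge_ideal_eq
  proof (rule F.tor_vanishes_Int)
    show "tor_vanishes N F (ideal_sum (?T \<inter> ?VA) ?VB) (Suc i) d"
      unfolding sum2 using that sub by (intro F.tor_vanishes_minor_ideal) auto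
    show "tor_vanishes N F (?T \<inter> ?VA) i d"
      using that TA by blast
    show "tor_vanishes N F ?VB i d"
      using that vars[OF sub(2)] by (intro F.tor_vanishes_var_ideal) (auto simp: card_vertex_vars)
  qed (simp_all only: sum2 ideals hInt)
  show ?thesis
  proof (cases "card A = 1")
    case False
    then show ?thesis
      using i pos AB(3) by (intro J) (auto simp: N)
  next
    case 1: True
    have single: "?T \<subseteq> var_ideal N (vertex_vars V)" if V: "card U = 1" "U \<union> V = {1..N}" for U V
    proof -
      obtain k where "U = {k}"
        using V(1) by (rule card_1_singletonE)
      then show ?thesis
        using V(2) by (intro minor_ideal_le_var_ideal[of N k]) auto
    qed
    have "?T \<subseteq> ?VB"
      using single[OF 1 partition] .
    then have eq: "edge_ideal = ?T \<inter> ?VA"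
      unfolding edge_ideal_eq by blast
    show ?thesis
    proof (cases "card B = 1")
      case True
      \<comment> \<open>For a single edge the contribution 2|A| = 2 would exceed p = 1, so the
        component of \<open>A\<close> has to drop out as well.\<close>
      have "?T \<subseteq> ?VA"
        using single[OF True] partition by blast
      then have "edge_ideal = ?T"
        unfolding eq by blast
      moreover have "d \<noteq> int i \<and> d \<noteq> int i + 1 \<or> N \<le> i"
        using i 1 True by (auto simp: N)
      ultimately show ?thesis
        using T by simp
    next
      case False
      then show ?thesis
        unfolding eq using i pos 1 by (intro TA) (auto simp: N)
    qed
  qed
qed

end

text \<open>The Koszul complex shows that a resolution exists, so the chosen one really is a
  resolution, and the same one serves for all ideals and bidegrees.\<close>

lemma graded_betti_eq:
  obtains F :: "'k::field free_complex" where "resolution N F"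
    and "\<And>I i j. graded_betti N I i j =
      coord.dim (tor_cycles N F I i (int i + j)) - coord.dim (tor_boundaries N F I i (int i + j))"
proof -
  obtain ws where "distinct ws" "set ws = vars N"
    using finite_distinct_list[OF finite_vars] by blast
  then have "\<exists>F :: 'k free_complex. graded_free_resolution N F"
    using resolution_koszul resolution.resolution by blast
  then have "graded_free_resolution N (SOME F :: 'k free_complex. graded_free_resolution N F)"
    by (rule someI_ex)
  then show ?thesis
    by (intro that[of "SOME F. graded_free_resolution N F"]) (simp_all add: resolution_def graded_betti_def Let_def)
qed

theorem theorem5p3:
  fixes m n p :: nat and J :: "'k::field mpoly set"
  assumes "1 \<le> n" and "n \<le> m"
    and "J = binomial_edge_ideal (m + n) (complete_bipartite_edges m n)"
    and "p = (if n = 1 then m else 2 * m + n - 2)"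
  shows "graded_betti (m + n) J 0 0 = 1 \<and>
    graded_betti (m + n) J 1 1 = m * n \<and>
    (\<forall>i j. (i, j) \<noteq> (0, 0) \<and> (i, j) \<noteq> (1, 1) \<and> \<not> (j = 2 \<and> 2 \<le> i \<and> i \<le> p) \<longrightarrow>
       graded_betti (m + n) J i j = 0)"
proof -
  let ?N = "m + n" and ?A = "{1..n}" and ?B = "{n+1..n+m}"
  interpret complete_bipartite ?N ?A ?B
    by unfold_locales auto
  have J: "J = edge_ideal"
    unfolding assms(3) by (rule binomial_edge_ideal_complete_bipartite)
  have hJ: "hideal ?N J"
    unfolding J by (rule hideal_edge_ideal)
  obtain F :: "'k free_complex" where F: "resolution ?N F" and betti: "\<And>I i j. graded_betti ?N I i j =
      coord.dim (tor_cycles ?N F I i (int i + j)) - coord.dim (tor_boundaries ?N F I i (int i + j))"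
    by (rule graded_betti_eq[where 'k = 'k and N = ?N]) blast
  interpret F: resolution ?N F by fact
  have "lookup f 0 = 0" if f: "f \<in> J" for f
  proof -
    have "0 \<notin> keys f"
      using f unfolding J edge_ideal_eq by (auto simp: var_ideal_iff)
    then show ?thesis
      by (simp add: in_keys_iff)
  qed
  then have "graded_betti ?N J 0 0 = 1"
    using F.dim_tor_0_0[OF hJ] by (simp add: betti)
  moreover have "graded_betti ?N J 1 1 = m * n"
    using edge_ideal_tor_1(2)[OF F] by (simp add: betti J)
  moreover have "graded_betti ?N J i j = 0"
    if ij: "(i, j) \<noteq> (0, 0)" "(i, j) \<noteq> (1, 1)" "\<not> (j = 2 \<and> 2 \<le> i \<and> i \<le> p)" for i j
  proof -
    \<comment> \<open>Row j of column i is internal degree i + j. Columns 0 and 1 and the rows 0 and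
      1 have arguments of their own; the last case covers the rows j other than 0, 1, 2 and the
      columns beyond p.\<close>
    consider "i = 0" "j \<noteq> 0" | "i = 1" "j \<noteq> 1" | "2 \<le> i" "j = 0 \<or> j = 1" | "2 \<le> i" "j \<noteq> 0" "j \<noteq> 1"
      using ij(1,2) by fastforce
    then have "tor_vanishes ?N F J i (int i + j)"
    proof cases
      case 1
      then show ?thesis
        using F.tor_vanishes_0[OF hJ, of j] by simp
    next
      case 2
      then show ?thesis
        using edge_ideal_tor_1(1)[OF F, of "1 + j"] by (simp add: J)
    next
      case 3
      then show ?thesis
        unfolding J by (intro tor_vanishes_linear_strand[OF F]) auto
    next
      case 4
      then have "int i + j \<noteq> int i \<and> int i + j \<noteq> int i + 1 \<and> int i + j \<noteq> int i + 2 \<or>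
          (if card ?A = 1 then card ?B else 2 * card ?B + card ?A - 2) < i"
        using ij(3) assms(4) by (cases "j = 2") (auto split: if_splits)
      then show ?thesis
        unfolding J using assms(1,2) by (intro tor_vanishes_edge_ideal[OF F]) simp_all
    qed
    then show ?thesis
      unfolding betti by (rule F.dim_eq_if_tor_vanishes[OF hJ])
  qed
  ultimately show ?thesis
    by blast
qed

end
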